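(* Let $\{\mathcal F,\mathcal G\}$ be a minimal Hilbert C*-system with $\mathcal G$ nonabelian and such that the fixed point algebra $\mathcal A$, with center $\mathcal Z$, satisfies Property B. For $D\in\widehat{\mathcal G}$ let $\alpha_D:=\rho_D|_{\mathcal Z}\in\mathrm{Aut}\,\mathcal Z$. (i) Let $D,D'\in\widehat{\mathcal G}$ be equivalent, $D\approx D'$. Then $\alpha_D=\alpha_{D'}$, and one can associate the automorphism $\alpha_{[D]}:=\alpha_D\in\mathrm{Aut}\,\mathcal Z$ with the chain group element $[D]\in\mathfrak C(\mathcal G)$. (ii) There is a natural group homomorphism between the chain group and the automorphism group generated by the irreducible endomorphisms restricted to $\mathcal Z$, namely $$\mathfrak C(\mathcal G)\ni[D]\mapsto\alpha_{[D]}\in\mathrm{Aut}\,\mathcal Z.$$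
   Context: C*-algebras are unital. An algebraic Hilbert space in $\mathcal F$ is a finite-dimensional subspace $\mathcal H\subset\mathcal F$ with $A^*B\in\mathbb C\mathbf 1$ for $A,B\in\mathcal H$, with scalar product $\langle A,B\rangle\mathbf 1=A^*B$; all algebraic Hilbert spaces are assumed to have support $\sum_j\Phi_j\Phi_j^*=\mathbf 1$ ($\{\Phi_j\}$ an orthonormal basis). Let $\mathcal G$ be a compact group acting on $\mathcal F$ by a pointwise norm-continuous homomorphism $\alpha:\mathcal G\to\mathrm{Aut}\,\mathcal F$. For $D\in\widehat{\mathcal G}$ (equivalence classes of irreducible unitary representations) put $\Pi_D(F)=\int_{\mathcal G}\overline{\chi_D(g)}\,\alpha_g(F)\,dg$, $\chi_D(g)=\dim D\cdot\mathrm{Tr}\,\pi(g)$, $\pi\in D$. The system is a Hilbert C*-system if for each $D\in\widehat{\mathcal G}$ there is an $\alpha_{\mathcal G}$-invariant algebraic Hilbert space $\mathcal H_D\subset\Pi_D\mathcal F$ carrying a unitary representation of class $D$. One identifies $\mathcal G$ with $\alpha_{\mathcal G}$ and writes $\{\mathcal F,\mathcal G\}$; $\mathcal A$ is the fixed point algebra and $\mathcal Z=\mathcal A'\cap\mathcal A$. Minimal: $\mathcal A'\cap\mathcal F=\mathcal Z$. Property B: $\mathcal A$ contains isometries $V,W$ with $VV^*+WW^*=\mathbf 1$. For a $\mathcal G$-invariant algebraic Hilbert space $\mathcal H$, $\rho_{\mathcal H}(A)=\sum_j\Phi_jA\Phi_j^*$ is the canonical endomorphism of $\mathcal A$; $\rho_D:=\rho_{\mathcal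 H_D}$. With $(\rho,\rho)=\{X\in\mathcal A:X\rho(A)=\rho(A)X\ \forall A\in\mathcal A\}$, $\rho$ is irreducible if $(\rho,\rho)=\rho(\mathcal Z)$, equivalently $\mathcal G$ acts irreducibly on $\mathcal H$. Irreducible canonical endomorphisms restrict to automorphisms of $\mathcal Z$, and $\rho_D|_{\mathcal Z}$ depends only on $D$, not on the choice of $\mathcal H_D$. Chain group: for $D_1,D_2\in\widehat{\mathcal G}$, $D_1\times D_2$ is the set of classes appearing in the decomposition of $U_{D_1}\otimes U_{D_2}$, $U_{D_i}\in D_i$ (extended to subsets by unions, hence to $D_1\times\dots\times D_n$). $D\approx D'$ if there are $D_1,\dots,D_n\in\widehat{\mathcal G}$ with $D,D'\in D_1\times\dots\times D_n$. This is an equivalence relation with classes $[D]$; $\mathfrak C(\mathcal G)$ is the set of classes, an abelian group under $[D_0]\boxtimes[D_1]:=[D]$ for any $D\in D_0\times D_1$. *)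

theory Defs
  imports
    "HOL-Analysis.Analysis"
    "HOL-Algebra.Bij"
    "HOL-Algebra.Elementary_Groups"
    "Jordan_Normal_Form.Schur_Decomposition"
begin

section \<open>Unital C*-algebras\<close>

class unital_cstar_algebra = real_normed_algebra_1 + banach +
  fixes scaleC :: "complex \<Rightarrow> 'a \<Rightarrow> 'a" (infixr \<open>*\<^sub>C\<close> 75)
    and star :: "'a \<Rightarrow> 'a"
  assumes scaleC_add_right: "c *\<^sub>C (x + y) = c *\<^sub>C x + c *\<^sub>C y"
    and scaleC_add_left: "(c + d) *\<^sub>C x = c *\<^sub>C x + d *\<^sub>C x"
    and scaleC_scaleC: "c *\<^sub>C (d *\<^sub>C x) = (c * d) *\<^sub>C x"
    and scaleC_of_real: "complex_of_real r *\<^sub>C x = r *\<^sub>R x"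
    and scaleC_mult_left: "(c *\<^sub>C x) * y = c *\<^sub>C (x * y)"
    and scaleC_mult_right: "x * (c *\<^sub>C y) = c *\<^sub>C (x * y)"
    and norm_scaleC: "norm (c *\<^sub>C x) = cmod c * norm x"
    and star_star: "star (star x) = x"
    and star_add: "star (x + y) = star x + star y"
    and star_scaleC: "star (c *\<^sub>C x) = cnj c *\<^sub>C star x"
    and star_mult: "star (x * y) = star y * star x"
    and norm_star_mult: "norm (star x * x) = (norm x)\<^sup>2"

global_interpretation complex_vector:
  vector_space "scaleC :: complex \<Rightarrow> 'a \<Rightarrow> 'a::unital_cstar_algebra"
proof
  fix x :: 'a
  show "1 *\<^sub>C x = x"
    using scaleC_of_real[of 1 x] by simp
qed (simp_all add: scaleC_add_right scaleC_add_left scaleC_scaleC)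

definition commutant :: "'f::unital_cstar_algebra set \<Rightarrow> 'f set" where
  "commutant S = {X. \<forall>A\<in>S. X * A = A * X}"

text \<open>
  The *-automorphisms of a *-subalgebra \<open>S\<close>, as functions that are extensional on \<open>S\<close>
  (for \<open>S = UNIV\<close> this is no restriction).
\<close>

definition star_auts :: "'f::unital_cstar_algebra set \<Rightarrow> ('f \<Rightarrow> 'f) set" where
  "star_auts S = {f \<in> Bij S.
     (\<forall>x\<in>S. \<forall>y\<in>S. f (x + y) = f x + f y \<and> f (x * y) = f x * f y) \<and>
     (\<forall>c. \<forall>x\<in>S. f (c *\<^sub>C x) = c *\<^sub>C f x) \<and>
     (\<forall>x\<in>S. f (star x) = star (f x))}"

definition aut_group :: "'f::unital_cstar_algebra set \<Rightarrow> ('f \<Rightarrow> 'f) monoid" where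
  "aut_group S = BijGroup S \<lparr>carrier := star_auts S\<rparr>"

definition property_B :: "'f::unital_cstar_algebra set \<Rightarrow> bool" where
  "property_B S \<longleftrightarrow> (\<exists>V\<in>S. \<exists>W\<in>S.
     star V * V = 1 \<and> star W * W = 1 \<and> V * star V + W * star W = 1)"


section \<open>Unitary representations of compact groups\<close>

text \<open>
  The library's topological groups (class \<^class>\<open>topological_group_add\<close>) are written additively but
  are not assumed to be commutative: \<open>g + h\<close> is the product of \<open>g\<close> and \<open>h\<close>, and \<open>0\<close> is the neutral
  element.

  Irreducible unitary representations of a compact group are finite-dimensional, hence unitarily
  equivalent to a continuous homomorphism into unitary matrices. The dual of the group is the set of
  unitary equivalence classes of such matrix representations.
\<close>

type_synonym 'g rep = "'g \<Rightarrow> complex mat"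

definition unitary_mat :: "nat \<Rightarrow> complex mat \<Rightarrow> bool" where
  "unitary_mat n T \<longleftrightarrow> T \<in> carrier_mat n n \<and> mat_adjoint T * T = 1\<^sub>m n"

definition mat_trace :: "complex mat \<Rightarrow> complex" where
  "mat_trace M = (\<Sum>i<dim_row M. M $$ (i, i))"

definition rep_dim :: "'g::group_add rep \<Rightarrow> nat" where
  "rep_dim U = dim_row (U 0)"

definition unitary_rep :: "'g::{topological_group_add, t2_space} rep \<Rightarrow> bool" where
  "unitary_rep U \<longleftrightarrow>
     (\<forall>g. unitary_mat (rep_dim U) (U g)) \<and>
     (\<forall>g h. U (g + h) = U g * U h) \<and>
     (\<forall>i<rep_dim U. \<forall>j<rep_dim U. continuous_on UNIV (\<lambda>g. U g $$ (i, j)))"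

definition irreducible_rep :: "'g::{topological_group_add, t2_space} rep \<Rightarrow> bool" where
  "irreducible_rep U \<longleftrightarrow> unitary_rep U \<and> rep_dim U > 0 \<and>
     (\<forall>W. VectorSpace.subspace class_ring W (module_vec TYPE(complex) (rep_dim U)) \<longrightarrow>
          (\<forall>g. \<forall>v\<in>W. U g *\<^sub>v v \<in> W) \<longrightarrow>
          W = {0\<^sub>v (rep_dim U)} \<or> W = carrier_vec (rep_dim U))"

definition unitarily_equivalent :: "'g rep \<Rightarrow> 'g rep \<Rightarrow> bool" where
  "unitarily_equivalent U V \<longleftrightarrow> (\<exists>n T. unitary_mat n T \<and>
     (\<forall>g. U g \<in> carrier_mat n n \<and> V g \<in> carrier_mat n n \<and> T * U g = V g * T))"

definition rep_rel :: "('g::{topological_group_add, t2_space} rep \<times> 'g rep) set" where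
  "rep_rel = {(U, V). irreducible_rep U \<and> irreducible_rep V \<and> unitarily_equivalent U V}"

definition dual :: "'g::{topological_group_add, t2_space} rep set set" where
  "dual = {U. irreducible_rep U} // rep_rel"

definition trivial_class :: "'g::{topological_group_add, t2_space} rep set" where
  "trivial_class = rep_rel `` {\<lambda>g. 1\<^sub>m 1}"

text \<open>
  Note the factor \<open>dim D\<close>, which makes \<open>spectral_projection\<close> below an idempotent.
\<close>

definition modified_character ::
    "'g::{topological_group_add, t2_space} rep set \<Rightarrow> 'g \<Rightarrow> complex" where
  "modified_character D g =
     (let U = SOME U. U \<in> D in of_nat (rep_dim U) * mat_trace (U g))"


section \<open>The chain group\<close>

text \<open>
  The Kronecker product is the matrix of the tensor product with respect to the product basis,
  ordered lexicographically.
\<close>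

definition tensor_mat :: "complex mat \<Rightarrow> complex mat \<Rightarrow> complex mat" where
  "tensor_mat A B = Matrix.mat (dim_row A * dim_row B) (dim_col A * dim_col B)
     (\<lambda>(i, j). A $$ (i div dim_row B, j div dim_col B) * B $$ (i mod dim_row B, j mod dim_col B))"

definition tensor_rep :: "'g rep \<Rightarrow> 'g rep \<Rightarrow> 'g rep" where
  "tensor_rep U V = (\<lambda>g. tensor_mat (U g) (V g))"

definition appears_in ::
    "'g::{topological_group_add, t2_space} rep set \<Rightarrow> 'g rep \<Rightarrow> bool" where
  "appears_in D V \<longleftrightarrow> (\<exists>Us. (\<forall>U\<in>set Us. irreducible_rep U) \<and>
     unitarily_equivalent V (\<lambda>g. diag_block_mat (map (\<lambda>U. U g) Us)) \<and>
     (\<exists>U\<in>set Us. U \<in> D))"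

definition class_prod ::
    "'g::{topological_group_add, t2_space} rep set \<Rightarrow> 'g rep set \<Rightarrow> 'g rep set set" where
  "class_prod D\<^sub>1 D\<^sub>2 = {D \<in> dual. \<exists>U\<^sub>1\<in>D\<^sub>1. \<exists>U\<^sub>2\<in>D\<^sub>2. appears_in D (tensor_rep U\<^sub>1 U\<^sub>2)}"

text \<open>\<open>class_prods D\<^sub>1 [D\<^sub>2, \<dots>, D\<^sub>n]\<close> is \<open>D\<^sub>1 \<times> \<dots> \<times> D\<^sub>n\<close>; the product has at least one factor.\<close>

definition class_prods ::
    "'g::{topological_group_add, t2_space} rep set \<Rightarrow> 'g rep set list \<Rightarrow> 'g rep set set" where
  "class_prods D\<^sub>1 Ds = foldl (\<lambda>X E. \<Union>D\<in>X. class_prod D E) {D\<^sub>1} Ds"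

definition chain_equiv ::
    "'g::{topological_group_add, t2_space} rep set \<Rightarrow> 'g rep set \<Rightarrow> bool" where
  "chain_equiv D D' \<longleftrightarrow> D \<in> dual \<and> D' \<in> dual \<and>
     (\<exists>D\<^sub>1\<in>dual. \<exists>Ds. set Ds \<subseteq> dual \<and> D \<in> class_prods D\<^sub>1 Ds \<and> D' \<in> class_prods D\<^sub>1 Ds)"

definition chain_rel :: "('g::{topological_group_add, t2_space} rep set \<times> 'g rep set) set" where
  "chain_rel = {(D, D'). chain_equiv D D'}"

definition chain_class ::
    "'g::{topological_group_add, t2_space} rep set \<Rightarrow> 'g rep set set" where
  "chain_class D = chain_rel `` {D}"

definition chain_group :: "'g::{topological_group_add, t2_space} rep set set monoid" where
  "chain_group =
     \<lparr>carrier = dual // chain_rel,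
      mult = \<lambda>c\<^sub>0 c\<^sub>1. the_elem (chain_class ` (\<Union>D\<^sub>0\<in>c\<^sub>0. \<Union>D\<^sub>1\<in>c\<^sub>1. class_prod D\<^sub>0 D\<^sub>1)),
      one = chain_class trivial_class\<rparr>"


section \<open>Haar integration\<close>

text \<open>
  Outer regularity is part of the definition because it is not automatic, and needed for
  uniqueness, when the group is not second countable.
\<close>

definition is_haar :: "'g::{topological_group_add, t2_space} measure \<Rightarrow> bool" where
  "is_haar M \<longleftrightarrow> sets M = sets borel \<and> emeasure M UNIV = 1 \<and>
     (\<forall>g. distr M borel ((+) g) = M) \<and>
     (\<forall>A\<in>sets borel. emeasure M A = (INF U\<in>{U. open U \<and> A \<subseteq> U}. emeasure M U))"

definition haar :: "'g::{topological_group_add, t2_space} measure" where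
  "haar = (THE M. is_haar M)"

text \<open>
  The Bochner integral of the library is restricted to second countable target spaces. The weak
  integral, which agrees with it for continuous integrands on a compact space, does not need this.
\<close>

definition weak_integral :: "'a measure \<Rightarrow> ('a \<Rightarrow> 'b::banach) \<Rightarrow> 'b" where
  "weak_integral M f = (THE y. \<forall>\<phi> :: 'b \<Rightarrow> real. bounded_linear \<phi> \<longrightarrow>
     integrable M (\<lambda>x. \<phi> (f x)) \<and> \<phi> y = (\<integral>x. \<phi> (f x) \<partial>M))"


section \<open>Algebraic Hilbert spaces and canonical endomorphisms\<close>

definition scalar_prod_alg :: "'f::unital_cstar_algebra \<Rightarrow> 'f \<Rightarrow> complex" where
  "scalar_prod_alg A B = (THE c. star A * B = c *\<^sub>C 1)"

definition is_onb :: "'f::unital_cstar_algebra set \<Rightarrow> 'f list \<Rightarrow> bool" where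
  "is_onb H \<Phi> \<longleftrightarrow> complex_vector.span (set \<Phi>) = H \<and>
     (\<forall>i<length \<Phi>. \<forall>j<length \<Phi>. scalar_prod_alg (\<Phi> ! i) (\<Phi> ! j) = (if i = j then 1 else 0))"

definition algebraic_hilbert_space :: "'f::unital_cstar_algebra set \<Rightarrow> bool" where
  "algebraic_hilbert_space H \<longleftrightarrow>
     complex_vector.subspace H \<and> (\<exists>B. finite B \<and> complex_vector.span B = H) \<and>
     (\<forall>A\<in>H. \<forall>B\<in>H. \<exists>c. star A * B = c *\<^sub>C 1) \<and>
     (\<exists>\<Phi>. is_onb H \<Phi> \<and> (\<Sum>\<phi>\<leftarrow>\<Phi>. \<phi> * star \<phi>) = 1)"

text \<open>
  For an algebraic Hilbert space neither the support condition above nor the canonical endomorphism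
  depends on the choice of the orthonormal basis.
\<close>

definition canonical_endo :: "'f::unital_cstar_algebra set \<Rightarrow> 'f \<Rightarrow> 'f" where
  "canonical_endo H A = (\<Sum>\<phi>\<leftarrow>(SOME \<Phi>. is_onb H \<Phi>). \<phi> * A * star \<phi>)"


section \<open>Hilbert C*-systems\<close>

definition compact_group_action ::
    "('g::{topological_group_add, t2_space} \<Rightarrow> 'f::unital_cstar_algebra \<Rightarrow> 'f) \<Rightarrow> bool" where
  "compact_group_action \<alpha> \<longleftrightarrow> compact (UNIV :: 'g set) \<and>
     (\<forall>g. \<alpha> g \<in> star_auts UNIV) \<and>
     (\<forall>g h. \<alpha> (g + h) = \<alpha> g \<circ> \<alpha> h) \<and>
     (\<forall>F. continuous_on UNIV (\<lambda>g. \<alpha> g F))"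

definition fixed_algebra :: "('g \<Rightarrow> 'f::unital_cstar_algebra \<Rightarrow> 'f) \<Rightarrow> 'f set" where
  "fixed_algebra \<alpha> = {F. \<forall>g. \<alpha> g F = F}"

definition center :: "('g \<Rightarrow> 'f::unital_cstar_algebra \<Rightarrow> 'f) \<Rightarrow> 'f set" where
  "center \<alpha> = commutant (fixed_algebra \<alpha>) \<inter> fixed_algebra \<alpha>"

definition minimal_system :: "('g \<Rightarrow> 'f::unital_cstar_algebra \<Rightarrow> 'f) \<Rightarrow> bool" where
  "minimal_system \<alpha> \<longleftrightarrow> commutant (fixed_algebra \<alpha>) = center \<alpha>"

definition spectral_projection ::
    "('g::{topological_group_add, t2_space} \<Rightarrow> 'f::unital_cstar_algebra \<Rightarrow> 'f) \<Rightarrow>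
     'g rep set \<Rightarrow> 'f \<Rightarrow> 'f" where
  "spectral_projection \<alpha> D F =
     weak_integral haar (\<lambda>g. cnj (modified_character D g) *\<^sub>C \<alpha> g F)"

definition invariant_hilbert_space ::
    "('g \<Rightarrow> 'f::unital_cstar_algebra \<Rightarrow> 'f) \<Rightarrow> 'f set \<Rightarrow> bool" where
  "invariant_hilbert_space \<alpha> H \<longleftrightarrow> algebraic_hilbert_space H \<and> (\<forall>g. \<alpha> g ` H \<subseteq> H)"

definition action_matrix ::
    "('g \<Rightarrow> 'f::unital_cstar_algebra \<Rightarrow> 'f) \<Rightarrow> 'f list \<Rightarrow> 'g rep" where
  "action_matrix \<alpha> \<Phi> g = Matrix.mat (length \<Phi>) (length \<Phi>)
     (\<lambda>(i, j). scalar_prod_alg (\<Phi> ! i) (\<alpha> g (\<Phi> ! j)))"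

definition spectral_hilbert_space ::
    "('g::{topological_group_add, t2_space} \<Rightarrow> 'f::unital_cstar_algebra \<Rightarrow> 'f) \<Rightarrow>
     'g rep set \<Rightarrow> 'f set \<Rightarrow> bool" where
  "spectral_hilbert_space \<alpha> D H \<longleftrightarrow>
     invariant_hilbert_space \<alpha> H \<and> H \<subseteq> range (spectral_projection \<alpha> D) \<and>
     (\<exists>\<Phi>. is_onb H \<Phi> \<and> action_matrix \<alpha> \<Phi> \<in> D)"

text \<open>
  Faithfulness of \<open>\<alpha>\<close>, implicit in identifying the group with its image in the automorphism group,
  is a consequence, since every irreducible representation occurs in the action.
\<close>

definition hilbert_cstar_system ::
    "('g::{topological_group_add, t2_space} \<Rightarrow> 'f::unital_cstar_algebra \<Rightarrow> 'f) \<Rightarrow> bool" where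
  "hilbert_cstar_system \<alpha> \<longleftrightarrow> compact_group_action \<alpha> \<and>
     (\<forall>D\<in>dual. \<exists>H. spectral_hilbert_space \<alpha> D H)"

definition self_intertwiners ::
    "('g \<Rightarrow> 'f::unital_cstar_algebra \<Rightarrow> 'f) \<Rightarrow> ('f \<Rightarrow> 'f) \<Rightarrow> 'f set" where
  "self_intertwiners \<alpha> \<rho> =
     {X \<in> fixed_algebra \<alpha>. \<forall>A\<in>fixed_algebra \<alpha>. X * \<rho> A = \<rho> A * X}"

definition irreducible_endo ::
    "('g \<Rightarrow> 'f::unital_cstar_algebra \<Rightarrow> 'f) \<Rightarrow> ('f \<Rightarrow> 'f) \<Rightarrow> bool" where
  "irreducible_endo \<alpha> \<rho> \<longleftrightarrow> self_intertwiners \<alpha> \<rho> = \<rho> ` center \<alpha>"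

text \<open>
  \<^const>\<open>subgroup_generated\<close> intersects the generating set with the carrier. In a minimal Hilbert
  C*-system this removes nothing, since irreducible canonical endomorphisms restrict to automorphisms
  of the center.
\<close>

definition irreducible_aut_group ::
    "('g \<Rightarrow> 'f::unital_cstar_algebra \<Rightarrow> 'f) \<Rightarrow> ('f \<Rightarrow> 'f) monoid" where
  "irreducible_aut_group \<alpha> = subgroup_generated (aut_group (center \<alpha>))
     {restrict (canonical_endo H) (center \<alpha>) | H.
        invariant_hilbert_space \<alpha> H \<and> irreducible_endo \<alpha> (canonical_endo H)}"

text \<open>
  In the following two definitions \<open>H\<close> is a choice of Hilbert spaces \<open>D \<mapsto> H\<^sub>D\<close>.
\<close>

definition class_aut ::
    "('g \<Rightarrow> 'f::unital_cstar_algebra \<Rightarrow> 'f) \<Rightarrow> ('g rep set \<Rightarrow> 'f set) \<Rightarrow> 'g rep set \<Rightarrow> 'f \<Rightarrow> 'f"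
  where "class_aut \<alpha> H D = restrict (canonical_endo (H D)) (center \<alpha>)"

definition chain_aut ::
    "('g \<Rightarrow> 'f::unital_cstar_algebra \<Rightarrow> 'f) \<Rightarrow> ('g rep set \<Rightarrow> 'f set) \<Rightarrow> 'g rep set set \<Rightarrow> 'f \<Rightarrow> 'f"
  where "chain_aut \<alpha> H c = the_elem (class_aut \<alpha> H ` c)"

end

theory Submission
  imports Defs "Jordan_Normal_Form.Spectral_Radius"
begin

text \<open>
  Each Hilbert space \<open>H D\<close> carries a multiplet \<open>\<phi>\<close>, an orthonormal basis transforming by a matrix
  representation \<open>U \<in> D\<close>. By minimality and Schur's lemma every central \<open>z\<close> satisfies
  \<open>z \<phi>\<^sub>j = \<phi>\<^sub>j \<sigma>\<^sub>D(z)\<close> with \<open>\<sigma>\<^sub>D(z)\<close> central, so that \<open>\<rho>\<^sub>D(\<sigma>\<^sub>D(z)) = z\<close>. If \<open>D\<close> occurs in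
  \<open>D\<^sub>1 \<times> D\<^sub>2\<close>, products \<open>\<phi>\<^sub>i \<psi>\<^sub>j\<close> combine to a multiplet \<open>\<xi>\<close> for the same \<open>U \<in> D\<close> as the basis \<open>\<eta>\<close> of
  \<open>H D\<close>; then \<open>X = \<Sum>\<^sub>k \<xi>\<^sub>k \<eta>\<^sub>k\<^sup>*\<close> is an isometry in the fixed point algebra, and comparing \<open>z X\<close> with
  \<open>X z\<close> gives \<open>\<rho>\<^sub>D = \<rho>\<^sub>D\<^sub>1 \<rho>\<^sub>D\<^sub>2\<close> on the center. For the trivial class in \<open>D \<times> D\<close> conjugate this makes
  \<open>\<rho>\<^sub>D\<close> invertible on the center, and by iteration \<open>\<rho>\<^sub>D\<close> depends only on the chain class of \<open>D\<close>.
\<close>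

section \<open>Complex matrices\<close>

text \<open>The definition of \<open>class_prod\<close> asks for a full decomposition into
  irreducible blocks, which does not compose well. The proof works instead with
  \<open>embeds\<close>, the existence of an isometric intertwiner, which is transitive and
  compatible with tensor products; complete reducibility is what makes the two notions agree. On
  irreducible representations an embedding is already an equivalence, so \<open>embeds\<close> also
  describes \<open>rep_rel\<close>. On the algebra side the order of factors matters. Moving a
  central z through \<phi>_i \<psi>_j applies first the \<sigma> of the first class and then that of
  the second, so \<sigma> reverses products and its inverse \<rho> preserves their order. Minimality
  shows that every central z has the form \<rho>(w) with w central, but not yet that \<rho> maps the
  center into itself; the conjugate class supplies this.\<close>

lemma dim_mat_adjoint [simp]:
  "dim_row (mat_adjoint A) = dim_col A" "dim_col (mat_adjoint A) = dim_row A"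
  by (auto simp: mat_adjoint_def)

lemma mat_adjoint_carrier [simp]:
  "A \<in> carrier_mat n m \<Longrightarrow> mat_adjoint A \<in> carrier_mat m n"
  by (rule carrier_matI) simp_all

lemma index_mat_adjoint [simp]:
  fixes A :: "complex mat"
  assumes "i < dim_col A" "j < dim_row A"
  shows "mat_adjoint A $$ (i, j) = cnj (A $$ (j, i))"
  using assms by (auto simp: mat_adjoint_def mat_of_rows_index)

lemma mat_adjoint_adjoint [simp]: "mat_adjoint (mat_adjoint A) = (A :: complex mat)"
  by (rule eq_matI) auto

lemma mat_adjoint_one [simp]: "mat_adjoint (1\<^sub>m n) = (1\<^sub>m n :: complex mat)"
  by (rule eq_matI) auto

lemma mat_adjoint_smult: "mat_adjoint (c \<cdot>\<^sub>m A) = cnj c \<cdot>\<^sub>m mat_adjoint (A :: complex mat)"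
  by (rule eq_matI) auto

lemma index_mult_mat_sum:
  assumes "i < dim_row A" "j < dim_col B" "dim_col A = dim_row B"
  shows "(A * B) $$ (i, j) = (\<Sum>l<dim_row B. A $$ (i, l) * B $$ (l, j))"
  using assms by (simp add: scalar_prod_def atLeast0LessThan)

lemma mat_adjoint_mult:
  fixes A B :: "complex mat"
  assumes "dim_col A = dim_row B"
  shows "mat_adjoint (A * B) = mat_adjoint B * mat_adjoint A"
proof (rule eq_matI)
  fix i j assume "i < dim_row (mat_adjoint B * mat_adjoint A)" "j < dim_col (mat_adjoint B * mat_adjoint A)"
  then have ij: "i < dim_col B" "j < dim_row A"
    by auto
  then have "mat_adjoint (A * B) $$ (i, j) = cnj (\<Sum>l<dim_row B. A $$ (j, l) * B $$ (l, i))"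
    using assms by (simp add: index_mult_mat_sum del: index_mult_mat(1))
  also have "\<dots> = (\<Sum>l<dim_row B. mat_adjoint B $$ (i, l) * mat_adjoint A $$ (l, j))"
    using ij assms by (simp add: mult.commute)
  also have "\<dots> = (mat_adjoint B * mat_adjoint A) $$ (i, j)"
    using ij assms by (simp add: index_mult_mat_sum del: index_mult_mat(1))
  finally show "mat_adjoint (A * B) $$ (i, j) = (mat_adjoint B * mat_adjoint A) $$ (i, j)" .
qed auto

lemma eq_mat_if_mult_vec_eq:
  fixes A B :: "complex mat"
  assumes A: "A \<in> carrier_mat n m" and B: "B \<in> carrier_mat n m"
    and eq: "\<And>v. v \<in> carrier_vec m \<Longrightarrow> A *\<^sub>v v = B *\<^sub>v v"
  shows "A = B"
proof (rule eq_matI)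
  fix i j assume "i < dim_row B" "j < dim_col B"
  then have ij: "i < n" "j < m"
    using B by auto
  have *: "vec_index (C *\<^sub>v unit_vec m j) i = C $$ (i, j)" if "C \<in> carrier_mat n m" for C :: "complex mat"
    using that ij by (simp add: scalar_prod_right_unit[of _ m])
  show "A $$ (i, j) = B $$ (i, j)"
    using *[OF A] *[OF B] eq[of "unit_vec m j"] by simp
qed (use A B in auto)

text \<open>The traces of \<open>S * R\<close> and \<open>R * S\<close> agree, and the trace of an
  identity matrix is its size.\<close>

lemma mutually_inverse_dim_eq:
  fixes S R :: "complex mat"
  assumes S: "S \<in> carrier_mat n k" and R: "R \<in> carrier_mat k n"
    and "R * S = 1\<^sub>m k" "S * R = 1\<^sub>m n"
  shows "n = k"
proof -
  have "(of_nat n :: complex) = (\<Sum>i<n. (S * R) $$ (i, i))"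
    using assms by simp
  also have "\<dots> = (\<Sum>i<n. \<Sum>j<k. S $$ (i, j) * R $$ (j, i))"
    using S R by (intro sum.cong refl) (subst index_mult_mat_sum, auto)
  also have "\<dots> = (\<Sum>j<k. \<Sum>i<n. R $$ (j, i) * S $$ (i, j))"
    by (subst sum.swap) (simp add: mult.commute)
  also have "\<dots> = (\<Sum>j<k. (R * S) $$ (j, j))"
    using S R by (intro sum.cong refl) (subst index_mult_mat_sum, auto)
  also have "\<dots> = of_nat k"
    using assms by simp
  finally show ?thesis
    using of_nat_eq_iff by blast
qed

text \<open>If k exceeded n, padding both factors with zeros to size k would give square matrices
  whose product \<open>R0 * S0\<close> is the identity, hence also \<open>S0 * R0\<close>; but the
  rows of \<open>S0\<close> from n on vanish.\<close>

lemma left_invertible_dim_le: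
  fixes S R :: "complex mat"
  assumes S: "S \<in> carrier_mat n k" and R: "R \<in> carrier_mat k n"
    and RS: "R * S = 1\<^sub>m k"
  shows "k \<le> n"
proof (rule ccontr)
  assume "\<not> k \<le> n"
  then have nk: "n < k"
    by simp
  define S0 where "S0 = Matrix.mat k k (\<lambda>(i, j). if i < n then S $$ (i, j) else 0)"
  define R0 where "R0 = Matrix.mat k k (\<lambda>(i, j). if j < n then R $$ (i, j) else 0)"
  have [simp]: "S0 \<in> carrier_mat k k" "R0 \<in> carrier_mat k k"
    by (auto simp: S0_def R0_def)
  have "R0 * S0 = R * S"
  proof (rule eq_matI)
    fix i j assume "i < dim_row (R * S)" "j < dim_col (R * S)"
    then have ij: "i < k" "j < k"
      using S R by auto
    have "(R0 * S0) $$ (i, j) = (\<Sum>l<k. R0 $$ (i, l) * S0 $$ (l, j))"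
      using ij by (subst index_mult_mat_sum) (auto simp: S0_def R0_def)
    also have "\<dots> = (\<Sum>l<n. R $$ (i, l) * S $$ (l, j))"
      using nk ij by (intro sum.mono_neutral_cong_right) (auto simp: S0_def R0_def)
    also have "\<dots> = (R * S) $$ (i, j)"
      using ij S R by (subst index_mult_mat_sum) auto
    finally show "(R0 * S0) $$ (i, j) = (R * S) $$ (i, j)" .
  qed (use S R in \<open>auto simp: S0_def R0_def\<close>)
  then have "S0 * R0 = 1\<^sub>m k"
    using RS by (intro mat_mult_left_right_inverse[of R0]) auto
  then have "(S0 * R0) $$ (n, n) = 1"
    using nk by simp
  moreover have "(S0 * R0) $$ (n, n) = 0"
    using nk by (subst index_mult_mat_sum) (auto simp: S0_def R0_def)
  ultimately show False
    by simp
qed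

lemma adjoint_mult_self_diag:
  fixes A :: "complex mat"
  assumes "j < dim_col A"
  shows "(mat_adjoint A * A) $$ (j, j) = of_real (\<Sum>i<dim_row A. (cmod (A $$ (i, j)))\<^sup>2)"
  using assms by (subst index_mult_mat_sum) (auto simp: mult.commute complex_norm_square simp del: of_real_power)

lemma mat_nonzero_entry:
  assumes "A \<in> carrier_mat n m" "A \<noteq> 0\<^sub>m n m"
  obtains i j where "i < n" "j < m" "A $$ (i, j) \<noteq> 0"
proof -
  have "\<exists>i<n. \<exists>j<m. A $$ (i, j) \<noteq> 0"
  proof (rule ccontr)
    assume "\<not> (\<exists>i<n. \<exists>j<m. A $$ (i, j) \<noteq> 0)"
    then have "A = 0\<^sub>m n m"
      using assms(1) by (intro eq_matI) auto
    then show False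
      using assms(2) by blast
  qed
  then show thesis
    using that by blast
qed

lemma one_mat_neq_zero: "0 < n \<Longrightarrow> 1\<^sub>m n \<noteq> (0\<^sub>m n n :: complex mat)"
  using index_one_mat(1)[of 0 n 0, where 'a = complex] by force

section \<open>Invariant subspaces\<close>

abbreviation cvec_subspace :: "nat \<Rightarrow> complex Matrix.vec set \<Rightarrow> bool" where
  "cvec_subspace n W \<equiv> VectorSpace.subspace class_ring W (module_vec TYPE(complex) n)"

lemma cvec_subspace_iff:
  "cvec_subspace n W \<longleftrightarrow> W \<subseteq> carrier_vec n \<and> 0\<^sub>v n \<in> W \<and>
     (\<forall>v\<in>W. \<forall>w\<in>W. v + w \<in> W) \<and> (\<forall>c. \<forall>v\<in>W. c \<cdot>\<^sub>v v \<in> W)"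
proof -
  interpret vec_space "TYPE(complex)" n .
  show ?thesis
    by (auto simp: VectorSpace.subspace_def submodule_def vec_vs vec_module module_vec_simps
        class_ring_simps)
qed

lemma smult_vec_one_mat:
  fixes v :: "complex Matrix.vec"
  assumes "v \<in> carrier_vec n"
  shows "(c \<cdot>\<^sub>m 1\<^sub>m n) *\<^sub>v v = c \<cdot>\<^sub>v v"
  using assms by (intro eq_vecI) (auto simp: scalar_prod_def row_def if_distrib if_distribR cong: if_cong)

lemma index_mult_mat_vec_sum:
  assumes "i < dim_row A" "dim_vec v = dim_col A"
  shows "vec_index (A *\<^sub>v v) i = (\<Sum>l<dim_col A. A $$ (i, l) * vec_index v l)"
  using assms by (simp add: scalar_prod_def atLeast0LessThan)

text \<open>With an orthonormal basis of W as the columns of S, \<open>S * mat_adjoint S\<close> is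
  the orthogonal projection onto W. The basis is an orthonormal family in W of maximal length: a
  vector of W that the projection does not fix would extend the family by its normalized
  residual.\<close>

lemma cvec_subspace_isometry:
  assumes W: "cvec_subspace n W"
  obtains k S where "S \<in> carrier_mat n k" "mat_adjoint S * S = 1\<^sub>m k"
    "\<forall>v\<in>carrier_vec n. v \<in> W \<longleftrightarrow> S * mat_adjoint S *\<^sub>v v = v"
proof -
  define Q where "Q k S \<longleftrightarrow> S \<in> carrier_mat n k \<and> mat_adjoint S * S = 1\<^sub>m k \<and>
    (\<forall>u\<in>carrier_vec k. S *\<^sub>v u \<in> W)" for k S
  have W0: "0\<^sub>v n \<in> W" and Wadd: "\<And>v w. v \<in> W \<Longrightarrow> w \<in> W \<Longrightarrow> v + w \<in> W"
    and Wsmult: "\<And>c v. v \<in> W \<Longrightarrow> c \<cdot>\<^sub>v v \<in> W" and Wn: "W \<subseteq> carrier_vec n"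
    using W by (auto simp: cvec_subspace_iff)
  have "0\<^sub>m n 0 *\<^sub>v u = 0\<^sub>v n" if "u \<in> carrier_vec 0" for u :: "complex Matrix.vec"
    using that by (intro eq_vecI) (auto simp: scalar_prod_def)
  \<comment> \<open>The empty family, a matrix without columns, starts the maximization and covers
    the zero subspace.\<close>
  then have "Q 0 (0\<^sub>m n 0)"
    using W0 by (auto simp: Q_def)
  then have ex: "\<exists>k S. Q k S"
    by blast
  have bound: "k \<le> n" if "\<exists>S. Q k S" for k
    using that left_invertible_dim_le unfolding Q_def by (meson mat_adjoint_carrier)
  define k where "k = (GREATEST k. \<exists>S. Q k S)"
  have "\<exists>S. Q k S"
    unfolding k_def by (rule GreatestI_ex_nat[OF ex bound])
  then obtain S where "Q k S"
    by blast
  then have S: "S \<in> carrier_mat n k" and SS: "mat_adjoint S * S = 1\<^sub>m k"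
    and SW: "\<And>u. u \<in> carrier_vec k \<Longrightarrow> S *\<^sub>v u \<in> W"
    by (auto simp: Q_def)
  have aS: "mat_adjoint S \<in> carrier_mat k n"
    using S by simp
  have aSv: "mat_adjoint S *\<^sub>v v \<in> carrier_vec k" for v :: "complex Matrix.vec"
    using S by (intro carrier_vecI) simp
  note SSv = assoc_mult_mat_vec[OF S aS]
  have max: "\<not> Q (Suc k) S'" for S'
  proof
    assume "Q (Suc k) S'"
    then have "Suc k \<le> k"
      using Greatest_le_nat[where P = "\<lambda>k. \<exists>S. Q k S" and b = n and k = "Suc k"] bound
      unfolding k_def by blast
    then show False
      by simp
  qed
  have proj: "S * mat_adjoint S *\<^sub>v v = v" if v: "v \<in> W" for v
  proof (rule ccontr)
    assume neq: "S * mat_adjoint S *\<^sub>v v \<noteq> v"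
    have vn: "v \<in> carrier_vec n"
      using v Wn by auto
    \<comment> \<open>p is the projection of v, and w the residual, orthogonal to every column of S
      by \<open>Sw\<close> below.\<close>
    define p where "p = S *\<^sub>v (mat_adjoint S *\<^sub>v v)"
    define w where "w = v + (-1) \<cdot>\<^sub>v p"
    have pn: "p \<in> carrier_vec n"
      using S unfolding p_def by (intro carrier_vecI) simp
    have wn: "w \<in> carrier_vec n"
      using vn pn unfolding w_def by simp
    have wi: "vec_index w i = vec_index v i - vec_index p i" if "i < n" for i
      using that vn pn unfolding w_def by simp
    have p: "p = S * mat_adjoint S *\<^sub>v v"
      unfolding p_def using SSv[OF vn] by simp
    have wW: "w \<in> W"
      unfolding w_def p_def by (intro Wadd Wsmult SW v aSv)
    have Sp: "mat_adjoint S *\<^sub>v p = mat_adjoint S *\<^sub>v v"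
      unfolding p_def using assoc_mult_mat_vec[OF aS S aSv] SS one_mult_mat_vec[OF aSv] by simp
    have Sw: "(\<Sum>l<n. cnj (S $$ (l, j)) * vec_index w l) = 0" if j: "j < k" for j
    proof -
      have "(\<Sum>l<n. cnj (S $$ (l, j)) * vec_index w l) =
          vec_index (mat_adjoint S *\<^sub>v v) j - vec_index (mat_adjoint S *\<^sub>v p) j"
        using S j vn pn
        by (subst (1 2) index_mult_mat_vec_sum)
          (auto simp: wi right_diff_distrib sum_subtractf)
      then show ?thesis
        by (simp add: Sp)
    qed
    define r where "r = (\<Sum>l<n. (cmod (vec_index w l))\<^sup>2)"
    have "\<exists>l<n. vec_index w l \<noteq> 0"
    proof (rule ccontr)
      assume "\<not> ?thesis"
      then have "v = p"
        using vn pn by (intro eq_vecI) (auto simp: wi)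
      then show False
        using neq p by simp
    qed
    then obtain l where "l < n" "vec_index w l \<noteq> 0"
      by blast
    then have r: "r > 0"
      unfolding r_def by (intro sum_pos2[where i = l]) auto
    have rr: "(\<Sum>l<n. cnj (vec_index w l) * vec_index w l) = of_real r"
      unfolding r_def of_real_sum by (intro sum.cong refl) (simp add: complex_norm_square mult.commute del: of_real_power)
    \<comment> \<open>Normalizes w, whose squared norm is r.\<close>
    define c where "c = complex_of_real (1 / sqrt r)"
    have cc: "cnj c * c * of_real r = 1"
      using r by (simp add: c_def flip: of_real_mult)
    define S' where "S' = Matrix.mat n (Suc k) (\<lambda>(i, j). if j < k then S $$ (i, j) else c * vec_index w i)"
    have S': "S' \<in> carrier_mat n (Suc k)"
      by (simp add: S'_def)
    have "mat_adjoint S' * S' = 1\<^sub>m (Suc k)"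
    proof (rule eq_matI)
      fix i j assume "i < dim_row (1\<^sub>m (Suc k) :: complex mat)" "j < dim_col (1\<^sub>m (Suc k) :: complex mat)"
      then have ij: "i < Suc k" "j < Suc k"
        by auto
      have eq: "(mat_adjoint S' * S') $$ (i, j) = (\<Sum>l<n. cnj (S' $$ (l, i)) * S' $$ (l, j))"
        using ij S' by (subst index_mult_mat_sum) auto
      consider "i < k" "j < k" | "i < k" "j = k" | "i = k" "j < k" | "i = k" "j = k"
        using ij by linarith
      then show "(mat_adjoint S' * S') $$ (i, j) = 1\<^sub>m (Suc k) $$ (i, j)"
      proof cases
        case 1
        then have "(\<Sum>l<n. cnj (S' $$ (l, i)) * S' $$ (l, j)) = (mat_adjoint S * S) $$ (i, j)"
          using S by (subst index_mult_mat_sum) (auto simp: S'_def)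
        then show ?thesis
          using 1 eq SS by simp
      next
        case 2
        then have "(\<Sum>l<n. cnj (S' $$ (l, i)) * S' $$ (l, j)) =
            c * (\<Sum>l<n. cnj (S $$ (l, i)) * vec_index w l)"
          unfolding sum_distrib_left by (intro sum.cong) (auto simp: S'_def)
        then show ?thesis
          using 2 eq Sw by simp
      next
        case 3
        then have "(\<Sum>l<n. cnj (S' $$ (l, i)) * S' $$ (l, j)) =
            cnj c * cnj (\<Sum>l<n. cnj (S $$ (l, j)) * vec_index w l)"
          unfolding cnj_sum sum_distrib_left by (intro sum.cong) (auto simp: S'_def)
        then show ?thesis
          using 3 eq Sw by simp
      next
        case 4
        then have "(\<Sum>l<n. cnj (S' $$ (l, i)) * S' $$ (l, j)) =
            cnj c * c * (\<Sum>l<n. cnj (vec_index w l) * vec_index w l)"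
          unfolding sum_distrib_left by (intro sum.cong) (auto simp: S'_def)
        then show ?thesis
          using 4 eq cc rr by simp
      qed
    qed (auto simp: S'_def)
    moreover have "S' *\<^sub>v u \<in> W" if u: "u \<in> carrier_vec (Suc k)" for u
    proof -
      define u' where "u' = Matrix.vec k (vec_index u)"
      have "S' *\<^sub>v u = S *\<^sub>v u' + (c * vec_index u k) \<cdot>\<^sub>v w"
      proof (rule eq_vecI)
        fix i assume "i < dim_vec (S *\<^sub>v u' + (c * vec_index u k) \<cdot>\<^sub>v w)"
        then have i: "i < n"
          using wn by simp
        have "vec_index (S' *\<^sub>v u) i = (\<Sum>l<Suc k. S' $$ (i, l) * vec_index u l)"
          using i S' u by (subst index_mult_mat_vec_sum) auto
        also have "\<dots> = (\<Sum>l<k. S $$ (i, l) * vec_index u' l) + c * vec_index w i * vec_index u k"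
          using i by (simp add: S'_def u'_def)
        also have "(\<Sum>l<k. S $$ (i, l) * vec_index u' l) = vec_index (S *\<^sub>v u') i"
          using i S by (subst index_mult_mat_vec_sum) (auto simp: u'_def)
        finally show "vec_index (S' *\<^sub>v u) i = vec_index (S *\<^sub>v u' + (c * vec_index u k) \<cdot>\<^sub>v w) i"
          using i S wn by simp
      qed (use S' S wn in auto)
      then show ?thesis
        using wW by (auto intro!: Wadd Wsmult SW simp: u'_def)
    qed
    ultimately have "Q (Suc k) S'"
      using S' by (auto simp: Q_def)
    then show False
      using max by blast
  qed
  show thesis
  proof (rule that[OF S SS], rule ballI)
    fix v :: "complex Matrix.vec" assume v: "v \<in> carrier_vec n"
    show "v \<in> W \<longleftrightarrow> S * mat_adjoint S *\<^sub>v v = v"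
    proof
      assume "S * mat_adjoint S *\<^sub>v v = v"
      moreover have "S * mat_adjoint S *\<^sub>v v \<in> W"
        using SSv[OF v] SW[OF aSv] by simp
      ultimately show "v \<in> W"
        by simp
    qed (rule proj)
  qed
qed

section \<open>Unitary representations\<close>

lemma unitary_mat_inverse:
  assumes "unitary_mat n T"
  shows "T * mat_adjoint T = 1\<^sub>m n"
  using assms unfolding unitary_mat_def
  by (intro mat_mult_left_right_inverse[of "mat_adjoint T"]) auto

lemma unitary_mat_adjoint: "unitary_mat n T \<Longrightarrow> unitary_mat n (mat_adjoint T)"
  using unitary_mat_inverse[of n T] by (simp add: unitary_mat_def)

lemma left_inverse_mat_cancel:
  fixes A B C :: "complex mat"
  assumes "A \<in> carrier_mat n k" "B \<in> carrier_mat k n" "C \<in> carrier_mat n m"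
    and "A * B = 1\<^sub>m n"
  shows "A * (B * C) = C"
  using assms assoc_mult_mat[of A n k B n C m] by simp

lemma right_inverse_mat_cancel:
  fixes A B C :: "complex mat"
  assumes "A \<in> carrier_mat n k" "B \<in> carrier_mat k n" "C \<in> carrier_mat m n"
    and "A * B = 1\<^sub>m n"
  shows "C * A * B = C"
  using assms assoc_mult_mat[of C m n A k B n] by simp

lemma isometry_projection:
  fixes S :: "complex mat"
  assumes S: "S \<in> carrier_mat n k" and SS: "mat_adjoint S * S = 1\<^sub>m k"
  shows "S * mat_adjoint S \<in> carrier_mat n n"
    and "mat_adjoint (S * mat_adjoint S) = S * mat_adjoint S"
    and "S * mat_adjoint S * (S * mat_adjoint S) = S * mat_adjoint S"
proof -
  have Sc: "mat_adjoint S \<in> carrier_mat k n"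
    using S by simp
  show "S * mat_adjoint S \<in> carrier_mat n n"
    by (rule mult_carrier_mat[OF S Sc])
  show "mat_adjoint (S * mat_adjoint S) = S * mat_adjoint S"
    using S by (simp add: mat_adjoint_mult)
  have "S * mat_adjoint S * (S * mat_adjoint S) = S * (mat_adjoint S * (S * mat_adjoint S))"
    using S Sc by (intro assoc_mult_mat[of _ n k _ n _ n]) auto
  then show "S * mat_adjoint S * (S * mat_adjoint S) = S * mat_adjoint S"
    by (simp add: left_inverse_mat_cancel[OF Sc S Sc SS])
qed

lemma isometric_mult:
  fixes S T :: "complex mat"
  assumes S: "S \<in> carrier_mat m k" "mat_adjoint S * S = 1\<^sub>m k"
    and T: "T \<in> carrier_mat n m" "mat_adjoint T * T = 1\<^sub>m m"
  shows "mat_adjoint (T * S) * (T * S) = 1\<^sub>m k"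
proof -
  have "mat_adjoint (T * S) * (T * S) = mat_adjoint S * mat_adjoint T * (T * S)"
    using S T by (simp add: mat_adjoint_mult)
  also have "\<dots> = mat_adjoint S * (mat_adjoint T * (T * S))"
    using S(1) T(1) by (intro assoc_mult_mat[of _ k m _ n _ k]) auto
  also have "mat_adjoint T * (T * S) = S"
    using left_inverse_mat_cancel[of "mat_adjoint T" m n T S k] S(1) T by simp
  finally show ?thesis
    using S by simp
qed

lemma unitary_rep_carrier:
  "unitary_rep U \<Longrightarrow> U g \<in> carrier_mat (rep_dim U) (rep_dim U)"
  by (simp add: unitary_rep_def unitary_mat_def)

lemma unitary_rep_adjoint_mult:
  "unitary_rep U \<Longrightarrow> mat_adjoint (U g) * U g = 1\<^sub>m (rep_dim U)"
  by (simp add: unitary_rep_def unitary_mat_def)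

lemma unitary_rep_mult_adjoint:
  "unitary_rep U \<Longrightarrow> U g * mat_adjoint (U g) = 1\<^sub>m (rep_dim U)"
  by (simp add: unitary_rep_def unitary_mat_inverse)

lemma unitary_rep_add: "unitary_rep U \<Longrightarrow> U (g + h) = U g * U h"
  by (simp add: unitary_rep_def)

lemma unitary_rep_zero:
  assumes "unitary_rep U"
  shows "U 0 = 1\<^sub>m (rep_dim U)"
proof -
  note c = unitary_rep_carrier[OF assms, of 0]
  have "U 0 = mat_adjoint (U 0) * (U 0 * U 0)"
    using c unitary_rep_adjoint_mult[OF assms, of 0]
    by (subst left_inverse_mat_cancel[OF _ c c]) auto
  also have "U 0 * U 0 = U 0"
    using unitary_rep_add[OF assms, of 0 0] by simp
  finally show ?thesis
    using unitary_rep_adjoint_mult[OF assms, of 0] by simp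
qed

lemma unitary_rep_minus:
  assumes "unitary_rep U"
  shows "U (- g) = mat_adjoint (U g)"
proof -
  note c = unitary_rep_carrier[OF assms]
  have "U (- g) = mat_adjoint (U g) * (U g * U (- g))"
    using unitary_rep_adjoint_mult[OF assms, of g]
    by (subst left_inverse_mat_cancel[OF _ c c]) (use c in auto)
  also have "U g * U (- g) = 1\<^sub>m (rep_dim U)"
    using unitary_rep_add[OF assms, of g "- g"] unitary_rep_zero[OF assms] by simp
  finally show ?thesis
    using c[of g] by (metis mat_adjoint_carrier right_mult_one_mat)
qed

subsection \<open>Intertwiners\<close>

definition intertwiner :: "'g::group_add rep \<Rightarrow> 'g rep \<Rightarrow> complex mat \<Rightarrow> bool" where
  "intertwiner U V T \<longleftrightarrow> T \<in> carrier_mat (rep_dim V) (rep_dim U) \<and> (\<forall>g. T * U g = V g * T)"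

definition isometric_intertwiner :: "'g::group_add rep \<Rightarrow> 'g rep \<Rightarrow> complex mat \<Rightarrow> bool" where
  "isometric_intertwiner U V T \<longleftrightarrow> intertwiner U V T \<and> mat_adjoint T * T = 1\<^sub>m (rep_dim U)"

text \<open>U is equivalent to a subrepresentation of V. Asking for an isometry rather than mere
  injectivity makes the adjoint a left inverse, and the property survives composition and tensor
  products.\<close>

definition embeds :: "'g::group_add rep \<Rightarrow> 'g rep \<Rightarrow> bool" where
  "embeds U V \<longleftrightarrow> (\<exists>T. isometric_intertwiner U V T)"

lemma intertwiner_carrier: "intertwiner U V T \<Longrightarrow> T \<in> carrier_mat (rep_dim V) (rep_dim U)"
  by (simp add: intertwiner_def)

lemma intertwiner_adjoint:
  assumes U: "unitary_rep U" and V: "unitary_rep V" and T: "intertwiner U V T"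
  shows "intertwiner V U (mat_adjoint T)"
proof -
  note c = unitary_rep_carrier[OF U] unitary_rep_carrier[OF V] intertwiner_carrier[OF T]
  have "mat_adjoint T * V g = U g * mat_adjoint T" for g
  proof -
    have "T * U (- g) = V (- g) * T"
      using T by (simp add: intertwiner_def)
    then have "mat_adjoint (T * U (- g)) = mat_adjoint (V (- g) * T)"
      by simp
    moreover have "mat_adjoint (T * U (- g)) = U g * mat_adjoint T"
      using carrier_matD[OF c(1)[of g]] carrier_matD[OF c(3)]
      by (simp add: mat_adjoint_mult unitary_rep_minus[OF U])
    moreover have "mat_adjoint (V (- g) * T) = mat_adjoint T * V g"
      using carrier_matD[OF c(2)[of g]] carrier_matD[OF c(3)]
      by (simp add: mat_adjoint_mult unitary_rep_minus[OF V])
    ultimately show ?thesis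
      by simp
  qed
  then show ?thesis
    using c by (simp add: intertwiner_def)
qed

lemma intertwiner_mult:
  assumes U: "unitary_rep U" and V: "unitary_rep V" and W: "unitary_rep W"
    and S: "intertwiner U V S" and T: "intertwiner V W T"
  shows "intertwiner U W (T * S)"
proof -
  note c = unitary_rep_carrier[OF U] unitary_rep_carrier[OF V] unitary_rep_carrier[OF W]
    intertwiner_carrier[OF S] intertwiner_carrier[OF T]
  have "T * S * U g = W g * (T * S)" for g
  proof -
    have "T * S * U g = T * (S * U g)"
      by (rule assoc_mult_mat[OF c(5) c(4) c(1)])
    also have "S * U g = V g * S"
      using S by (simp add: intertwiner_def)
    also have "T * (V g * S) = T * V g * S"
      by (rule assoc_mult_mat[OF c(5) c(2) c(4), symmetric])
    also have "T * V g = W g * T"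
      using T by (simp add: intertwiner_def)
    also have "W g * T * S = W g * (T * S)"
      by (rule assoc_mult_mat[OF c(3) c(5) c(4)])
    finally show ?thesis .
  qed
  then show ?thesis
    using c by (auto simp: intertwiner_def)
qed

lemma embeds_trans:
  assumes "unitary_rep U" "unitary_rep V" "unitary_rep W" "embeds U V" "embeds V W"
  shows "embeds U W"
  using assms unfolding embeds_def isometric_intertwiner_def
  by (meson intertwiner_mult isometric_mult intertwiner_carrier)

lemma irreducible_rep_unitary: "irreducible_rep U \<Longrightarrow> unitary_rep U"
  by (simp add: irreducible_rep_def)

lemma embeds_refl: "unitary_rep U \<Longrightarrow> embeds U U"
  unfolding embeds_def isometric_intertwiner_def intertwiner_def
  by (intro exI[of _ "1\<^sub>m (rep_dim U)"])
    (auto simp: left_mult_one_mat[OF unitary_rep_carrier] right_mult_one_mat[OF unitary_rep_carrier])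

lemma isometric_intertwiner_nonzero:
  assumes "isometric_intertwiner U V T" "rep_dim U > 0"
  shows "T \<noteq> 0\<^sub>m (rep_dim V) (rep_dim U)"
proof
  assume T: "T = 0\<^sub>m (rep_dim V) (rep_dim U)"
  have "(mat_adjoint T * T) $$ (0, 0) = 1"
    using assms by (simp add: isometric_intertwiner_def)
  moreover have "(mat_adjoint T * T) $$ (0, 0) = 0"
    using assms(2) T by (subst index_mult_mat_sum) auto
  ultimately show False
    by simp
qed

subsection \<open>Schur's lemma\<close>

text \<open>Over the complex numbers and in positive dimension T has an eigenvalue; the eigenspace
  is invariant and nonzero, hence the whole space.\<close>

lemma schur_scalar:
  assumes U: "irreducible_rep U" and T: "intertwiner U U T"
  obtains c where "T = c \<cdot>\<^sub>m 1\<^sub>m (rep_dim U)"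
proof -
  define n where "n = rep_dim U"
  note Uu = irreducible_rep_unitary[OF U]
  have n: "n > 0" and Tn: "T \<in> carrier_mat n n" and Un: "\<And>g. U g \<in> carrier_mat n n"
    using U T unitary_rep_carrier[OF Uu] by (auto simp: irreducible_rep_def intertwiner_def n_def)
  obtain c where "eigenvalue T c"
    using spectrum_non_empty[OF Tn n] by (auto simp: spectrum_def)
  then obtain v where v: "v \<in> carrier_vec n" "v \<noteq> 0\<^sub>v n" "T *\<^sub>v v = c \<cdot>\<^sub>v v"
    using Tn by (auto simp: eigenvalue_def eigenvector_def)
  define W where "W = {v \<in> carrier_vec n. T *\<^sub>v v = c \<cdot>\<^sub>v v}"
  have "cvec_subspace n W"
    using Tn by (auto simp: cvec_subspace_iff W_def mult_add_distrib_mat_vec[OF Tn] mult_mat_vec[OF Tn]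
        smult_add_distrib_vec[of _ n] smult_smult_assoc mult.commute)
  moreover have "U g *\<^sub>v w \<in> W" if w: "w \<in> W" for g w
  proof -
    have wn: "w \<in> carrier_vec n" and Tw: "T *\<^sub>v w = c \<cdot>\<^sub>v w"
      using w by (auto simp: W_def)
    have "T *\<^sub>v (U g *\<^sub>v w) = T * U g *\<^sub>v w"
      by (rule assoc_mult_mat_vec[OF Tn Un wn, symmetric])
    also have "T * U g = U g * T"
      using T by (simp add: intertwiner_def)
    also have "U g * T *\<^sub>v w = c \<cdot>\<^sub>v (U g *\<^sub>v w)"
      using assoc_mult_mat_vec[OF Un Tn wn] Tw mult_mat_vec[OF Un wn] by simp
    finally show ?thesis
      using wn Un[of g] by (auto simp: W_def)
  qed
  ultimately have "W = {0\<^sub>v n} \<or> W = carrier_vec n"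
    using U unfolding irreducible_rep_def n_def by blast
  then have W: "W = carrier_vec n"
    using v by (auto simp: W_def)
  have "T = c \<cdot>\<^sub>m 1\<^sub>m n"
  proof (rule eq_mat_if_mult_vec_eq[OF Tn])
    fix w :: "complex Matrix.vec" assume w: "w \<in> carrier_vec n"
    then show "T *\<^sub>v w = (c \<cdot>\<^sub>m 1\<^sub>m n) *\<^sub>v w"
      using W by (auto simp: W_def smult_vec_one_mat)
  qed auto
  then show thesis
    using that n_def by blast
qed

text \<open>By Schur's lemma \<open>mat_adjoint T * T\<close> is a scalar c. One of its diagonal
  entries is the squared length of a nonzero column of T, so c is positive and T can be rescaled to
  an isometry.\<close>

lemma irreducible_embedsI:
  assumes U: "irreducible_rep U" and V: "unitary_rep V"
    and T: "intertwiner U V T" and T0: "T \<noteq> 0\<^sub>m (rep_dim V) (rep_dim U)"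
  shows "embeds U V"
proof -
  define n where "n = rep_dim U"
  define m where "m = rep_dim V"
  note Uu = irreducible_rep_unitary[OF U]
  have Tc: "T \<in> carrier_mat m n"
    using T by (simp add: intertwiner_def n_def m_def)
  obtain c where c: "mat_adjoint T * T = c \<cdot>\<^sub>m 1\<^sub>m n"
    using schur_scalar[OF U intertwiner_mult[OF Uu V Uu T intertwiner_adjoint[OF Uu V T]]]
    unfolding n_def by blast
  obtain i j where ij: "i < m" "j < n" "T $$ (i, j) \<noteq> 0"
    using mat_nonzero_entry[OF Tc] T0 n_def m_def by blast
  define r where "r = (\<Sum>i<m. (cmod (T $$ (i, j)))\<^sup>2)"
  have "c = of_real r"
    using adjoint_mult_self_diag[of j T] ij Tc c by (simp add: r_def)
  moreover have "r > 0"
    unfolding r_def using ij by (intro sum_pos2[of _ i]) auto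
  ultimately have r: "c = of_real r" "r > 0" by auto
  define s where "s = complex_of_real (1 / sqrt r)"
  define S where "S = s \<cdot>\<^sub>m T"
  have sc: "cnj s * s * c = 1"
    using r by (simp add: s_def flip: of_real_mult)
  have "mat_adjoint S * S = (cnj s * s) \<cdot>\<^sub>m (mat_adjoint T * T)"
    unfolding S_def mat_adjoint_smult
    by (rule eq_matI) (use Tc in \<open>auto simp: scalar_prod_def sum_distrib_left mult_ac\<close>)
  also have "\<dots> = 1\<^sub>m n"
    unfolding c by (rule eq_matI) (use sc in \<open>auto simp: mult_ac\<close>)
  finally have "mat_adjoint S * S = 1\<^sub>m n" .
  moreover have "S * U g = V g * S" for g
    using mult_smult_assoc_mat[OF intertwiner_carrier[OF T] unitary_rep_carrier[OF Uu], of s g]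
      mult_smult_distrib[OF unitary_rep_carrier[OF V] intertwiner_carrier[OF T], of g s] T
    by (simp add: S_def intertwiner_def)
  then have "intertwiner U V S"
    using Tc by (simp add: intertwiner_def S_def n_def m_def)
  ultimately show ?thesis
    by (auto simp: embeds_def isometric_intertwiner_def n_def)
qed

text \<open>Schur's lemma for V makes the projection \<open>S * mat_adjoint S\<close> a scalar d,
  and \<open>S = S * mat_adjoint S * S\<close> then reads S = d S, which forces d = 1.\<close>

lemma irreducible_embeds_unitary:
  assumes U: "irreducible_rep U" and V: "irreducible_rep V" and S: "isometric_intertwiner U V S"
  shows "rep_dim V = rep_dim U" "S * mat_adjoint S = 1\<^sub>m (rep_dim V)"
proof -
  note Uu = irreducible_rep_unitary[OF U]
  note Vu = irreducible_rep_unitary[OF V]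
  define n where "n = rep_dim U"
  define m where "m = rep_dim V"
  have Si: "intertwiner U V S" and Sc: "S \<in> carrier_mat m n" "mat_adjoint S \<in> carrier_mat n m"
    and SS: "mat_adjoint S * S = 1\<^sub>m n"
    using S by (auto simp: isometric_intertwiner_def intertwiner_def n_def m_def)
  obtain d where d: "S * mat_adjoint S = d \<cdot>\<^sub>m 1\<^sub>m m"
    using schur_scalar[OF V intertwiner_mult[OF Vu Uu Vu intertwiner_adjoint[OF Uu Vu Si] Si]]
    unfolding m_def by blast
  have "S \<noteq> 0\<^sub>m m n"
    using isometric_intertwiner_nonzero[OF S] U by (auto simp: n_def m_def irreducible_rep_def)
  then obtain i j where ij: "i < m" "j < n" "S $$ (i, j) \<noteq> 0"
    using mat_nonzero_entry[OF Sc(1)] by blast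
  have "S = S * mat_adjoint S * S"
    using right_mult_one_mat[OF Sc(1)] assoc_mult_mat[OF Sc Sc(1)] SS by simp
  also have "\<dots> = d \<cdot>\<^sub>m S"
    unfolding d using Sc(1) by (subst mult_smult_assoc_mat[of _ m m _ n]) auto
  finally have "S $$ (i, j) = d * S $$ (i, j)"
    using ij Sc by (metis carrier_matD index_smult_mat(1))
  then have "d = 1"
    using ij by simp
  then show *: "S * mat_adjoint S = 1\<^sub>m (rep_dim V)"
    using d by (auto simp: m_def intro!: eq_matI)
  show "rep_dim V = rep_dim U"
    using mutually_inverse_dim_eq[OF Sc SS] * by (simp add: n_def m_def)
qed

lemma irreducible_embeds_sym:
  assumes U: "irreducible_rep U" and V: "irreducible_rep V" and "embeds U V"
  shows "embeds V U"
proof -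
  obtain S where S: "isometric_intertwiner U V S"
    using assms by (auto simp: embeds_def)
  have "isometric_intertwiner V U (mat_adjoint S)"
    using S irreducible_embeds_unitary[OF U V S] U V
    by (auto simp: isometric_intertwiner_def intertwiner_adjoint irreducible_rep_def)
  then show ?thesis
    by (auto simp: embeds_def)
qed

text \<open>Lets the relation behind the dual inherit reflexivity, symmetry and transitivity from
  \<open>embeds\<close>.\<close>

lemma unitarily_equivalent_iff_embeds:
  assumes U: "irreducible_rep U" and V: "irreducible_rep V"
  shows "unitarily_equivalent U V \<longleftrightarrow> embeds U V"
proof
  assume "unitarily_equivalent U V"
  then obtain n T where *: "unitary_mat n T" "\<And>g. U g \<in> carrier_mat n n"
    "\<And>g. V g \<in> carrier_mat n n" "\<And>g. T * U g = V g * T"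
    by (auto simp: unitarily_equivalent_def)
  then have "rep_dim U = n" "rep_dim V = n"
    by (auto simp: rep_dim_def)
  with * show "embeds U V"
    by (auto simp: embeds_def isometric_intertwiner_def intertwiner_def unitary_mat_def)
next
  assume "embeds U V"
  then obtain S where S: "isometric_intertwiner U V S"
    by (auto simp: embeds_def)
  then show "unitarily_equivalent U V"
    using irreducible_embeds_unitary[OF U V S] U V unitary_rep_carrier[of U] unitary_rep_carrier[of V]
    by (auto simp: unitarily_equivalent_def isometric_intertwiner_def intertwiner_def unitary_mat_def
        irreducible_rep_def intro!: exI[of _ "rep_dim U"] exI[of _ S])
qed

lemma rep_rel_iff:
  "(U, V) \<in> rep_rel \<longleftrightarrow> irreducible_rep U \<and> irreducible_rep V \<and> embeds U V"
  unfolding rep_rel_def using unitarily_equivalent_iff_embeds by auto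

lemma equiv_rep_rel: "equiv {U. irreducible_rep U} rep_rel"
proof (rule equivI)
  show "refl_on {U. irreducible_rep U} rep_rel"
    by (auto simp: refl_on_def rep_rel_iff intro: embeds_refl irreducible_rep_unitary)
  show "sym rep_rel"
    by (auto simp: sym_def rep_rel_iff intro: irreducible_embeds_sym)
  show "trans rep_rel"
    by (auto simp: trans_def rep_rel_iff intro: embeds_trans irreducible_rep_unitary)
  show "rep_rel \<subseteq> {U. irreducible_rep U} \<times> {U. irreducible_rep U}"
    by (auto simp: rep_rel_iff)
qed

subsection \<open>Tensor products\<close>

lemma dim_tensor_mat [simp]:
  "dim_row (tensor_mat A B) = dim_row A * dim_row B"
  "dim_col (tensor_mat A B) = dim_col A * dim_col B"
  by (auto simp: tensor_mat_def)

lemma index_tensor_mat: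
  assumes "i < dim_row A * dim_row B" "j < dim_col A * dim_col B"
  shows "tensor_mat A B $$ (i, j) =
    A $$ (i div dim_row B, j div dim_col B) * B $$ (i mod dim_row B, j mod dim_col B)"
  using assms by (simp add: tensor_mat_def)

lemma tensor_mat_carrier:
  "A \<in> carrier_mat n m \<Longrightarrow> B \<in> carrier_mat n' m' \<Longrightarrow> tensor_mat A B \<in> carrier_mat (n * n') (m * m')"
  by (intro carrier_matI) auto

lemma less_mult_mod_less: "i < a * b \<Longrightarrow> i mod b < (b :: nat)"
  by (metis less_nat_zero_code mod_less_divisor mult_0_right not_gr_zero)

lemma tensor_mat_mult:
  assumes "dim_col A = dim_row B" "dim_col C = dim_row D"
  shows "tensor_mat A C * tensor_mat B D = tensor_mat (A * B) (C * D)"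
proof (rule eq_matI)
  fix i j
  assume "i < dim_row (tensor_mat (A * B) (C * D))" "j < dim_col (tensor_mat (A * B) (C * D))"
  then have ij: "i < dim_row A * dim_row C" "j < dim_col B * dim_col D"
    by auto
  note i' = less_mult_imp_div_less[OF ij(1)] less_mult_mod_less[OF ij(1)]
  note j' = less_mult_imp_div_less[OF ij(2)] less_mult_mod_less[OF ij(2)]
  define f where "f a b = A $$ (i div dim_row C, a) * C $$ (i mod dim_row C, b) *
    (B $$ (a, j div dim_col D) * D $$ (b, j mod dim_col D))" for a b
  have "(tensor_mat A C * tensor_mat B D) $$ (i, j) =
      (\<Sum>p<dim_row B * dim_row D. f (p div dim_row D) (p mod dim_row D))"
    using ij assms
    by (subst index_mult_mat_sum) (auto simp: index_tensor_mat f_def intro!: sum.cong)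
  also have "\<dots> = (\<Sum>a<dim_row B. \<Sum>b<dim_row D. f a b)"
    by (subst sum_mult_product) (auto intro!: sum.cong)
  also have "\<dots> = (\<Sum>a<dim_row B. A $$ (i div dim_row C, a) * B $$ (a, j div dim_col D)) *
      (\<Sum>b<dim_row D. C $$ (i mod dim_row C, b) * D $$ (b, j mod dim_col D))"
    by (simp add: sum_product f_def mult_ac)
  also have "\<dots> = tensor_mat (A * B) (C * D) $$ (i, j)"
    using ij i' j' assms by (subst index_tensor_mat) (auto simp: index_mult_mat_sum simp del: index_mult_mat(1))
  finally show "(tensor_mat A C * tensor_mat B D) $$ (i, j) = tensor_mat (A * B) (C * D) $$ (i, j)" .
qed auto

lemma mat_adjoint_tensor: "mat_adjoint (tensor_mat A B) = tensor_mat (mat_adjoint A) (mat_adjoint B)"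
  by (rule eq_matI) (auto simp: index_tensor_mat less_mult_imp_div_less less_mult_mod_less)

lemma tensor_mat_one: "tensor_mat (1\<^sub>m n) (1\<^sub>m m) = 1\<^sub>m (n * m)"
proof (rule eq_matI)
  fix i j assume "i < dim_row (1\<^sub>m (n * m) :: complex mat)" "j < dim_col (1\<^sub>m (n * m) :: complex mat)"
  then have ij: "i < n * m" "j < n * m"
    by auto
  have "i = j \<longleftrightarrow> i div m = j div m \<and> i mod m = j mod m"
    by (metis div_mult_mod_eq)
  then show "tensor_mat (1\<^sub>m n) (1\<^sub>m m) $$ (i, j) = 1\<^sub>m (n * m) $$ (i, j)"
    using ij by (auto simp: index_tensor_mat less_mult_imp_div_less less_mult_mod_less)
qed auto

text \<open>The lexicographic order of product bases makes both sides equal as matrices, with no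
  reordering of the basis; on indices this is the decomposition of i in the mixed radix b,
  c.\<close>

lemma tensor_mat_assoc: "tensor_mat (tensor_mat A B) C = tensor_mat A (tensor_mat B C)"
proof -
  have idx: "i div c div b = i div (b * c)" "i div c mod b = i mod (b * c) div c"
    "i mod (b * c) mod c = i mod c" if "i < a * (b * c)" for i a b c :: nat
  proof -
    have c: "c > 0"
      using that by (cases c) auto
    show "i div c div b = i div (b * c)"
      by (simp add: div_mult2_eq mult.commute[of b])
    have "i mod (b * c) = c * (i div c mod b) + i mod c"
      using mod_mult2_eq[of i c b] by (simp add: mult.commute)
    then show "i div c mod b = i mod (b * c) div c" "i mod (b * c) mod c = i mod c"
      using c by auto
  qed
  show ?thesis
  proof (rule eq_matI)
    fix i j
    assume "i < dim_row (tensor_mat A (tensor_mat B C))" "j < dim_col (tensor_mat A (tensor_mat B C))"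
    then have i: "i < dim_row A * (dim_row B * dim_row C)" and j: "j < dim_col A * (dim_col B * dim_col C)"
      by auto
    have i2: "i < dim_row A * dim_row B * dim_row C" and j2: "j < dim_col A * dim_col B * dim_col C"
      using i j by (simp_all add: mult.assoc)
    show "tensor_mat (tensor_mat A B) C $$ (i, j) = tensor_mat A (tensor_mat B C) $$ (i, j)"
      using i j i2 j2 less_mult_imp_div_less[OF i2] less_mult_imp_div_less[OF j2]
        less_mult_mod_less[OF i] less_mult_mod_less[OF j] idx[OF i] idx[OF j]
      by (simp add: index_tensor_mat mult.assoc)
  qed (auto simp: mult.assoc)
qed

lemma continuous_on_index_mult_mat:
  fixes A B :: "'x::topological_space \<Rightarrow> complex mat"
  assumes "\<And>x. A x \<in> carrier_mat n k" "\<And>x. B x \<in> carrier_mat k m"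
    and "\<And>i j. i < n \<Longrightarrow> j < k \<Longrightarrow> continuous_on X (\<lambda>x. A x $$ (i, j))"
    and "\<And>i j. i < k \<Longrightarrow> j < m \<Longrightarrow> continuous_on X (\<lambda>x. B x $$ (i, j))"
    and "i < n" "j < m"
  shows "continuous_on X (\<lambda>x. (A x * B x) $$ (i, j))"
proof -
  have "(A x * B x) $$ (i, j) = (\<Sum>l<k. A x $$ (i, l) * B x $$ (l, j))" for x
    using assms(1,2)[of x] assms(5,6) by (subst index_mult_mat_sum) auto
  then show ?thesis
    using assms(3-6) by (auto intro!: continuous_intros)
qed

lemma rep_dim_tensor [simp]: "rep_dim (tensor_rep U V) = rep_dim U * rep_dim V"
  by (simp add: rep_dim_def tensor_rep_def)

lemma unitary_rep_tensor:
  assumes U: "unitary_rep U" and V: "unitary_rep V"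
  shows "unitary_rep (tensor_rep U V)"
proof -
  note c = unitary_rep_carrier[OF U] unitary_rep_carrier[OF V]
  have d: "dim_row (U g) = rep_dim U" "dim_col (U g) = rep_dim U"
    "dim_row (V g) = rep_dim V" "dim_col (V g) = rep_dim V" for g
    using c[of g] by auto
  have "unitary_mat (rep_dim U * rep_dim V) (tensor_mat (U g) (V g))" for g
    by (simp add: unitary_mat_def tensor_mat_carrier[OF c] mat_adjoint_tensor tensor_mat_mult d
        unitary_rep_adjoint_mult[OF U] unitary_rep_adjoint_mult[OF V] tensor_mat_one)
  moreover have "tensor_mat (U (g + h)) (V (g + h)) = tensor_mat (U g) (V g) * tensor_mat (U h) (V h)" for g h
    by (simp add: tensor_mat_mult d unitary_rep_add[OF U] unitary_rep_add[OF V])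
  moreover have "continuous_on UNIV (\<lambda>g. tensor_mat (U g) (V g) $$ (i, j))"
    if "i < rep_dim U * rep_dim V" "j < rep_dim U * rep_dim V" for i j
    using U V that less_mult_imp_div_less[OF that(1)] less_mult_mod_less[OF that(1)]
      less_mult_imp_div_less[OF that(2)] less_mult_mod_less[OF that(2)]
    by (simp add: index_tensor_mat d continuous_on_mult unitary_rep_def)
  ultimately show ?thesis
    by (simp add: unitary_rep_def) (simp add: tensor_rep_def)
qed

lemma tensor_rep_assoc: "tensor_rep (tensor_rep U V) W = tensor_rep U (tensor_rep V W)"
  by (simp add: tensor_rep_def tensor_mat_assoc)

lemma intertwiner_tensor:
  assumes U1: "unitary_rep U1" and U2: "unitary_rep U2" and V1: "unitary_rep V1" and V2: "unitary_rep V2"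
    and S: "intertwiner U1 V1 S" and T: "intertwiner U2 V2 T"
  shows "intertwiner (tensor_rep U1 U2) (tensor_rep V1 V2) (tensor_mat S T)"
proof -
  note c = unitary_rep_carrier[OF U1] unitary_rep_carrier[OF V1] unitary_rep_carrier[OF U2]
    unitary_rep_carrier[OF V2] intertwiner_carrier[OF S] intertwiner_carrier[OF T]
  note d = c[THEN carrier_matD(1)] c[THEN carrier_matD(2)]
  have "tensor_mat S T * tensor_rep U1 U2 g = tensor_rep V1 V2 g * tensor_mat S T" for g
    using S T d by (simp add: tensor_rep_def tensor_mat_mult intertwiner_def)
  then show ?thesis
    using tensor_mat_carrier[OF c(5,6)] by (simp add: intertwiner_def)
qed

lemma embeds_tensor:
  assumes U: "unitary_rep U1" "unitary_rep U2" and V: "unitary_rep V1" "unitary_rep V2"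
    and "embeds U1 V1" "embeds U2 V2"
  shows "embeds (tensor_rep U1 U2) (tensor_rep V1 V2)"
proof -
  obtain S T where ST: "isometric_intertwiner U1 V1 S" "isometric_intertwiner U2 V2 T"
    using assms by (auto simp: embeds_def)
  then have "mat_adjoint (tensor_mat S T) * tensor_mat S T = 1\<^sub>m (rep_dim U1 * rep_dim U2)"
    by (auto simp: isometric_intertwiner_def mat_adjoint_tensor tensor_mat_mult tensor_mat_one)
  then show ?thesis
    using ST U V intertwiner_tensor[of U1 U2 V1 V2 S T]
    by (auto simp: embeds_def isometric_intertwiner_def)
qed

subsection \<open>Complete reducibility\<close>

lemma mat_adjoint_four_block:
  fixes A B C D :: "complex mat"
  assumes "A \<in> carrier_mat n k" "B \<in> carrier_mat n l" "C \<in> carrier_mat m k" "D \<in> carrier_mat m l"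
  shows "mat_adjoint (four_block_mat A B C D) =
    four_block_mat (mat_adjoint A) (mat_adjoint C) (mat_adjoint B) (mat_adjoint D)"
  by (rule eq_matI) (use assms in auto)

text \<open>Blocks with zero rows stand in for a lower half, so that the multiplication rule for
  \<open>four_block_mat\<close> covers matrices placed side by side.\<close>

abbreviation hcat :: "complex mat \<Rightarrow> complex mat \<Rightarrow> complex mat" where
  "hcat A B \<equiv> four_block_mat A B (0\<^sub>m 0 (dim_col A)) (0\<^sub>m 0 (dim_col B))"

lemma hcat_carrier:
  "A \<in> carrier_mat n k \<Longrightarrow> B \<in> carrier_mat n l \<Longrightarrow> hcat A B \<in> carrier_mat n (k + l)"
  by (intro carrier_matI) auto

lemma mult_hcat:
  assumes M: "M \<in> carrier_mat m n" and A: "A \<in> carrier_mat n k" and B: "B \<in> carrier_mat n l"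
  shows "M * hcat A B = hcat (M * A) (M * B)"
proof (rule eq_matI)
  fix i j assume "i < dim_row (hcat (M * A) (M * B))" "j < dim_col (hcat (M * A) (M * B))"
  then have ij: "i < m" "j < k + l"
    using assms by auto
  show "(M * hcat A B) $$ (i, j) = hcat (M * A) (M * B) $$ (i, j)"
    using ij assms
    by (cases "j < k"; subst index_mult_mat_sum)
      (auto simp: index_mult_mat_sum simp del: index_mult_mat(1))
qed (use assms in auto)

lemma hcat_mult_diag:
  fixes A B X Y :: "complex mat"
  assumes A: "A \<in> carrier_mat n k" and B: "B \<in> carrier_mat n l"
    and X: "X \<in> carrier_mat k k" and Y: "Y \<in> carrier_mat l l"
  shows "hcat A B * four_block_mat X (0\<^sub>m k l) (0\<^sub>m l k) Y = hcat (A * X) (B * Y)"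
proof -
  have "hcat A B * four_block_mat X (0\<^sub>m k l) (0\<^sub>m l k) Y =
      four_block_mat (A * X + B * 0\<^sub>m l k) (A * 0\<^sub>m k l + B * Y)
        (0\<^sub>m 0 k * X + 0\<^sub>m 0 l * 0\<^sub>m l k) (0\<^sub>m 0 k * 0\<^sub>m k l + 0\<^sub>m 0 l * Y)"
    unfolding carrier_matD[OF A] carrier_matD[OF B]
    by (rule mult_four_block_mat[OF A B _ _ X _ _ Y]) auto
  also have "\<dots> = hcat (A * X) (B * Y)"
    using assms by (intro cong_four_block_mat) auto
  finally show ?thesis .
qed

lemma adjoint_hcat_mult_hcat:
  assumes A: "A \<in> carrier_mat n k" and B: "B \<in> carrier_mat n l"
  shows "mat_adjoint (hcat A B) * hcat A B =
    four_block_mat (mat_adjoint A * A) (mat_adjoint A * B) (mat_adjoint B * A) (mat_adjoint B * B)"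
proof -
  have "mat_adjoint (hcat A B) = four_block_mat (mat_adjoint A) (0\<^sub>m k 0) (mat_adjoint B) (0\<^sub>m l 0)"
    using assms by (subst mat_adjoint_four_block[of _ n k _ l _ 0]) (auto intro!: cong_four_block_mat eq_matI)
  then have "mat_adjoint (hcat A B) * hcat A B =
      four_block_mat (mat_adjoint A * A + 0\<^sub>m k 0 * 0\<^sub>m 0 k) (mat_adjoint A * B + 0\<^sub>m k 0 * 0\<^sub>m 0 l)
        (mat_adjoint B * A + 0\<^sub>m l 0 * 0\<^sub>m 0 k) (mat_adjoint B * B + 0\<^sub>m l 0 * 0\<^sub>m 0 l)"
    unfolding carrier_matD[OF A] carrier_matD[OF B]
    using A B by (simp only:, intro mult_four_block_mat[where ?nr1.0 = k and ?n1.0 = n and ?nr2.0 = l and ?n2.0 = 0]) auto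
  also have "\<dots> = four_block_mat (mat_adjoint A * A) (mat_adjoint A * B) (mat_adjoint B * A) (mat_adjoint B * B)"
    using assms by (intro cong_four_block_mat) auto
  finally show ?thesis .
qed

lemma hcat_mult_adjoint_hcat:
  assumes A: "A \<in> carrier_mat n k" and B: "B \<in> carrier_mat n l"
  shows "hcat A B * mat_adjoint (hcat A B) = A * mat_adjoint A + B * mat_adjoint B"
proof -
  have "mat_adjoint (hcat A B) = four_block_mat (mat_adjoint A) (0\<^sub>m k 0) (mat_adjoint B) (0\<^sub>m l 0)"
    using assms by (subst mat_adjoint_four_block[of _ n k _ l _ 0]) (auto intro!: cong_four_block_mat eq_matI)
  then have "hcat A B * mat_adjoint (hcat A B) =
      four_block_mat (A * mat_adjoint A + B * mat_adjoint B) (A * 0\<^sub>m k 0 + B * 0\<^sub>m l 0)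
        (0\<^sub>m 0 k * mat_adjoint A + 0\<^sub>m 0 l * mat_adjoint B) (0\<^sub>m 0 k * 0\<^sub>m k 0 + 0\<^sub>m 0 l * 0\<^sub>m l 0)"
    unfolding carrier_matD[OF A] carrier_matD[OF B]
    using A B by (simp only:, intro mult_four_block_mat[where ?nr1.0 = n and ?n1.0 = k and ?nr2.0 = 0 and ?n2.0 = l]) auto
  also have "\<dots> = A * mat_adjoint A + B * mat_adjoint B"
    by (rule eq_matI) (use assms in auto)
  finally show ?thesis .
qed

text \<open>With P the projection onto W, invariance gives P V(g) P = V(g) P. The adjoint of this
  identity at -g reads P V(g) P = P V(g), since \<open>V (- g)\<close> is the adjoint of
  \<open>V g\<close>.\<close>

lemma invariant_projection_commute:
  assumes V: "unitary_rep V" and S: "S \<in> carrier_mat (rep_dim V) k"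
    and char: "\<forall>v\<in>carrier_vec (rep_dim V). v \<in> W \<longleftrightarrow> S * mat_adjoint S *\<^sub>v v = v"
    and SS: "mat_adjoint S * S = 1\<^sub>m k"
    and inv: "\<And>g v. v \<in> W \<Longrightarrow> V g *\<^sub>v v \<in> W"
  shows "V g * (S * mat_adjoint S) = S * mat_adjoint S * V g"
proof -
  define n where "n = rep_dim V"
  define P where "P = S * mat_adjoint S"
  note pr = isometry_projection[OF S[folded n_def] SS, folded P_def]
  note P = pr(1) and aP = pr(2) and PP = pr(3)
  have Vc: "\<And>g. V g \<in> carrier_mat n n"
    using unitary_rep_carrier[OF V] by (simp add: n_def)
  have PVP: "P * (V g * P) = V g * P" for g
  proof (rule eq_mat_if_mult_vec_eq[of _ n n])
    fix v :: "complex Matrix.vec" assume v: "v \<in> carrier_vec n"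
    have Pv: "P *\<^sub>v v \<in> carrier_vec n" "V g *\<^sub>v (P *\<^sub>v v) \<in> carrier_vec n"
      using P Vc[of g] v by (auto intro!: carrier_vecI)
    have "P *\<^sub>v (P *\<^sub>v v) = P *\<^sub>v v"
      using assoc_mult_mat_vec[OF P P v] PP by simp
    then have "V g *\<^sub>v (P *\<^sub>v v) \<in> W"
      using Pv(1) inv bspec[OF char, of "P *\<^sub>v v"] unfolding P_def n_def by blast
    then have "P *\<^sub>v (V g *\<^sub>v (P *\<^sub>v v)) = V g *\<^sub>v (P *\<^sub>v v)"
      using Pv(2) bspec[OF char, of "V g *\<^sub>v (P *\<^sub>v v)"] unfolding P_def n_def by blast
    moreover have "V g * P *\<^sub>v v = V g *\<^sub>v (P *\<^sub>v v)"
      by (rule assoc_mult_mat_vec[OF Vc P v])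
    moreover have "P * (V g * P) *\<^sub>v v = P *\<^sub>v (V g * P *\<^sub>v v)"
      by (rule assoc_mult_mat_vec[OF P mult_carrier_mat[OF Vc P] v])
    ultimately show "P * (V g * P) *\<^sub>v v = V g * P *\<^sub>v v"
      by simp
  qed (use P mult_carrier_mat[OF Vc P] in auto)
  have d: "dim_row P = n" "dim_col P = n" "dim_row (V g) = n" "dim_col (V g) = n" for g
    using P Vc[of g] by auto
  have "mat_adjoint (P * (V (- g) * P)) = mat_adjoint (V (- g) * P)"
    using PVP by simp
  then have "P * V g * P = P * V g"
    by (simp add: mat_adjoint_mult d aP unitary_rep_minus[OF V])
  then show ?thesis
    using PVP[of g] assoc_mult_mat[OF P Vc P, of g] by (simp add: P_def)
qed

text \<open>U is the restriction of V to the range of S, written in the basis of the columns of S.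
  Commutation with the projection makes S an intertwiner, from which multiplicativity follows;
  unitarity holds because the adjoint of \<open>U g\<close> is \<open>U (- g)\<close>.\<close>

lemma unitary_rep_compress:
  assumes V: "unitary_rep V" and S: "S \<in> carrier_mat (rep_dim V) k"
    and SS: "mat_adjoint S * S = 1\<^sub>m k"
    and comm: "\<And>g. V g * (S * mat_adjoint S) = S * mat_adjoint S * V g"
  defines "U \<equiv> \<lambda>g. mat_adjoint S * (V g * S)"
  shows "unitary_rep U" "rep_dim U = k" "intertwiner U V S"
proof -
  define n where "n = rep_dim V"
  have Sc: "S \<in> carrier_mat n k" "mat_adjoint S \<in> carrier_mat k n"
    using S by (auto simp: n_def)
  have Vc: "V g \<in> carrier_mat n n" for g
    using unitary_rep_carrier[OF V] by (auto simp: n_def)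
  have VS: "V g * S \<in> carrier_mat n k" for g
    by (rule mult_carrier_mat[OF Vc Sc(1)])
  show dim: "rep_dim U = k"
    using Sc by (simp add: rep_dim_def U_def)
  have Uc: "U g \<in> carrier_mat k k" for g
    unfolding U_def by (rule mult_carrier_mat[OF Sc(2) VS])
  have SU: "S * U g = V g * S" for g
  proof -
    have "S * U g = S * mat_adjoint S * (V g * S)"
      unfolding U_def by (rule assoc_mult_mat[OF Sc VS, symmetric])
    also have "\<dots> = S * mat_adjoint S * V g * S"
      using Sc Vc by (intro assoc_mult_mat[of _ n n _ n _ k, symmetric]) auto
    also have "\<dots> = V g * (S * mat_adjoint S) * S"
      by (simp add: comm)
    also have "\<dots> = V g * (S * mat_adjoint S * S)"
      using Sc Vc by (intro assoc_mult_mat[of _ n n _ n _ k]) auto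
    also have "S * mat_adjoint S * S = S"
      using assoc_mult_mat[OF Sc Sc(1)] SS right_mult_one_mat[OF Sc(1)] by simp
    finally show ?thesis .
  qed
  have add: "U (g + h) = U g * U h" for g h
  proof -
    have "mat_adjoint S * (V g * S) * U h = mat_adjoint S * (V g * S * U h)"
      by (rule assoc_mult_mat[OF Sc(2) VS Uc])
    also have "V g * S * U h = V g * (S * U h)"
      by (rule assoc_mult_mat[OF Vc Sc(1) Uc])
    also have "\<dots> = V g * V h * S"
      unfolding SU by (rule assoc_mult_mat[OF Vc Vc Sc(1), symmetric])
    also have "mat_adjoint S * (V g * V h * S) = U (g + h)"
      by (simp add: U_def unitary_rep_add[OF V])
    finally show ?thesis
      by (simp add: U_def)
  qed
  have "U 0 = 1\<^sub>m k"
    using SS left_mult_one_mat[OF Sc(1)] by (simp add: U_def unitary_rep_zero[OF V] flip: n_def)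
  moreover have "mat_adjoint (U g) = U (- g)" for g
  proof -
    have "mat_adjoint (U g) = mat_adjoint S * V (- g) * S"
      unfolding U_def using Sc carrier_matD[OF Vc[of g]] by (simp add: mat_adjoint_mult unitary_rep_minus[OF V])
    also have "\<dots> = U (- g)"
      unfolding U_def by (rule assoc_mult_mat[OF Sc(2) Vc Sc(1)])
    finally show ?thesis .
  qed
  ultimately have "unitary_mat k (U g)" for g
    using Uc[of g] add[of "- g" g] by (simp add: unitary_mat_def)
  moreover have VScont: "continuous_on UNIV (\<lambda>g. (V g * S) $$ (i, j))" if "i < n" "j < k" for i j
    using V that by (intro continuous_on_index_mult_mat[OF Vc Sc(1)]) (auto simp: unitary_rep_def n_def)
  have "continuous_on UNIV (\<lambda>g. U g $$ (i, j))" if "i < k" "j < k" for i j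
    unfolding U_def using that
    by (intro continuous_on_index_mult_mat[OF Sc(2) VS] VScont) auto
  ultimately show "unitary_rep U"
    using add by (auto simp: unitary_rep_def dim)
  show "intertwiner U V S"
    using SU S by (auto simp: intertwiner_def dim)
qed

text \<open>The columns of R form an orthonormal basis of the kernel of P =
  \<open>S * mat_adjoint S\<close>. The projection Q onto it satisfies P Q = 0, and Q P = 0 by
  taking adjoints; since v - P v lies in the kernel, Q fixes it, whence P + Q = 1.\<close>

lemma orthogonal_complement_isometry:
  fixes S :: "complex mat"
  assumes S: "S \<in> carrier_mat n k" and SS: "mat_adjoint S * S = 1\<^sub>m k"
  obtains l R where "R \<in> carrier_mat n l" "mat_adjoint R * R = 1\<^sub>m l"
    "S * mat_adjoint S + R * mat_adjoint R = 1\<^sub>m n"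
    "\<forall>v\<in>carrier_vec n. S * mat_adjoint S *\<^sub>v v = 0\<^sub>v n \<longleftrightarrow> R * mat_adjoint R *\<^sub>v v = v"
proof -
  define P where "P = S * mat_adjoint S"
  note pr = isometry_projection[OF S SS, folded P_def]
  note P = pr(1) and aP = pr(2) and PP = pr(3)
  define W where "W = {v \<in> carrier_vec n. P *\<^sub>v v = 0\<^sub>v n}"
  have "cvec_subspace n W"
    using P by (auto simp: cvec_subspace_iff W_def mult_add_distrib_mat_vec[OF P] mult_mat_vec[OF P]
        intro!: eq_vecI)
  then obtain l R where R: "R \<in> carrier_mat n l" and RR: "mat_adjoint R * R = 1\<^sub>m l"
    and char: "\<forall>v\<in>carrier_vec n. v \<in> W \<longleftrightarrow> R * mat_adjoint R *\<^sub>v v = v"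
    by (rule cvec_subspace_isometry)
  define Q where "Q = R * mat_adjoint R"
  note qr = isometry_projection[OF R RR, folded Q_def]
  note Q = qr(1) and aQ = qr(2) and QQ = qr(3)
  have "P * Q = 0\<^sub>m n n"
  proof (rule eq_mat_if_mult_vec_eq[of _ n n])
    fix v :: "complex Matrix.vec" assume v: "v \<in> carrier_vec n"
    have Qv: "Q *\<^sub>v v \<in> carrier_vec n"
      using Q v by (auto intro!: carrier_vecI)
    have "Q *\<^sub>v (Q *\<^sub>v v) = Q *\<^sub>v v"
      using assoc_mult_mat_vec[OF Q Q v] QQ by simp
    then have "Q *\<^sub>v v \<in> W"
      using Qv char by (simp add: Q_def)
    then show "P * Q *\<^sub>v v = 0\<^sub>m n n *\<^sub>v v"
      using assoc_mult_mat_vec[OF P Q v] v by (auto simp: W_def intro!: eq_vecI)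
  qed (use P Q in auto)
  then have "mat_adjoint (P * Q) = mat_adjoint (0\<^sub>m n n)"
    by simp
  moreover have "mat_adjoint (0\<^sub>m n n) = (0\<^sub>m n n :: complex mat)"
    by (rule eq_matI) auto
  ultimately have QP: "Q * P = 0\<^sub>m n n"
    using P Q aP aQ by (simp add: mat_adjoint_mult)
  have "P + Q = 1\<^sub>m n"
  proof (rule eq_mat_if_mult_vec_eq[of _ n n])
    fix v :: "complex Matrix.vec" assume v: "v \<in> carrier_vec n"
    have Pv: "P *\<^sub>v v \<in> carrier_vec n" and Qv: "Q *\<^sub>v v \<in> carrier_vec n"
      using P Q v by (auto intro!: carrier_vecI)
    have "P *\<^sub>v (P *\<^sub>v v) = P *\<^sub>v v"
      using assoc_mult_mat_vec[OF P P v] PP by simp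
    then have "v - P *\<^sub>v v \<in> W"
      using v Pv by (simp add: W_def mult_minus_distrib_mat_vec[OF P])
    then have "Q *\<^sub>v (v - P *\<^sub>v v) = v - P *\<^sub>v v"
      using v Pv char by (simp add: Q_def)
    moreover have "Q *\<^sub>v (P *\<^sub>v v) = 0\<^sub>v n"
      unfolding assoc_mult_mat_vec[OF Q P v, symmetric] QP using v by (intro eq_vecI) auto
    ultimately have "Q *\<^sub>v v = v - P *\<^sub>v v"
      using v Pv Qv by (simp add: mult_minus_distrib_mat_vec[OF Q])
    then show "(P + Q) *\<^sub>v v = 1\<^sub>m n *\<^sub>v v"
      using v carrier_matD[OF P] by (simp add: add_mult_distrib_mat_vec[OF P Q]) (auto intro!: eq_vecI)
  qed (use P Q in auto)
  then show thesis
    using that[OF R RR] char by (auto simp: P_def Q_def W_def)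
qed

text \<open>Induction on the dimension: a proper invariant subspace and its orthogonal complement
  carry representations of smaller dimension, whose adapted bases are joined by \<open>hcat\<close>.
  The induction is phrased with T on the right of \<open>V g\<close>, so that the columns of T are
  the adapted basis; the adjoint of T gives the direction that \<open>unitarily_equivalent\<close>
  demands.\<close>

theorem complete_reducibility:
  assumes "unitary_rep V"
  obtains Us where "\<forall>U\<in>set Us. irreducible_rep U"
    "unitarily_equivalent V (\<lambda>g. diag_block_mat (map (\<lambda>U. U g) Us))"
proof -
  have "\<exists>Us. (\<forall>U\<in>set Us. irreducible_rep U) \<and> (\<exists>T. unitary_mat (rep_dim V) T \<and>
      (\<forall>g. diag_block_mat (map (\<lambda>U. U g) Us) \<in> carrier_mat (rep_dim V) (rep_dim V) \<and>
        V g * T = T * diag_block_mat (map (\<lambda>U. U g) Us)))"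
    using assms
  proof (induction "rep_dim V" arbitrary: V rule: less_induct)
    case (less V)
    define n where "n = rep_dim V"
    have Vc: "V g \<in> carrier_mat n n" for g
      using unitary_rep_carrier[OF less.prems] by (simp add: n_def)
    consider "n = 0" | "irreducible_rep V" | "n > 0" "\<not> irreducible_rep V"
      by blast
    then show ?case
    proof cases
      \<comment> \<open>The empty list decomposes the zero-dimensional representation.\<close>
      case 1
      then have "rep_dim V = 0"
        by (simp add: n_def)
      moreover have "V g * 1\<^sub>m 0 = 1\<^sub>m 0 * 0\<^sub>m 0 0" for g
        using Vc[of g] 1 by (intro eq_matI) auto
      ultimately show ?thesis
        by (intro exI[of _ "[]"] conjI exI[of _ "1\<^sub>m 0"]) (simp_all add: unitary_mat_def)
    next
      case 2
      then show ?thesis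
        using Vc left_mult_one_mat[OF Vc] right_mult_one_mat[OF Vc]
        unfolding n_def[symmetric]
        by (intro exI[of _ "[V]"] conjI exI[of _ "1\<^sub>m n"]) (simp_all add: unitary_mat_def del: diag_block_mat.simps)
    next
      case 3
      then obtain W where W: "cvec_subspace n W" and inv: "\<And>g v. v \<in> W \<Longrightarrow> V g *\<^sub>v v \<in> W"
        and W0: "W \<noteq> {0\<^sub>v n}" and W1: "W \<noteq> carrier_vec n"
        using less.prems unfolding irreducible_rep_def n_def by blast
      have Wn: "W \<subseteq> carrier_vec n"
        using W by (auto simp: cvec_subspace_iff)
      obtain k S where S: "S \<in> carrier_mat n k" and SS: "mat_adjoint S * S = 1\<^sub>m k"
        and Schar: "\<forall>v\<in>carrier_vec n. v \<in> W \<longleftrightarrow> S * mat_adjoint S *\<^sub>v v = v"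
        by (rule cvec_subspace_isometry[OF W])
      obtain l R where R: "R \<in> carrier_mat n l" and RR: "mat_adjoint R * R = 1\<^sub>m l"
        and sum1: "S * mat_adjoint S + R * mat_adjoint R = 1\<^sub>m n"
        and Rchar: "\<forall>v\<in>carrier_vec n. S * mat_adjoint S *\<^sub>v v = 0\<^sub>v n \<longleftrightarrow> R * mat_adjoint R *\<^sub>v v = v"
        by (rule orthogonal_complement_isometry[OF S SS])
      have aS: "mat_adjoint S \<in> carrier_mat k n" and aR: "mat_adjoint R \<in> carrier_mat l n"
        using S R by auto
      define P where "P = S * mat_adjoint S"
      have P: "P \<in> carrier_mat n n"
        using S aS by (auto simp: P_def)
      have comm: "V g * P = P * V g" for g
        unfolding P_def
        by (rule invariant_projection_commute[OF less.prems S[unfolded n_def] Schar[unfolded n_def] SS inv])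
      define W' where "W' = {v \<in> carrier_vec n. P *\<^sub>v v = 0\<^sub>v n}"
      have inv': "V g *\<^sub>v v \<in> W'" if "v \<in> W'" for g v
      proof -
        have v: "v \<in> carrier_vec n" "P *\<^sub>v v = 0\<^sub>v n"
          using that by (auto simp: W'_def)
        have "P *\<^sub>v (V g *\<^sub>v v) = V g *\<^sub>v (P *\<^sub>v v)"
          using assoc_mult_mat_vec[OF P Vc v(1)] assoc_mult_mat_vec[OF Vc P v(1)] comm by simp
        also have "\<dots> = 0\<^sub>v n"
          unfolding v(2) using Vc[of g] by (intro eq_vecI) auto
        finally show ?thesis
          using Vc[of g] v by (auto simp: W'_def intro!: carrier_vecI)
      qed
      have char': "\<forall>v\<in>carrier_vec n. v \<in> W' \<longleftrightarrow> R * mat_adjoint R *\<^sub>v v = v"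
        using Rchar unfolding W'_def P_def by blast
      have comm': "V g * (R * mat_adjoint R) = R * mat_adjoint R * V g" for g
        by (rule invariant_projection_commute[OF less.prems R[unfolded n_def] char'[unfolded n_def] RR inv'])
      define V1 where "V1 = (\<lambda>g. mat_adjoint S * (V g * S))"
      define V2 where "V2 = (\<lambda>g. mat_adjoint R * (V g * R))"
      note V1 = unitary_rep_compress[OF less.prems S[unfolded n_def] SS comm[unfolded P_def], folded V1_def]
      note V2 = unitary_rep_compress[OF less.prems R[unfolded n_def] RR comm', folded V2_def]
      have V1c: "V1 g \<in> carrier_mat k k" and V2c: "V2 g \<in> carrier_mat l l" for g
        using unitary_rep_carrier[OF V1(1)] unitary_rep_carrier[OF V2(1)] V1(2) V2(2) by auto
      have "0 < k"
      proof (rule ccontr)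
        assume "\<not> 0 < k"
        then have k: "k = 0"
          by simp
        have "v = 0\<^sub>v n" if "v \<in> W" for v
        proof -
          have "v = S * mat_adjoint S *\<^sub>v v"
            using that Wn Schar by auto
          also have "\<dots> = 0\<^sub>v n"
            using S k that Wn by (intro eq_vecI) (auto simp: scalar_prod_def)
          finally show ?thesis .
        qed
        then show False
          using W0 W by (auto simp: cvec_subspace_iff)
      qed
      moreover have "0 < l"
      proof (rule ccontr)
        assume "\<not> 0 < l"
        then have "R * mat_adjoint R = 0\<^sub>m n n"
          using R by (intro eq_matI) (auto simp: scalar_prod_def)
        then have "S * mat_adjoint S = 1\<^sub>m n"
          using sum1 S aS by simp
        then have "W = carrier_vec n"
          using Schar Wn by auto
        then show False
          using W1 by simp
      qed
      moreover have SR: "mat_adjoint S * R = 0\<^sub>m k l"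
      proof -
        \<comment> \<open>Multiplying \<open>sum1\<close> by \<open>mat_adjoint S\<close> from the
          left shows that \<open>mat_adjoint S * (R * mat_adjoint R)\<close> vanishes; multiplying
          by R from the right then removes the projection.\<close>
        have "mat_adjoint S = mat_adjoint S * (S * mat_adjoint S + R * mat_adjoint R)"
          using right_mult_one_mat[OF aS] by (simp add: sum1)
        also have "\<dots> = mat_adjoint S * (S * mat_adjoint S) + mat_adjoint S * (R * mat_adjoint R)"
          using S R by (intro mult_add_distrib_mat[of _ k n _ n]) auto
        also have "mat_adjoint S * (S * mat_adjoint S) = mat_adjoint S"
          by (rule left_inverse_mat_cancel[OF aS S aS SS])
        finally have eq: "mat_adjoint S = mat_adjoint S + mat_adjoint S * (R * mat_adjoint R)" .
        have z: "mat_adjoint S * (R * mat_adjoint R) = 0\<^sub>m k n"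
        proof (rule eq_matI)
          fix i j assume "i < dim_row (0\<^sub>m k n :: complex mat)" "j < dim_col (0\<^sub>m k n :: complex mat)"
          then have ij: "i < k" "j < n"
            by auto
          then have "mat_adjoint S $$ (i, j) =
              mat_adjoint S $$ (i, j) + (mat_adjoint S * (R * mat_adjoint R)) $$ (i, j)"
            using S R by (subst eq, subst index_add_mat) auto
          then show "(mat_adjoint S * (R * mat_adjoint R)) $$ (i, j) = 0\<^sub>m k n $$ (i, j)"
            using ij by simp
        qed (use S R in auto)
        have "mat_adjoint S * R = mat_adjoint S * (R * (mat_adjoint R * R))"
          using R RR by simp
        also have "R * (mat_adjoint R * R) = R * mat_adjoint R * R"
          by (rule assoc_mult_mat[OF R aR R, symmetric])
        also have "mat_adjoint S * (R * mat_adjoint R * R) = mat_adjoint S * (R * mat_adjoint R) * R"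
          using R aS by (intro assoc_mult_mat[of _ k n _ n _ l, symmetric]) auto
        finally show ?thesis
          using z R by simp
      qed
      moreover have RS: "mat_adjoint R * S = 0\<^sub>m l k"
      proof -
        have "mat_adjoint R * S = mat_adjoint (mat_adjoint S * R)"
          using S R by (simp add: mat_adjoint_mult)
        also have "\<dots> = 0\<^sub>m l k"
          unfolding SR by (rule eq_matI) auto
        finally show ?thesis .
      qed
      \<comment> \<open>The joined matrix of S and R is inverse to its adjoint on both sides, so it
        is square. As k and l are positive, both pieces are strictly smaller than n.\<close>
      moreover have "n = k + l"
        using hcat_carrier[OF S R] adjoint_hcat_mult_hcat[OF S R] hcat_mult_adjoint_hcat[OF S R] SS RR SR RS sum1
        by (intro mutually_inverse_dim_eq[OF hcat_carrier[OF S R] mat_adjoint_carrier[OF hcat_carrier[OF S R]]]) simp_all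
      ultimately have lt: "k < n" "l < n" and n: "n = k + l"
        by auto
      obtain Us1 T1 where 1: "\<forall>U\<in>set Us1. irreducible_rep U" "unitary_mat k T1"
        "\<And>g. diag_block_mat (map (\<lambda>U. U g) Us1) \<in> carrier_mat k k"
        "\<And>g. V1 g * T1 = T1 * diag_block_mat (map (\<lambda>U. U g) Us1)"
        using less.hyps[of V1] V1 lt by (auto simp: n_def)
      obtain Us2 T2 where 2: "\<forall>U\<in>set Us2. irreducible_rep U" "unitary_mat l T2"
        "\<And>g. diag_block_mat (map (\<lambda>U. U g) Us2) \<in> carrier_mat l l"
        "\<And>g. V2 g * T2 = T2 * diag_block_mat (map (\<lambda>U. U g) Us2)"
        using less.hyps[of V2] V2 lt by (auto simp: n_def)
      have T1: "T1 \<in> carrier_mat k k" and T2: "T2 \<in> carrier_mat l l"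
        using 1 2 by (auto simp: unitary_mat_def)
      define T where "T = hcat (S * T1) (R * T2)"
      have ST: "S * T1 \<in> carrier_mat n k" and RT: "R * T2 \<in> carrier_mat n l"
        using S R T1 T2 by auto
      have orth: "mat_adjoint (A * B) * (C * D) = 0\<^sub>m b d"
        if "A \<in> carrier_mat n a" "B \<in> carrier_mat a b" "C \<in> carrier_mat n c" "D \<in> carrier_mat c d"
          "mat_adjoint A * C = 0\<^sub>m a c" for A B C D :: "complex mat" and a b c d
      proof -
        have "mat_adjoint (A * B) * (C * D) = mat_adjoint B * mat_adjoint A * (C * D)"
          using that by (simp add: mat_adjoint_mult)
        also have "\<dots> = mat_adjoint B * (mat_adjoint A * (C * D))"
          using that by (intro assoc_mult_mat[of _ b a _ n _ d]) auto
        also have "mat_adjoint A * (C * D) = mat_adjoint A * C * D"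
          using that by (intro assoc_mult_mat[of _ a n _ c _ d, symmetric]) auto
        finally show ?thesis
          using that(2,4,5) by simp
      qed
      have "mat_adjoint T * T = 1\<^sub>m n"
        unfolding T_def adjoint_hcat_mult_hcat[OF ST RT]
          orth[OF S T1 R T2 SR] orth[OF R T2 S T1 RS]
        using isometric_mult[OF T1 _ S SS] isometric_mult[OF T2 _ R RR] 1(2) 2(2) n
        by (simp add: unitary_mat_def)
      then have Tu: "unitary_mat n T"
        using hcat_carrier[OF ST RT] n by (simp add: unitary_mat_def T_def)
      have "V g * T = T * diag_block_mat (map (\<lambda>U. U g) (Us1 @ Us2))" for g
      proof -
        have "V g * (S * T1) = S * T1 * diag_block_mat (map (\<lambda>U. U g) Us1)"
        proof -
          have "V g * (S * T1) = V g * S * T1"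
            by (rule assoc_mult_mat[OF Vc S T1, symmetric])
          also have "V g * S = S * V1 g"
            using V1(3) by (simp add: intertwiner_def)
          also have "S * V1 g * T1 = S * (V1 g * T1)"
            by (rule assoc_mult_mat[OF S V1c T1])
          finally show ?thesis
            using assoc_mult_mat[OF S T1 1(3)[of g]] 1(4) by simp
        qed
        moreover have "V g * (R * T2) = R * T2 * diag_block_mat (map (\<lambda>U. U g) Us2)"
        proof -
          have "V g * (R * T2) = V g * R * T2"
            by (rule assoc_mult_mat[OF Vc R T2, symmetric])
          also have "V g * R = R * V2 g"
            using V2(3) by (simp add: intertwiner_def)
          also have "R * V2 g * T2 = R * (V2 g * T2)"
            by (rule assoc_mult_mat[OF R V2c T2])
          finally show ?thesis
            using assoc_mult_mat[OF R T2 2(3)[of g]] 2(4) by simp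
        qed
        ultimately have "V g * T = hcat (S * T1 * diag_block_mat (map (\<lambda>U. U g) Us1))
            (R * T2 * diag_block_mat (map (\<lambda>U. U g) Us2))"
          unfolding T_def mult_hcat[OF Vc ST RT] by simp
        also have "\<dots> = T * diag_block_mat (map (\<lambda>U. U g) (Us1 @ Us2))"
          unfolding T_def map_append diag_block_mat_append Let_def hcat_mult_diag[OF ST RT 1(3) 2(3), symmetric]
          using 1(3)[of g] 2(3)[of g] by simp
        finally show ?thesis .
      qed
      moreover have "diag_block_mat (map (\<lambda>U. U g) (Us1 @ Us2)) \<in> carrier_mat n n" for g
        using 1(3)[of g] 2(3)[of g] n by (auto simp: diag_block_mat_append Let_def)
      ultimately show ?thesis
        using 1(1) 2(1) Tu unfolding n_def[symmetric]
        by (intro exI[of _ "Us1 @ Us2"] conjI exI[of _ T] allI) auto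
    qed
  qed
  then obtain Us T where Us: "\<forall>U\<in>set Us. irreducible_rep U" and T: "unitary_mat (rep_dim V) T"
    and D: "\<And>g. diag_block_mat (map (\<lambda>U. U g) Us) \<in> carrier_mat (rep_dim V) (rep_dim V)"
    and VT: "\<And>g. V g * T = T * diag_block_mat (map (\<lambda>U. U g) Us)"
    by blast
  note Vc = unitary_rep_carrier[OF assms]
  have Tc: "T \<in> carrier_mat (rep_dim V) (rep_dim V)" "mat_adjoint T \<in> carrier_mat (rep_dim V) (rep_dim V)"
    using T by (auto simp: unitary_mat_def)
  have "mat_adjoint T * V g = diag_block_mat (map (\<lambda>U. U g) Us) * mat_adjoint T" for g
  proof -
    have "mat_adjoint T * V g = mat_adjoint T * (V g * T * mat_adjoint T)"
      using right_inverse_mat_cancel[OF Tc Vc unitary_mat_inverse[OF T]] by simp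
    also have "V g * T * mat_adjoint T = T * (diag_block_mat (map (\<lambda>U. U g) Us) * mat_adjoint T)"
      unfolding VT by (rule assoc_mult_mat[OF Tc(1) D Tc(2)])
    also have "mat_adjoint T * \<dots> = diag_block_mat (map (\<lambda>U. U g) Us) * mat_adjoint T"
      using T D[of g] Tc by (intro left_inverse_mat_cancel) (auto simp: unitary_mat_def)
    finally show ?thesis .
  qed
  then have "unitarily_equivalent V (\<lambda>g. diag_block_mat (map (\<lambda>U. U g) Us))"
    using unitary_mat_adjoint[OF T] Vc D unfolding unitarily_equivalent_def
    by (intro exI[of _ "rep_dim V"] exI[of _ "mat_adjoint T"]) simp
  then show thesis
    using that Us by blast
qed

section \<open>Inclusions of the summands of a block diagonal representation\<close>

abbreviation vcat :: "complex mat \<Rightarrow> complex mat \<Rightarrow> complex mat" where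
  "vcat A B \<equiv> four_block_mat A (0\<^sub>m (dim_row A) 0) B (0\<^sub>m (dim_row B) 0)"

lemma vcat_carrier:
  "A \<in> carrier_mat n m \<Longrightarrow> B \<in> carrier_mat k m \<Longrightarrow> vcat A B \<in> carrier_mat (n + k) m"
  by (intro carrier_matI) auto

lemma vcat_mult:
  assumes A: "A \<in> carrier_mat n m" and B: "B \<in> carrier_mat k m" and M: "M \<in> carrier_mat m l"
  shows "vcat A B * M = vcat (A * M) (B * M)"
proof (rule eq_matI)
  fix i j assume "i < dim_row (vcat (A * M) (B * M))" "j < dim_col (vcat (A * M) (B * M))"
  then have ij: "i < n + k" "j < l"
    using assms by auto
  show "(vcat A B * M) $$ (i, j) = vcat (A * M) (B * M) $$ (i, j)"
    using ij assms
    by (cases "i < n"; subst index_mult_mat_sum)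
      (auto simp: index_mult_mat_sum simp del: index_mult_mat(1))
qed (use assms in auto)

lemma adjoint_vcat_mult_vcat:
  assumes A: "A \<in> carrier_mat n m" and B: "B \<in> carrier_mat k m"
    and C: "C \<in> carrier_mat n l" and D: "D \<in> carrier_mat k l"
  shows "mat_adjoint (vcat A B) * vcat C D = mat_adjoint A * C + mat_adjoint B * D"
proof -
  have "mat_adjoint (vcat A B) = four_block_mat (mat_adjoint A) (mat_adjoint B) (0\<^sub>m 0 n) (0\<^sub>m 0 k)"
    using assms by (subst mat_adjoint_four_block[of _ n m _ 0 _ k]) (auto intro!: cong_four_block_mat eq_matI)
  then have "mat_adjoint (vcat A B) * vcat C D =
      four_block_mat (mat_adjoint A * C + mat_adjoint B * D) (mat_adjoint A * 0\<^sub>m n 0 + mat_adjoint B * 0\<^sub>m k 0)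
        (0\<^sub>m 0 n * C + 0\<^sub>m 0 k * D) (0\<^sub>m 0 n * 0\<^sub>m n 0 + 0\<^sub>m 0 k * 0\<^sub>m k 0)"
    unfolding carrier_matD[OF C] carrier_matD[OF D]
    using assms by (simp only:, intro mult_four_block_mat[where ?nr1.0 = m and ?n1.0 = n and ?nr2.0 = 0 and ?n2.0 = k]) auto
  also have "\<dots> = mat_adjoint A * C + mat_adjoint B * D"
    by (rule eq_matI) (use assms in auto)
  finally show ?thesis .
qed

lemma diag_mult_vcat:
  fixes A B X Y :: "complex mat"
  assumes X: "X \<in> carrier_mat n n" and Y: "Y \<in> carrier_mat k k"
    and A: "A \<in> carrier_mat n m" and B: "B \<in> carrier_mat k m"
  shows "four_block_mat X (0\<^sub>m n k) (0\<^sub>m k n) Y * vcat A B = vcat (X * A) (Y * B)"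
proof -
  have "four_block_mat X (0\<^sub>m n k) (0\<^sub>m k n) Y * vcat A B =
      four_block_mat (X * A + 0\<^sub>m n k * B) (X * 0\<^sub>m n 0 + 0\<^sub>m n k * 0\<^sub>m k 0)
        (0\<^sub>m k n * A + Y * B) (0\<^sub>m k n * 0\<^sub>m n 0 + Y * 0\<^sub>m k 0)"
    unfolding carrier_matD[OF A] carrier_matD[OF B]
    by (rule mult_four_block_mat[OF X _ _ Y A _ B]) auto
  also have "\<dots> = vcat (X * A) (Y * B)"
    using assms by (intro cong_four_block_mat) (auto intro: eq_matI)
  finally show ?thesis .
qed

text \<open>The target dimension is the sum over the list rather than the \<open>rep_dim\<close> of
  the block matrix, the form in which induction over the list works. J is not tied to a position,
  since a representation may occur in the list several times.\<close>

definition block_inclusion :: "'g::{topological_group_add, t2_space} rep list \<Rightarrow> 'g rep \<Rightarrow> complex mat \<Rightarrow> bool" where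
  "block_inclusion Us U J \<longleftrightarrow> J \<in> carrier_mat (sum_list (map rep_dim Us)) (rep_dim U) \<and>
     mat_adjoint J * J = 1\<^sub>m (rep_dim U) \<and> (\<forall>g. diag_block_mat (map (\<lambda>U. U g) Us) * J = J * U g)"

lemma diag_block_mat_carrier:
  assumes "\<forall>U\<in>set Us. unitary_rep U"
  shows "diag_block_mat (map (\<lambda>U. U g) Us) \<in>
    carrier_mat (sum_list (map rep_dim Us)) (sum_list (map rep_dim Us))"
proof -
  have "dim_row (U g) = rep_dim U" "dim_col (U g) = rep_dim U" if "U \<in> set Us" for U
    using assms unitary_rep_carrier[of U g] that by auto
  then show ?thesis
    by (intro carrier_matI) (auto simp: dim_diag_block_mat o_def intro!: arg_cong[where f = sum_list])
qed

lemma diag_block_mat_Cons: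
  assumes "\<forall>U\<in>set (U # Us). unitary_rep U"
  shows "diag_block_mat (map (\<lambda>U. U g) (U # Us)) =
    four_block_mat (U g) (0\<^sub>m (rep_dim U) (sum_list (map rep_dim Us)))
      (0\<^sub>m (sum_list (map rep_dim Us)) (rep_dim U)) (diag_block_mat (map (\<lambda>U. U g) Us))"
  using assms unitary_rep_carrier[of U g] diag_block_mat_carrier[of Us g] by (auto simp: Let_def)

lemma block_inclusion_Cons_first:
  assumes "\<forall>U\<in>set (U # Us). unitary_rep U"
  shows "block_inclusion (U # Us) U (vcat (1\<^sub>m (rep_dim U)) (0\<^sub>m (sum_list (map rep_dim Us)) (rep_dim U)))"
proof -
  define n where "n = rep_dim U"
  define k where "k = sum_list (map rep_dim Us)"
  have Uc: "U g \<in> carrier_mat n n" for g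
    using assms unitary_rep_carrier[of U] by (simp add: n_def)
  have Dc: "diag_block_mat (map (\<lambda>U. U g) Us) \<in> carrier_mat k k" for g
    using assms diag_block_mat_carrier[of Us] by (simp add: k_def)
  have c: "1\<^sub>m n \<in> carrier_mat n n" "0\<^sub>m k n \<in> carrier_mat k n"
    by auto
  have "diag_block_mat (map (\<lambda>U. U g) (U # Us)) * vcat (1\<^sub>m n) (0\<^sub>m k n) = vcat (1\<^sub>m n) (0\<^sub>m k n) * U g" for g
    unfolding diag_block_mat_Cons[OF assms] n_def[symmetric] k_def[symmetric]
      diag_mult_vcat[OF Uc Dc c] vcat_mult[OF c Uc]
    using Uc[of g] Dc[of g] by simp
  moreover have "mat_adjoint (vcat (1\<^sub>m n) (0\<^sub>m k n)) * vcat (1\<^sub>m n) (0\<^sub>m k n) = 1\<^sub>m n"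
    unfolding adjoint_vcat_mult_vcat[OF c c] by (simp add: right_mult_zero_mat[of _ n k])
  ultimately show ?thesis
    using vcat_carrier[OF c] by (simp add: block_inclusion_def n_def k_def)
qed

lemma block_inclusion_Cons_rest:
  assumes "\<forall>U\<in>set (V # Us). unitary_rep U" "U \<in> set Us" "block_inclusion Us U J"
  shows "block_inclusion (V # Us) U (vcat (0\<^sub>m (rep_dim V) (rep_dim U)) J)"
proof -
  define n where "n = rep_dim V"
  define k where "k = sum_list (map rep_dim Us)"
  define m where "m = rep_dim U"
  have Vc: "V g \<in> carrier_mat n n" and Uc: "U g \<in> carrier_mat m m" for g
    using assms unitary_rep_carrier[of U] unitary_rep_carrier[of V] by (auto simp: n_def m_def)
  have Dc: "diag_block_mat (map (\<lambda>U. U g) Us) \<in> carrier_mat k k" for g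
    using assms diag_block_mat_carrier[of Us] by (simp add: k_def)
  have c: "0\<^sub>m n m \<in> carrier_mat n m" "J \<in> carrier_mat k m"
    and J: "mat_adjoint J * J = 1\<^sub>m m" "\<And>g. diag_block_mat (map (\<lambda>U. U g) Us) * J = J * U g"
    using assms by (auto simp: block_inclusion_def k_def m_def)
  have "diag_block_mat (map (\<lambda>U. U g) (V # Us)) * vcat (0\<^sub>m n m) J = vcat (0\<^sub>m n m) J * U g" for g
    unfolding diag_block_mat_Cons[OF assms(1)] n_def[symmetric] k_def[symmetric]
      diag_mult_vcat[OF Vc Dc c] vcat_mult[OF c Uc]
    using Vc[of g] Uc[of g] J by simp
  moreover have "mat_adjoint (vcat (0\<^sub>m n m) J) * vcat (0\<^sub>m n m) J = 1\<^sub>m m"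
    unfolding adjoint_vcat_mult_vcat[OF c c] using J c by (simp add: right_mult_zero_mat[of _ m n])
  ultimately show ?thesis
    using vcat_carrier[OF c] by (simp add: block_inclusion_def n_def k_def m_def)
qed

lemma block_inclusion_exists:
  assumes "\<forall>U\<in>set Us. unitary_rep U" "U \<in> set Us"
  shows "\<exists>J. block_inclusion Us U J"
  using assms
proof (induction Us)
  case (Cons V Us)
  show ?case
  proof (cases "U \<in> set Us")
    case True
    then show ?thesis
      using Cons block_inclusion_Cons_rest[of V Us U] by auto
  next
    case False
    then show ?thesis
      using Cons block_inclusion_Cons_first[of V Us] by auto
  qed
qed simp

text \<open>The ranges of the standard block inclusions span the whole space, so their adjoints
  cannot all annihilate X. Detection of a given X, not mere occurrence, is what the later choices of
  a component require.\<close>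

lemma block_inclusion_detects:
  assumes "\<forall>U\<in>set Us. unitary_rep U" "X \<in> carrier_mat (sum_list (map rep_dim Us)) m"
    and "X \<noteq> 0\<^sub>m (sum_list (map rep_dim Us)) m"
  shows "\<exists>U\<in>set Us. \<exists>J. block_inclusion Us U J \<and> mat_adjoint J * X \<noteq> 0\<^sub>m (rep_dim U) m"
  using assms
proof (induction Us arbitrary: X)
  case Nil
  have "X = 0\<^sub>m 0 m"
    using Nil(2) by (intro eq_matI) auto
  then show ?case
    using Nil(3) by simp
next
  case (Cons V Us)
  define n where "n = rep_dim V"
  define k where "k = sum_list (map rep_dim Us)"
  define X1 where "X1 = Matrix.mat n m (\<lambda>(i, j). X $$ (i, j))"
  define X2 where "X2 = Matrix.mat k m (\<lambda>(i, j). X $$ (n + i, j))"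
  have c: "X1 \<in> carrier_mat n m" "X2 \<in> carrier_mat k m"
    by (auto simp: X1_def X2_def)
  have X: "X \<in> carrier_mat (n + k) m"
    using Cons.prems by (simp add: n_def k_def)
  have eq: "X = vcat X1 X2"
    by (rule eq_matI) (use X in \<open>auto simp: X1_def X2_def\<close>)
  show ?case
  proof (cases "X1 = 0\<^sub>m n m")
    case False
    have J: "1\<^sub>m n \<in> carrier_mat n n" "0\<^sub>m k n \<in> carrier_mat k n"
      by auto
    have "mat_adjoint (0\<^sub>m k n) * X2 = 0\<^sub>m n m"
    proof -
      have "mat_adjoint (0\<^sub>m k n) = (0\<^sub>m n k :: complex mat)"
        by (rule eq_matI) auto
      then show ?thesis
        using c by simp
    qed
    then have "mat_adjoint (vcat (1\<^sub>m n) (0\<^sub>m k n)) * X = X1"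
      unfolding eq adjoint_vcat_mult_vcat[OF J c] using c by simp
    then show ?thesis
      using False block_inclusion_Cons_first[OF Cons.prems(1)] unfolding n_def k_def by auto
  next
    case True
    have "X2 \<noteq> 0\<^sub>m k m"
    proof
      assume "X2 = 0\<^sub>m k m"
      then have "X = 0\<^sub>m (n + k) m"
        unfolding eq True by (intro eq_matI) auto
      then show False
        using Cons.prems(3) by (simp add: n_def k_def)
    qed
    then obtain U J where J: "U \<in> set Us" "block_inclusion Us U J" "mat_adjoint J * X2 \<noteq> 0\<^sub>m (rep_dim U) m"
      using Cons.IH[of X2] Cons.prems(1) c by (auto simp: k_def)
    have Jc: "0\<^sub>m n (rep_dim U) \<in> carrier_mat n (rep_dim U)" "J \<in> carrier_mat k (rep_dim U)"
      using J by (auto simp: block_inclusion_def k_def)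
    have "mat_adjoint (vcat (0\<^sub>m n (rep_dim U)) J) * X = mat_adjoint J * X2"
      unfolding eq adjoint_vcat_mult_vcat[OF Jc c] using True mult_carrier_mat[OF mat_adjoint_carrier[OF Jc(2)] c(2)]
      by (simp add: right_mult_zero_mat[of _ _ n])
    then show ?thesis
      using J block_inclusion_Cons_rest[OF Cons.prems(1) J(1,2)] unfolding n_def by auto
  qed
qed

text \<open>T carries the block decomposition back to V, so composing it with a block inclusion
  realizes that block inside V.\<close>

lemma equivalent_diag_intertwiner:
  fixes V :: "'g::{topological_group_add, t2_space} rep"
  assumes V: "unitary_rep V" and Us: "\<forall>U\<in>set Us. unitary_rep U"
    and eqv: "unitarily_equivalent V (\<lambda>g. diag_block_mat (map (\<lambda>U. U g) Us))"
  obtains T where "unitary_mat (rep_dim V) T" "sum_list (map rep_dim Us) = rep_dim V"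
    "\<forall>U J. block_inclusion Us U J \<longrightarrow> U \<in> set Us \<longrightarrow> isometric_intertwiner U V (T * J)"
proof -
  obtain n T where T: "unitary_mat n T"
    and *: "\<And>g. V g \<in> carrier_mat n n" "\<And>g. diag_block_mat (map (\<lambda>U. U g) Us) \<in> carrier_mat n n"
      "\<And>g. T * V g = diag_block_mat (map (\<lambda>U. U g) Us) * T"
    using eqv by (auto simp: unitarily_equivalent_def)
  have n: "rep_dim V = n"
    using *(1)[of 0] by (simp add: rep_dim_def)
  have k: "sum_list (map rep_dim Us) = n"
    using *(2)[of 0] diag_block_mat_carrier[OF Us, of 0] by auto
  have Tc: "T \<in> carrier_mat n n" "mat_adjoint T \<in> carrier_mat n n"
    using T by (auto simp: unitary_mat_def)
  have VT: "V g * mat_adjoint T = mat_adjoint T * diag_block_mat (map (\<lambda>U. U g) Us)" for g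
  proof -
    have "V g * mat_adjoint T = mat_adjoint T * (T * (V g * mat_adjoint T))"
      using T Tc *(1)[of g] by (subst left_inverse_mat_cancel[of _ n n]) (auto simp: unitary_mat_def)
    also have "T * (V g * mat_adjoint T) = T * V g * mat_adjoint T"
      by (rule assoc_mult_mat[OF Tc(1) *(1) Tc(2), symmetric])
    also have "\<dots> = diag_block_mat (map (\<lambda>U. U g) Us)"
      unfolding *(3) by (rule right_inverse_mat_cancel[OF Tc *(2) unitary_mat_inverse[OF T]])
    finally show ?thesis .
  qed
  have "isometric_intertwiner U V (mat_adjoint T * J)" if J: "block_inclusion Us U J" and U: "U \<in> set Us" for U J
  proof -
    define m where "m = rep_dim U"
    have Jc: "J \<in> carrier_mat n m" "mat_adjoint J * J = 1\<^sub>m m"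
      and DJ: "\<And>g. diag_block_mat (map (\<lambda>U. U g) Us) * J = J * U g"
      using J k by (auto simp: block_inclusion_def m_def)
    have Uc: "U g \<in> carrier_mat m m" for g
      using U Us unitary_rep_carrier[of U] by (auto simp: m_def)
    have "mat_adjoint T * J * U g = V g * (mat_adjoint T * J)" for g
    proof -
      have "V g * (mat_adjoint T * J) = V g * mat_adjoint T * J"
        by (rule assoc_mult_mat[OF *(1) Tc(2) Jc(1), symmetric])
      also have "\<dots> = mat_adjoint T * (J * U g)"
        unfolding VT DJ[symmetric] by (rule assoc_mult_mat[OF Tc(2) *(2) Jc(1)])
      also have "\<dots> = mat_adjoint T * J * U g"
        by (rule assoc_mult_mat[OF Tc(2) Jc(1) Uc, symmetric])
      finally show ?thesis
        by simp
    qed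
    moreover have "mat_adjoint (mat_adjoint T * J) * (mat_adjoint T * J) = 1\<^sub>m m"
      using unitary_mat_adjoint[OF T] by (intro isometric_mult[OF Jc]) (auto simp: unitary_mat_def)
    ultimately show ?thesis
      using Tc Jc by (auto simp: isometric_intertwiner_def intertwiner_def n m_def)
  qed
  then show thesis
    using that[of "mat_adjoint T"] unitary_mat_adjoint[OF T] k n by simp
qed

lemma equivalent_diag_component:
  fixes V :: "'g::{topological_group_add, t2_space} rep"
  assumes V: "unitary_rep V" and Us: "\<forall>U\<in>set Us. unitary_rep U"
    and eqv: "unitarily_equivalent V (\<lambda>g. diag_block_mat (map (\<lambda>U. U g) Us))"
    and X: "X \<in> carrier_mat (rep_dim V) m" "X \<noteq> 0\<^sub>m (rep_dim V) m"
  obtains U S where "U \<in> set Us" "isometric_intertwiner U V S" "mat_adjoint S * X \<noteq> 0\<^sub>m (rep_dim U) m"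
proof -
  define n where "n = rep_dim V"
  obtain T where T: "unitary_mat n T" and n: "sum_list (map rep_dim Us) = n"
    and iso: "\<forall>U J. block_inclusion Us U J \<longrightarrow> U \<in> set Us \<longrightarrow> isometric_intertwiner U V (T * J)"
    unfolding n_def by (rule equivalent_diag_intertwiner[OF V Us eqv])
  have Tc: "T \<in> carrier_mat n n" "mat_adjoint T \<in> carrier_mat n n"
    using T by (auto simp: unitary_mat_def)
  have Xc: "X \<in> carrier_mat n m"
    using X by (simp add: n_def)
  have "mat_adjoint T * X \<noteq> 0\<^sub>m n m"
  proof
    assume "mat_adjoint T * X = 0\<^sub>m n m"
    then have "X = T * 0\<^sub>m n m"
      using left_inverse_mat_cancel[OF Tc Xc unitary_mat_inverse[OF T]] by simp
    then show False
      using X Tc by (simp add: n_def)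
  qed
  then obtain U J where J: "U \<in> set Us" "block_inclusion Us U J"
    "mat_adjoint J * (mat_adjoint T * X) \<noteq> 0\<^sub>m (rep_dim U) m"
    using block_inclusion_detects[OF Us, of "mat_adjoint T * X" m] mult_carrier_mat[OF Tc(2) Xc]
    unfolding n by blast
  have Jc: "J \<in> carrier_mat n (rep_dim U)"
    using J n by (auto simp: block_inclusion_def)
  have "mat_adjoint (T * J) * X = mat_adjoint J * (mat_adjoint T * X)"
    using Jc Tc Xc assoc_mult_mat[of "mat_adjoint J" "rep_dim U" n "mat_adjoint T" n X m]
    by (simp add: mat_adjoint_mult)
  then show thesis
    using that[OF J(1), of "T * J"] J iso by auto
qed

text \<open>X prescribes where the component must not vanish: a slice of an intertwiner when a
  tensor factor is to be split, the identity matrix where any component will do.\<close>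

lemma irreducible_component:
  fixes V :: "'g::{topological_group_add, t2_space} rep"
  assumes V: "unitary_rep V" and X: "X \<in> carrier_mat (rep_dim V) m" "X \<noteq> 0\<^sub>m (rep_dim V) m"
  obtains U S where "irreducible_rep U" "isometric_intertwiner U V S"
    "mat_adjoint S * X \<noteq> 0\<^sub>m (rep_dim U) m"
proof -
  obtain Us where Us: "\<forall>U\<in>set Us. irreducible_rep U"
    "unitarily_equivalent V (\<lambda>g. diag_block_mat (map (\<lambda>U. U g) Us))"
    by (rule complete_reducibility[OF V])
  have "\<forall>U\<in>set Us. unitary_rep U"
    using Us(1) irreducible_rep_unitary by blast
  from equivalent_diag_component[OF V this Us(2) X] show thesis
    using that Us(1) by metis
qed

section \<open>Fusion of classes\<close>

lemma dual_memD:
  assumes "D \<in> dual" "U \<in> D"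
  shows "irreducible_rep U" "D = rep_rel `` {U}"
proof -
  obtain V where V: "irreducible_rep V" "D = rep_rel `` {V}"
    using assms by (auto simp: dual_def elim: quotientE)
  then have VU: "(V, U) \<in> rep_rel"
    using assms by auto
  then show "irreducible_rep U"
    by (simp add: rep_rel_iff)
  show "D = rep_rel `` {U}"
    using equiv_class_eq[OF equiv_rep_rel VU] V by simp
qed

lemma dual_memE:
  assumes "D \<in> dual"
  obtains U where "U \<in> D" "irreducible_rep U"
proof -
  obtain V where V: "irreducible_rep V" "D = rep_rel `` {V}"
    using assms by (auto simp: dual_def elim: quotientE)
  then have "V \<in> D"
    using embeds_refl irreducible_rep_unitary by (auto simp: rep_rel_iff)
  then show thesis
    using that V by blast
qed

lemma rep_rel_class:
  assumes "irreducible_rep U"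
  shows "rep_rel `` {U} \<in> dual" "U \<in> rep_rel `` {U}"
  using assms embeds_refl irreducible_rep_unitary by (auto simp: dual_def rep_rel_iff intro: quotientI)

text \<open>A block of a decomposition is embedded by its \<open>block_inclusion\<close>.
  Conversely, given T from U into V, some block of a decomposition of V detects T, and the resulting
  nonzero intertwiner between irreducibles puts that block into D. In particular occurrence does not
  depend on the decomposition.\<close>

lemma appears_in_iff_embeds:
  assumes D: "D \<in> dual" "U \<in> D" and V: "unitary_rep V"
  shows "appears_in D V \<longleftrightarrow> embeds U V"
proof
  note U = dual_memD[OF D]
  assume "appears_in D V"
  then obtain Us U' where Us: "\<forall>U\<in>set Us. irreducible_rep U"
    "unitarily_equivalent V (\<lambda>g. diag_block_mat (map (\<lambda>U. U g) Us))" and U': "U' \<in> set Us" "U' \<in> D"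
    by (auto simp: appears_in_def)
  have u: "\<forall>U\<in>set Us. unitary_rep U"
    using Us(1) irreducible_rep_unitary by blast
  obtain J where "block_inclusion Us U' J"
    using block_inclusion_exists[OF u U'(1)] by blast
  then have "embeds U' V"
    using equivalent_diag_intertwiner[OF V u Us(2)] U'(1) unfolding embeds_def by metis
  moreover have "embeds U U'"
    using U' U by (auto simp: rep_rel_iff)
  ultimately show "embeds U V"
    using embeds_trans[of U U' V] V U(1) u U' irreducible_rep_unitary by blast
next
  note U = dual_memD[OF D]
  assume "embeds U V"
  then obtain T where T: "isometric_intertwiner U V T"
    by (auto simp: embeds_def)
  then have Ti: "intertwiner U V T" and Tc: "T \<in> carrier_mat (rep_dim V) (rep_dim U)"
    by (auto simp: isometric_intertwiner_def intertwiner_def)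
  have T0: "T \<noteq> 0\<^sub>m (rep_dim V) (rep_dim U)"
    using isometric_intertwiner_nonzero[OF T] U by (simp add: irreducible_rep_def)
  obtain Us where Us: "\<forall>U\<in>set Us. irreducible_rep U"
    "unitarily_equivalent V (\<lambda>g. diag_block_mat (map (\<lambda>U. U g) Us))"
    by (rule complete_reducibility[OF V])
  have u: "\<forall>U\<in>set Us. unitary_rep U"
    using Us(1) irreducible_rep_unitary by blast
  obtain U' S where U': "U' \<in> set Us" and S: "isometric_intertwiner U' V S"
    and ST: "mat_adjoint S * T \<noteq> 0\<^sub>m (rep_dim U') (rep_dim U)"
    by (rule equivalent_diag_component[OF V u Us(2) Tc T0])
  have "intertwiner U U' (mat_adjoint S * T)"
    using intertwiner_mult[OF irreducible_rep_unitary[OF U(1)] V _ Ti] intertwiner_adjoint[OF _ V] u U' S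
    by (auto simp: isometric_intertwiner_def)
  then have "embeds U U'"
    using irreducible_embedsI[OF U(1) _ _ ST] u U' by blast
  then have "U' \<in> D"
    using U Us(1) U' by (auto simp: rep_rel_iff)
  then show "appears_in D V"
    using Us U' by (auto simp: appears_in_def)
qed

text \<open>Frees products of classes from the choice of representatives: equivalent factors embed
  into each other, hence so do their tensor products.\<close>

lemma class_prod_iff_embeds:
  assumes D: "D \<in> dual" "D\<^sub>1 \<in> dual" "D\<^sub>2 \<in> dual" and U: "U \<in> D" "U\<^sub>1 \<in> D\<^sub>1" "U\<^sub>2 \<in> D\<^sub>2"
  shows "D \<in> class_prod D\<^sub>1 D\<^sub>2 \<longleftrightarrow> embeds U (tensor_rep U\<^sub>1 U\<^sub>2)"
proof
  note u = dual_memD(1)[OF _ U(1), THEN irreducible_rep_unitary] dual_memD(1)[OF _ U(2), THEN irreducible_rep_unitary]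
    dual_memD(1)[OF _ U(3), THEN irreducible_rep_unitary]
  assume "D \<in> class_prod D\<^sub>1 D\<^sub>2"
  then obtain V1 V2 where V: "V1 \<in> D\<^sub>1" "V2 \<in> D\<^sub>2" "appears_in D (tensor_rep V1 V2)"
    by (auto simp: class_prod_def)
  note v = dual_memD(1)[OF D(2) V(1), THEN irreducible_rep_unitary] dual_memD(1)[OF D(3) V(2), THEN irreducible_rep_unitary]
  have "embeds U (tensor_rep V1 V2)"
    using appears_in_iff_embeds[OF D(1) U(1) unitary_rep_tensor[OF v]] V by simp
  moreover have "embeds V1 U\<^sub>1" "embeds V2 U\<^sub>2"
    using dual_memD(2)[OF D(2) V(1)] dual_memD(2)[OF D(3) V(2)] U by (auto simp: rep_rel_iff)
  ultimately show "embeds U (tensor_rep U\<^sub>1 U\<^sub>2)"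
    using embeds_trans[OF u(1)[OF D(1)] unitary_rep_tensor[OF v] unitary_rep_tensor[OF u(2)[OF D(2)] u(3)[OF D(3)]]]
      embeds_tensor[OF v u(2)[OF D(2)] u(3)[OF D(3)]] by blast
next
  assume "embeds U (tensor_rep U\<^sub>1 U\<^sub>2)"
  then show "D \<in> class_prod D\<^sub>1 D\<^sub>2"
    using appears_in_iff_embeds[OF D(1) U(1), of "tensor_rep U\<^sub>1 U\<^sub>2"] D U
      unitary_rep_tensor[of U\<^sub>1 U\<^sub>2] dual_memD(1) irreducible_rep_unitary
    by (fastforce simp: class_prod_def)
qed

section \<open>The trivial class\<close>

lemma rep_dim_one [simp]: "rep_dim (\<lambda>g. 1\<^sub>m n) = n"
  by (simp add: rep_dim_def)

lemma irreducible_rep_trivial: "irreducible_rep (\<lambda>g :: 'g::{topological_group_add, t2_space}. 1\<^sub>m 1)"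
proof -
  have "W = {0\<^sub>v 1} \<or> W = carrier_vec 1" if W: "cvec_subspace 1 W" for W
  proof (cases "W = {0\<^sub>v 1}")
    case False
    have Wp: "W \<subseteq> carrier_vec 1" "0\<^sub>v 1 \<in> W" "\<And>c v. v \<in> W \<Longrightarrow> c \<cdot>\<^sub>v v \<in> W"
      using W by (auto simp: cvec_subspace_iff)
    then obtain v where v: "v \<in> W" "v \<noteq> 0\<^sub>v 1"
      using False by blast
    have vc: "v \<in> carrier_vec 1"
      using v Wp by blast
    have v0: "vec_index v 0 \<noteq> 0"
    proof
      assume "vec_index v 0 = 0"
      then have "v = 0\<^sub>v 1"
        using vc by (intro eq_vecI) auto
      then show False
        using v by simp
    qed
    have "w \<in> W" if w: "w \<in> carrier_vec 1" for w
    proof -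
      have "w = (vec_index w 0 / vec_index v 0) \<cdot>\<^sub>v v"
        using w vc v0 by (intro eq_vecI) auto
      then show ?thesis
        using Wp(3)[OF v(1)] by metis
    qed
    then show ?thesis
      using Wp by blast
  qed simp
  then show ?thesis
    by (auto simp: irreducible_rep_def unitary_rep_def unitary_mat_def rep_dim_def)
qed

lemma trivial_class_mem: "(\<lambda>g. 1\<^sub>m 1) \<in> trivial_class" "trivial_class \<in> dual"
  using rep_rel_class[OF irreducible_rep_trivial] by (auto simp: trivial_class_def)

lemma tensor_rep_trivial_left: "tensor_rep (\<lambda>g. 1\<^sub>m 1) U = U"
  unfolding tensor_rep_def by (rule ext, rule eq_matI) (auto simp: index_tensor_mat)

lemma tensor_rep_trivial_right: "tensor_rep U (\<lambda>g. 1\<^sub>m 1) = U"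
  unfolding tensor_rep_def by (rule ext, rule eq_matI) (auto simp: index_tensor_mat)

section \<open>Splitting embeddings into tensor products\<close>

lemma intertwiner_one: "unitary_rep U \<Longrightarrow> intertwiner U U (1\<^sub>m (rep_dim U))"
  by (auto simp: intertwiner_def left_mult_one_mat[OF unitary_rep_carrier] right_mult_one_mat[OF unitary_rep_carrier])

lemma mult_add_less: "a < e \<Longrightarrow> j < w \<Longrightarrow> a * w + j < e * (w :: nat)"
proof -
  assume "a < e" "j < w"
  then have "a * w + j < Suc a * w" "Suc a * w \<le> e * w"
    by (simp, intro mult_le_mono1) simp
  then show ?thesis
    by linarith
qed

text \<open>Row \<open>a * w + j\<close> belongs to the basis tensor with components a and j; the
  identity in the second factor leaves only the summands whose second component is j.\<close>

lemma index_tensor_one_right_mult: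
  assumes A: "A \<in> carrier_mat e v" and T: "T \<in> carrier_mat (v * w) m"
    and "a < e" "j < w" "k < m"
  shows "(tensor_mat A (1\<^sub>m w) * T) $$ (a * w + j, k) = (\<Sum>i<v. A $$ (a, i) * T $$ (i * w + j, k))"
proof -
  have lt: "a * w + j < e * w"
    using assms by (intro mult_add_less)
  have "(tensor_mat A (1\<^sub>m w) * T) $$ (a * w + j, k) =
      (\<Sum>p<v * w. tensor_mat A (1\<^sub>m w) $$ (a * w + j, p) * T $$ (p, k))"
    using assms lt by (subst index_mult_mat_sum) auto
  also have "\<dots> = (\<Sum>p<v * w. A $$ (a, p div w) * (if p mod w = j then 1 else 0) * T $$ (p, k))"
    using assms lt by (intro sum.cong refl) (auto simp: index_tensor_mat less_mult_mod_less)
  also have "\<dots> = (\<Sum>i<v. \<Sum>l<w. A $$ (a, i) * (if l = j then 1 else 0) * T $$ (i * w + l, k))"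
    by (subst sum_mult_product) (auto intro!: sum.cong simp: add.commute)
  also have "\<dots> = (\<Sum>i<v. A $$ (a, i) * T $$ (i * w + j, k))"
    using assms by (intro sum.cong refl) (simp add: if_distrib if_distribR cong: if_cong)
  finally show ?thesis .
qed

lemma index_tensor_one_left_mult:
  assumes A: "A \<in> carrier_mat e w" and T: "T \<in> carrier_mat (v * w) m"
    and "i < v" "a < e" "k < m"
  shows "(tensor_mat (1\<^sub>m v) A * T) $$ (i * e + a, k) = (\<Sum>j<w. A $$ (a, j) * T $$ (i * w + j, k))"
proof -
  have lt: "i * e + a < v * e"
    using assms by (intro mult_add_less)
  have "(tensor_mat (1\<^sub>m v) A * T) $$ (i * e + a, k) =
      (\<Sum>p<v * w. tensor_mat (1\<^sub>m v) A $$ (i * e + a, p) * T $$ (p, k))"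
    using assms lt by (subst index_mult_mat_sum) auto
  also have "\<dots> = (\<Sum>p<v * w. (if p div w = i then 1 else 0) * A $$ (a, p mod w) * T $$ (p, k))"
    using assms lt by (intro sum.cong refl) (auto simp: index_tensor_mat less_mult_imp_div_less)
  also have "\<dots> = (\<Sum>l<v. \<Sum>j<w. (if l = i then 1 else 0) * A $$ (a, j) * T $$ (l * w + j, k))"
    by (subst sum_mult_product) (auto intro!: sum.cong simp: add.commute)
  also have "\<dots> = (\<Sum>l<v. if l = i then (\<Sum>j<w. A $$ (a, j) * T $$ (i * w + j, k)) else 0)"
    by (intro sum.cong refl) auto
  also have "\<dots> = (\<Sum>j<w. A $$ (a, j) * T $$ (i * w + j, k))"
    using assms by simp
  finally show ?thesis .
qed

lemma embeds_nonzero_entry: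
  assumes "irreducible_rep U" "embeds U V"
  obtains T p k where "intertwiner U V T" "T \<in> carrier_mat (rep_dim V) (rep_dim U)"
    "p < rep_dim V" "k < rep_dim U" "T $$ (p, k) \<noteq> 0"
proof -
  obtain T where T: "isometric_intertwiner U V T"
    using assms by (auto simp: embeds_def)
  then have Ti: "intertwiner U V T"
    by (simp add: isometric_intertwiner_def)
  have "T \<noteq> 0\<^sub>m (rep_dim V) (rep_dim U)"
    using isometric_intertwiner_nonzero[OF T] assms by (simp add: irreducible_rep_def)
  from mat_nonzero_entry[OF intertwiner_carrier[OF Ti] this] show thesis
    using that[OF Ti intertwiner_carrier[OF Ti]] by blast
qed

text \<open>Around a nonzero entry of T in row (i, j) and column k, the slice of T with j and k
  fixed is a nonzero vector of V. A component E of V that detects this slice gives a nonzero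
  intertwiner Y from U into E tensor W, because the entries of the compressed slice are entries of
  Y.\<close>

lemma embeds_tensor_split_left:
  fixes U V W :: "'g::{topological_group_add, t2_space} rep"
  assumes U: "irreducible_rep U" and V: "unitary_rep V" and W: "unitary_rep W"
    and "embeds U (tensor_rep V W)"
  obtains E where "irreducible_rep E" "embeds E V" "embeds U (tensor_rep E W)"
proof -
  note Uu = irreducible_rep_unitary[OF U]
  define v where "v = rep_dim V"
  define w where "w = rep_dim W"
  define m where "m = rep_dim U"
  obtain T p k where Ti: "intertwiner U (tensor_rep V W) T" and Tc: "T \<in> carrier_mat (v * w) m"
    and pk: "p < v * w" "k < m" "T $$ (p, k) \<noteq> 0"
    using embeds_nonzero_entry[OF U \<open>embeds U (tensor_rep V W)\<close>] unfolding v_def w_def m_def rep_dim_tensor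
    by blast
  define j where "j = p mod w"
  have j: "j < w" "p div w < v" "p div w * w + j = p"
    using pk less_mult_mod_less less_mult_imp_div_less by (auto simp: j_def)
  define X where "X = Matrix.mat v 1 (\<lambda>(i, l). T $$ (i * w + j, k))"
  have X: "X \<in> carrier_mat (rep_dim V) 1"
    by (simp add: X_def v_def)
  have "X $$ (p div w, 0) \<noteq> 0"
    using j pk by (simp add: X_def)
  then have "X \<noteq> 0\<^sub>m (rep_dim V) 1"
    using j by (auto simp: v_def)
  then obtain E S where E: "irreducible_rep E" and S: "isometric_intertwiner E V S"
    and SX: "mat_adjoint S * X \<noteq> 0\<^sub>m (rep_dim E) 1"
    by (rule irreducible_component[OF V X])
  note Eu = irreducible_rep_unitary[OF E]
  have Si: "intertwiner E V S" and Sc: "S \<in> carrier_mat v (rep_dim E)"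
    using S by (auto simp: isometric_intertwiner_def intertwiner_def v_def)
  define Y where "Y = tensor_mat (mat_adjoint S) (1\<^sub>m w) * T"
  have Yi: "intertwiner U (tensor_rep E W) Y"
    unfolding Y_def w_def
    by (rule intertwiner_mult[OF Uu unitary_rep_tensor[OF V W] unitary_rep_tensor[OF Eu W] Ti
          intertwiner_tensor[OF V W Eu W intertwiner_adjoint[OF Eu V Si] intertwiner_one[OF W]]])
  obtain a b where a: "a < rep_dim E" "b < 1" "(mat_adjoint S * X) $$ (a, b) \<noteq> 0"
    by (rule mat_nonzero_entry[OF mult_carrier_mat[OF mat_adjoint_carrier[OF Sc]] SX]) (use X v_def in auto)
  have "(mat_adjoint S * X) $$ (a, 0) = (\<Sum>i<v. mat_adjoint S $$ (a, i) * T $$ (i * w + j, k))"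
    using a X Sc by (subst index_mult_mat_sum) (auto simp: X_def v_def)
  then have "Y $$ (a * w + j, k) \<noteq> 0"
    using a index_tensor_one_right_mult[OF mat_adjoint_carrier[OF Sc] Tc a(1) j(1) pk(2)]
    by (simp add: Y_def)
  then have "Y \<noteq> 0\<^sub>m (rep_dim (tensor_rep E W)) (rep_dim U)"
    using mult_add_less[OF a(1) j(1)] pk(2) by (auto simp: w_def m_def)
  then have "embeds U (tensor_rep E W)"
    using irreducible_embedsI[OF U unitary_rep_tensor[OF Eu W] Yi] by blast
  then show thesis
    using that E S unfolding embeds_def by blast
qed

lemma embeds_tensor_split_right:
  fixes U V W :: "'g::{topological_group_add, t2_space} rep"
  assumes U: "irreducible_rep U" and V: "unitary_rep V" and W: "unitary_rep W"
    and "embeds U (tensor_rep V W)"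
  obtains E where "irreducible_rep E" "embeds E W" "embeds U (tensor_rep V E)"
proof -
  note Uu = irreducible_rep_unitary[OF U]
  define v where "v = rep_dim V"
  define w where "w = rep_dim W"
  define m where "m = rep_dim U"
  obtain T p k where Ti: "intertwiner U (tensor_rep V W) T" and Tc: "T \<in> carrier_mat (v * w) m"
    and pk: "p < v * w" "k < m" "T $$ (p, k) \<noteq> 0"
    using embeds_nonzero_entry[OF U \<open>embeds U (tensor_rep V W)\<close>] unfolding v_def w_def m_def rep_dim_tensor
    by blast
  \<comment> \<open>Here the first tensor component stays fixed and the slice lies in W.\<close>
  define i where "i = p div w"
  have i: "i < v" "p mod w < w" "i * w + p mod w = p"
    using pk less_mult_mod_less less_mult_imp_div_less by (auto simp: i_def)
  define X where "X = Matrix.mat w 1 (\<lambda>(j, l). T $$ (i * w + j, k))"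
  have X: "X \<in> carrier_mat (rep_dim W) 1"
    by (simp add: X_def w_def)
  have "X $$ (p mod w, 0) \<noteq> 0"
    using i pk by (simp add: X_def)
  then have "X \<noteq> 0\<^sub>m (rep_dim W) 1"
    using i by (auto simp: w_def)
  then obtain E S where E: "irreducible_rep E" and S: "isometric_intertwiner E W S"
    and SX: "mat_adjoint S * X \<noteq> 0\<^sub>m (rep_dim E) 1"
    by (rule irreducible_component[OF W X])
  note Eu = irreducible_rep_unitary[OF E]
  have Si: "intertwiner E W S" and Sc: "S \<in> carrier_mat w (rep_dim E)"
    using S by (auto simp: isometric_intertwiner_def intertwiner_def w_def)
  define Y where "Y = tensor_mat (1\<^sub>m v) (mat_adjoint S) * T"
  have Yi: "intertwiner U (tensor_rep V E) Y"
    unfolding Y_def v_def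
    by (rule intertwiner_mult[OF Uu unitary_rep_tensor[OF V W] unitary_rep_tensor[OF V Eu] Ti
          intertwiner_tensor[OF V W V Eu intertwiner_one[OF V] intertwiner_adjoint[OF Eu W Si]]])
  obtain a b where a: "a < rep_dim E" "b < 1" "(mat_adjoint S * X) $$ (a, b) \<noteq> 0"
    by (rule mat_nonzero_entry[OF mult_carrier_mat[OF mat_adjoint_carrier[OF Sc]] SX]) (use X w_def in auto)
  have "(mat_adjoint S * X) $$ (a, 0) = (\<Sum>j<w. mat_adjoint S $$ (a, j) * T $$ (i * w + j, k))"
    using a X Sc by (subst index_mult_mat_sum) (auto simp: X_def w_def)
  then have "Y $$ (i * rep_dim E + a, k) \<noteq> 0"
    using a index_tensor_one_left_mult[OF mat_adjoint_carrier[OF Sc] Tc i(1) a(1) pk(2)]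
    by (simp add: Y_def)
  then have "Y \<noteq> 0\<^sub>m (rep_dim (tensor_rep V E)) (rep_dim U)"
    using mult_add_less[OF i(1) a(1)] pk(2) by (auto simp: v_def m_def)
  then have "embeds U (tensor_rep V E)"
    using irreducible_embedsI[OF U unitary_rep_tensor[OF V Eu] Yi] by blast
  then show thesis
    using that E S unfolding embeds_def by blast
qed

section \<open>Conjugate classes\<close>

definition conj_rep :: "'g rep \<Rightarrow> 'g rep" where
  "conj_rep U g = map_mat cnj (U g)"

lemma rep_dim_conj_rep [simp]: "rep_dim (conj_rep U) = rep_dim U"
  by (simp add: rep_dim_def conj_rep_def)

lemma index_conj_rep:
  assumes "unitary_rep U" "i < rep_dim U" "j < rep_dim U"
  shows "conj_rep U g $$ (i, j) = cnj (U g $$ (i, j))"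
  using assms unitary_rep_carrier[of U g] by (simp add: conj_rep_def)

lemma unitary_rep_conj_rep:
  assumes "unitary_rep U"
  shows "unitary_rep (conj_rep U)"
proof -
  define n where "n = rep_dim U"
  have c: "U g \<in> carrier_mat n n" for g
    using unitary_rep_carrier[OF assms] by (simp add: n_def)
  have mult: "map_mat cnj (A * B) = map_mat cnj A * map_mat cnj B"
    if "A \<in> carrier_mat n n" "B \<in> carrier_mat n n" for A B :: "complex mat"
    by (rule eq_matI) (use that in \<open>auto simp: scalar_prod_def\<close>)
  have adj: "mat_adjoint (map_mat cnj A) = map_mat cnj (mat_adjoint A)" for A :: "complex mat"
    by (rule eq_matI) auto
  have one: "map_mat cnj (1\<^sub>m n) = 1\<^sub>m n"
    by (rule eq_matI) auto
  have "unitary_mat n (map_mat cnj (U g))" for g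
    using c unitary_rep_adjoint_mult[OF assms, of g] mult[of "mat_adjoint (U g)" "U g"] one
    by (simp add: unitary_mat_def adj n_def)
  moreover have "map_mat cnj (U (g + h)) = map_mat cnj (U g) * map_mat cnj (U h)" for g h
    using mult[OF c c] by (simp add: unitary_rep_add[OF assms])
  moreover have "continuous_on UNIV (\<lambda>g. conj_rep U g $$ (i, j))" if "i < n" "j < n" for i j
    using assms that by (simp add: index_conj_rep n_def continuous_on_cnj unitary_rep_def)
  ultimately show ?thesis
    by (simp add: unitary_rep_def n_def) (simp add: conj_rep_def)
qed

text \<open>The vector \<open>\<Sum>\<^sub>i e\<^sub>i \<otimes> e\<^sub>i\<close>.\<close>

definition diag_vec :: "nat \<Rightarrow> complex mat" where
  "diag_vec n = Matrix.mat (n * n) 1 (\<lambda>(p, k). if p div n = p mod n then 1 else 0)"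

lemma diag_vec_carrier: "diag_vec n \<in> carrier_mat (n * n) 1"
  by (simp add: diag_vec_def)

lemma index_diag_vec: "i < n \<Longrightarrow> j < n \<Longrightarrow> diag_vec n $$ (i * n + j, 0) = (if i = j then 1 else 0)"
  using mult_add_less[of i n j n] by (simp add: diag_vec_def)

text \<open>In terms of coefficient matrices, A tensor B sends C to
  \<open>A * C * transpose_mat B\<close>, and the diagonal vector has the identity as its
  coefficient matrix.\<close>

lemma tensor_mult_diag_vec:
  assumes A: "A \<in> carrier_mat n n" and B: "B \<in> carrier_mat n n"
    and AB: "A * transpose_mat B = 1\<^sub>m n"
  shows "tensor_mat A B * diag_vec n = diag_vec n"
proof (rule eq_matI)
  fix p k assume "p < dim_row (diag_vec n)" "k < dim_col (diag_vec n)"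
  then have p: "p < n * n" "k = 0"
    by (auto simp: diag_vec_def)
  note q = less_mult_imp_div_less[OF p(1)] less_mult_mod_less[OF p(1)]
  have "(tensor_mat A B * diag_vec n) $$ (p, k) =
      (\<Sum>r<n * n. A $$ (p div n, r div n) * B $$ (p mod n, r mod n) * diag_vec n $$ (r, 0))"
    using A B p diag_vec_carrier[of n]
    by (subst index_mult_mat_sum) (auto simp: index_tensor_mat intro!: sum.cong)
  also have "\<dots> = (\<Sum>i<n. \<Sum>j<n. A $$ (p div n, i) * B $$ (p mod n, j) * diag_vec n $$ (i * n + j, 0))"
    by (subst sum_mult_product) (auto intro!: sum.cong simp: add.commute)
  also have "\<dots> = (\<Sum>i<n. \<Sum>j<n. if i = j then A $$ (p div n, i) * B $$ (p mod n, j) else 0)"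
    by (intro sum.cong refl) (auto simp: index_diag_vec)
  also have "\<dots> = (\<Sum>i<n. A $$ (p div n, i) * B $$ (p mod n, i))"
    by simp
  also have "\<dots> = (A * transpose_mat B) $$ (p div n, p mod n)"
    using A B q by (subst index_mult_mat_sum) auto
  also have "\<dots> = diag_vec n $$ (p, k)"
    unfolding AB using p q by (simp add: diag_vec_def)
  finally show "(tensor_mat A B * diag_vec n) $$ (p, k) = diag_vec n $$ (p, k)" .
qed (use A B in \<open>auto simp: diag_vec_def\<close>)

lemma intertwiner_diag_vec:
  assumes U: "unitary_rep U"
  shows "intertwiner (\<lambda>g. 1\<^sub>m 1) (tensor_rep (conj_rep U) U) (diag_vec (rep_dim U))"
    "intertwiner (\<lambda>g. 1\<^sub>m 1) (tensor_rep U (conj_rep U)) (diag_vec (rep_dim U))"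
proof -
  define n where "n = rep_dim U"
  have c: "U g \<in> carrier_mat n n" "conj_rep U g \<in> carrier_mat n n" for g
    using unitary_rep_carrier[OF U] unitary_rep_carrier[OF unitary_rep_conj_rep[OF U]] by (auto simp: n_def)
  have "transpose_mat (conj_rep U g) = mat_adjoint (U g)" for g
    by (rule eq_matI) (use c[of g] in \<open>auto simp: conj_rep_def\<close>)
  then have 1: "U g * transpose_mat (conj_rep U g) = 1\<^sub>m n" for g
    using unitary_rep_mult_adjoint[OF U] by (simp add: n_def)
  have "transpose_mat (U g) = mat_adjoint (conj_rep U g)" for g
    by (rule eq_matI) (use c[of g] in \<open>auto simp: conj_rep_def\<close>)
  then have 2: "conj_rep U g * transpose_mat (U g) = 1\<^sub>m n" for g
    using unitary_rep_mult_adjoint[OF unitary_rep_conj_rep[OF U]] by (simp add: n_def)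
  have "tensor_rep V W g = tensor_mat (V g) (W g)" for V W :: "'a rep" and g
    by (simp add: tensor_rep_def)
  then show "intertwiner (\<lambda>g. 1\<^sub>m 1) (tensor_rep (conj_rep U) U) (diag_vec (rep_dim U))"
    "intertwiner (\<lambda>g. 1\<^sub>m 1) (tensor_rep U (conj_rep U)) (diag_vec (rep_dim U))"
    unfolding intertwiner_def
    using tensor_mult_diag_vec[OF c(2,1) 2] tensor_mult_diag_vec[OF c(1,2) 1] diag_vec_carrier[of n]
      right_mult_one_mat[OF diag_vec_carrier]
    by (simp_all add: n_def)
qed

text \<open>The tensor products of U with its complex conjugate, in both orders, contain an
  invariant vector. Compressing it to an irreducible component E of the conjugate keeps it nonzero,
  since its entries become those of \<open>mat_adjoint S\<close>; the same E serves both
  orders.\<close>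

lemma conjugate_class:
  assumes U: "irreducible_rep U"
  obtains E where "irreducible_rep E" "embeds (\<lambda>g. 1\<^sub>m 1) (tensor_rep E U)"
    "embeds (\<lambda>g. 1\<^sub>m 1) (tensor_rep U E)"
proof -
  note Uu = irreducible_rep_unitary[OF U]
  note Cu = unitary_rep_conj_rep[OF Uu]
  note Iu = irreducible_rep_unitary[OF irreducible_rep_trivial]
  define n where "n = rep_dim U"
  have n: "n > 0"
    using U by (simp add: n_def irreducible_rep_def)
  \<comment> \<open>Every component detects the identity matrix, so E is an arbitrary irreducible
    component.\<close>
  have X: "1\<^sub>m n \<in> carrier_mat (rep_dim (conj_rep U)) n"
    by (simp add: n_def)
  have X0: "1\<^sub>m n \<noteq> (0\<^sub>m (rep_dim (conj_rep U)) n :: complex mat)"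
    using one_mat_neq_zero[OF n] by (simp add: n_def)
  obtain E S where E: "irreducible_rep E" and S: "isometric_intertwiner E (conj_rep U) S"
    by (rule irreducible_component[OF Cu X X0])
  note Eu = irreducible_rep_unitary[OF E]
  have Si: "intertwiner E (conj_rep U) S" and Sc: "S \<in> carrier_mat n (rep_dim E)"
    using S by (auto simp: isometric_intertwiner_def intertwiner_def n_def)
  note aSi = intertwiner_adjoint[OF Eu Cu Si]
  note aSc = mat_adjoint_carrier[OF Sc]
  have "S \<noteq> 0\<^sub>m n (rep_dim E)"
    using isometric_intertwiner_nonzero[OF S] E by (simp add: irreducible_rep_def n_def)
  then obtain j a where ja: "j < n" "a < rep_dim E" "S $$ (j, a) \<noteq> 0"
    using mat_nonzero_entry[OF Sc] by blast
  then have aS: "mat_adjoint S $$ (a, j) \<noteq> 0"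
    using Sc by simp
  have i1: "intertwiner (\<lambda>g. 1\<^sub>m 1) (tensor_rep E U) (tensor_mat (mat_adjoint S) (1\<^sub>m n) * diag_vec n)"
    unfolding n_def
    by (rule intertwiner_mult[OF Iu unitary_rep_tensor[OF Cu Uu] unitary_rep_tensor[OF Eu Uu]
        intertwiner_diag_vec(1)[OF Uu] intertwiner_tensor[OF Cu Uu Eu Uu aSi intertwiner_one[OF Uu]]])
  have i2: "intertwiner (\<lambda>g. 1\<^sub>m 1) (tensor_rep U E) (tensor_mat (1\<^sub>m n) (mat_adjoint S) * diag_vec n)"
    unfolding n_def
    by (rule intertwiner_mult[OF Iu unitary_rep_tensor[OF Uu Cu] unitary_rep_tensor[OF Uu Eu]
        intertwiner_diag_vec(2)[OF Uu] intertwiner_tensor[OF Uu Cu Uu Eu intertwiner_one[OF Uu] aSi]])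
  have "(tensor_mat (mat_adjoint S) (1\<^sub>m n) * diag_vec n) $$ (a * n + j, 0) = mat_adjoint S $$ (a, j)"
    using ja by (subst index_tensor_one_right_mult[OF aSc diag_vec_carrier])
      (auto simp: index_diag_vec if_distrib cong: if_cong)
  moreover have "a * n + j < rep_dim (tensor_rep E U)" "0 < rep_dim (\<lambda>g :: 'a. 1\<^sub>m 1)"
    using mult_add_less[OF ja(2,1)] by (simp_all add: n_def)
  ultimately have "tensor_mat (mat_adjoint S) (1\<^sub>m n) * diag_vec n \<noteq>
      0\<^sub>m (rep_dim (tensor_rep E U)) (rep_dim (\<lambda>g :: 'a. 1\<^sub>m 1))"
    using aS by (metis index_zero_mat(1))
  then have e1: "embeds (\<lambda>g. 1\<^sub>m 1) (tensor_rep E U)"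
    by (rule irreducible_embedsI[OF irreducible_rep_trivial unitary_rep_tensor[OF Eu Uu] i1])
  have "(tensor_mat (1\<^sub>m n) (mat_adjoint S) * diag_vec n) $$ (j * rep_dim E + a, 0) = mat_adjoint S $$ (a, j)"
    using ja by (subst index_tensor_one_left_mult[OF aSc diag_vec_carrier])
      (auto simp: index_diag_vec if_distrib cong: if_cong)
  moreover have "j * rep_dim E + a < rep_dim (tensor_rep U E)" "0 < rep_dim (\<lambda>g :: 'a. 1\<^sub>m 1)"
    using mult_add_less[OF ja(1,2)] by (simp_all add: n_def)
  ultimately have "tensor_mat (1\<^sub>m n) (mat_adjoint S) * diag_vec n \<noteq>
      0\<^sub>m (rep_dim (tensor_rep U E)) (rep_dim (\<lambda>g :: 'a. 1\<^sub>m 1))"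
    using aS by (metis index_zero_mat(1))
  then have e2: "embeds (\<lambda>g. 1\<^sub>m 1) (tensor_rep U E)"
    by (rule irreducible_embedsI[OF irreducible_rep_trivial unitary_rep_tensor[OF Uu Eu] i2])
  show thesis
    using that[OF E e1 e2] .
qed

section \<open>Products of classes and their associativity\<close>

lemma class_prod_subset_dual: "class_prod D E \<subseteq> dual"
  by (auto simp: class_prod_def)

lemma class_prod_nonempty:
  assumes "D \<in> dual" "E \<in> dual"
  shows "class_prod D E \<noteq> {}"
proof -
  obtain U V where U: "U \<in> D" "irreducible_rep U" and V: "V \<in> E" "irreducible_rep V"
    using assms by (meson dual_memE)
  note u = unitary_rep_tensor[OF U(2)[THEN irreducible_rep_unitary] V(2)[THEN irreducible_rep_unitary]]
  define n where "n = rep_dim U * rep_dim V"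
  have n: "n > 0"
    using U V by (simp add: n_def irreducible_rep_def)
  have X: "1\<^sub>m n \<in> carrier_mat (rep_dim (tensor_rep U V)) n"
    by (simp add: n_def)
  have X0: "1\<^sub>m n \<noteq> (0\<^sub>m (rep_dim (tensor_rep U V)) n :: complex mat)"
    using one_mat_neq_zero[OF n] by (simp add: n_def)
  obtain F S where F: "irreducible_rep F" "isometric_intertwiner F (tensor_rep U V) S"
    by (rule irreducible_component[OF u X X0])
  then have "rep_rel `` {F} \<in> class_prod D E"
    using class_prod_iff_embeds[OF rep_rel_class(1)[OF F(1)] assms rep_rel_class(2)[OF F(1)] U(1) V(1)]
    by (auto simp: embeds_def)
  then show ?thesis
    by blast
qed

lemma class_prod_trivial:
  assumes "D \<in> dual"
  shows "D \<in> class_prod trivial_class D" "D \<in> class_prod D trivial_class"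
proof -
  obtain U where U: "U \<in> D" "irreducible_rep U"
    using assms by (rule dual_memE)
  then have "embeds U U"
    using embeds_refl irreducible_rep_unitary by blast
  then show "D \<in> class_prod trivial_class D" "D \<in> class_prod D trivial_class"
    unfolding class_prod_iff_embeds[OF assms trivial_class_mem(2) assms U(1) trivial_class_mem(1) U(1)]
      class_prod_iff_embeds[OF assms assms trivial_class_mem(2) U(1) U(1) trivial_class_mem(1)]
      tensor_rep_trivial_left tensor_rep_trivial_right by assumption+
qed

lemma class_prod_conjugate:
  assumes "D \<in> dual"
  obtains E where "E \<in> dual" "trivial_class \<in> class_prod E D" "trivial_class \<in> class_prod D E"
proof -
  obtain U where U: "U \<in> D" "irreducible_rep U"
    using assms by (rule dual_memE)
  obtain V where V: "irreducible_rep V" "embeds (\<lambda>g. 1\<^sub>m 1) (tensor_rep V U)"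
    "embeds (\<lambda>g. 1\<^sub>m 1) (tensor_rep U V)"
    by (rule conjugate_class[OF U(2)])
  note E = rep_rel_class[OF V(1)]
  show thesis
    using that[OF E(1)] class_prod_iff_embeds[OF trivial_class_mem(2) E(1) assms trivial_class_mem(1) E(2) U(1)]
      class_prod_iff_embeds[OF trivial_class_mem(2) assms E(1) trivial_class_mem(1) U(1) E(2)] V
    by blast
qed

text \<open>A product of two classes is a set of classes, so associativity is an equation only after
  the product is extended to sets.\<close>

definition class_set_prod ::
    "'g::{topological_group_add, t2_space} rep set set \<Rightarrow> 'g rep set set \<Rightarrow> 'g rep set set" where
  "class_set_prod X Y = (\<Union>D\<in>X. \<Union>E\<in>Y. class_prod D E)"

text \<open>Both bracketings describe the irreducible constituents of one triple tensor product.
  Transitivity of \<open>embeds\<close> eliminates an intermediate class; in the other direction the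
  splitting lemmas produce one.\<close>

lemma class_set_prod_singletons:
  assumes D: "A \<in> dual" "B \<in> dual" "C \<in> dual" and U: "U \<in> A" "V \<in> B" "W \<in> C"
  shows "class_set_prod (class_prod A B) {C} =
      {D \<in> dual. \<exists>F\<in>D. embeds F (tensor_rep (tensor_rep U V) W)}" (is "?L = ?S")
    and "class_set_prod {A} (class_prod B C) =
      {D \<in> dual. \<exists>F\<in>D. embeds F (tensor_rep (tensor_rep U V) W)}" (is "?R = ?S")
proof -
  note u = dual_memD(1)[OF D(1) U(1), THEN irreducible_rep_unitary]
  note v = dual_memD(1)[OF D(2) U(2), THEN irreducible_rep_unitary]
  note w = dual_memD(1)[OF D(3) U(3), THEN irreducible_rep_unitary]
  show "?L = ?S"
  proof (intro equalityI subsetI)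
    fix X assume "X \<in> ?L"
    then obtain E where E: "E \<in> class_prod A B" "X \<in> class_prod E C"
      by (auto simp: class_set_prod_def)
    have XE: "X \<in> dual" "E \<in> dual"
      using E class_prod_subset_dual by blast+
    obtain x e where x: "x \<in> X" "irreducible_rep x" and e: "e \<in> E" "irreducible_rep e"
      using XE by (meson dual_memE)
    note xu = irreducible_rep_unitary[OF x(2)]
    note eu = irreducible_rep_unitary[OF e(2)]
    have "embeds e (tensor_rep U V)" "embeds x (tensor_rep e W)"
      using E class_prod_iff_embeds[OF XE(2) D(1,2) e(1) U(1,2)]
        class_prod_iff_embeds[OF XE D(3) x(1) e(1) U(3)] by auto
    then have "embeds x (tensor_rep (tensor_rep U V) W)"
      using embeds_trans[OF xu unitary_rep_tensor[OF eu w] unitary_rep_tensor[OF unitary_rep_tensor[OF u v] w]]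
        embeds_tensor[OF eu w unitary_rep_tensor[OF u v] w] embeds_refl[OF w] by blast
    then show "X \<in> ?S"
      using x XE by blast
  next
    fix X assume "X \<in> ?S"
    then obtain x where X: "X \<in> dual" "x \<in> X" "embeds x (tensor_rep (tensor_rep U V) W)"
      by blast
    obtain e where e: "irreducible_rep e" "embeds e (tensor_rep U V)" "embeds x (tensor_rep e W)"
      by (rule embeds_tensor_split_left[OF dual_memD(1)[OF X(1,2)] unitary_rep_tensor[OF u v] w X(3)])
    note E = rep_rel_class[OF e(1)]
    show "X \<in> ?L"
      using class_prod_iff_embeds[OF E(1) D(1,2) E(2) U(1,2)] e
        class_prod_iff_embeds[OF X(1) E(1) D(3) X(2) E(2) U(3)]
      by (auto simp: class_set_prod_def)
  qed
  show "?R = ?S"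
  proof (intro equalityI subsetI)
    fix X assume "X \<in> ?R"
    then obtain E where E: "E \<in> class_prod B C" "X \<in> class_prod A E"
      by (auto simp: class_set_prod_def)
    have XE: "X \<in> dual" "E \<in> dual"
      using E class_prod_subset_dual by blast+
    obtain x e where x: "x \<in> X" "irreducible_rep x" and e: "e \<in> E" "irreducible_rep e"
      using XE by (meson dual_memE)
    note xu = irreducible_rep_unitary[OF x(2)]
    note eu = irreducible_rep_unitary[OF e(2)]
    have "embeds e (tensor_rep V W)" "embeds x (tensor_rep U e)"
      using E class_prod_iff_embeds[OF XE(2) D(2,3) e(1) U(2,3)]
        class_prod_iff_embeds[OF XE(1) D(1) XE(2) x(1) U(1) e(1)] by auto
    then have "embeds x (tensor_rep U (tensor_rep V W))"
      using embeds_trans[OF xu unitary_rep_tensor[OF u eu] unitary_rep_tensor[OF u unitary_rep_tensor[OF v w]]]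
        embeds_tensor[OF u eu u unitary_rep_tensor[OF v w]] embeds_refl[OF u] by blast
    then show "X \<in> ?S"
      using x XE unfolding tensor_rep_assoc by blast
  next
    fix X assume "X \<in> ?S"
    then obtain x where X: "X \<in> dual" "x \<in> X" "embeds x (tensor_rep U (tensor_rep V W))"
      unfolding tensor_rep_assoc by blast
    obtain e where e: "irreducible_rep e" "embeds e (tensor_rep V W)" "embeds x (tensor_rep U e)"
      by (rule embeds_tensor_split_right[OF dual_memD(1)[OF X(1,2)] u unitary_rep_tensor[OF v w] X(3)])
    note E = rep_rel_class[OF e(1)]
    show "X \<in> ?R"
      using class_prod_iff_embeds[OF E(1) D(2,3) E(2) U(2,3)] e
        class_prod_iff_embeds[OF X(1) D(1) E(1) X(2) U(1) E(2)]
      by (auto simp: class_set_prod_def)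
  qed
qed

lemma class_set_prod_assoc:
  assumes "X \<subseteq> dual" "Y \<subseteq> dual" "Z \<subseteq> dual"
  shows "class_set_prod (class_set_prod X Y) Z = class_set_prod X (class_set_prod Y Z)"
proof -
  have "class_set_prod (class_prod A B) {C} = class_set_prod {A} (class_prod B C)"
    if "A \<in> X" "B \<in> Y" "C \<in> Z" for A B C
  proof -
    have D: "A \<in> dual" "B \<in> dual" "C \<in> dual"
      using that assms by auto
    obtain U V W where U: "U \<in> A" "V \<in> B" "W \<in> C"
      using D by (meson dual_memE)
    show ?thesis
      unfolding class_set_prod_singletons[OF D U] ..
  qed
  then have "(\<Union>A\<in>X. \<Union>B\<in>Y. \<Union>C\<in>Z. class_set_prod (class_prod A B) {C}) =
      (\<Union>A\<in>X. \<Union>B\<in>Y. \<Union>C\<in>Z. class_set_prod {A} (class_prod B C))"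
    by simp
  moreover have "class_set_prod (class_set_prod X Y) Z = (\<Union>A\<in>X. \<Union>B\<in>Y. \<Union>C\<in>Z. class_set_prod (class_prod A B) {C})"
    by (auto simp: class_set_prod_def)
  moreover have "class_set_prod X (class_set_prod Y Z) = (\<Union>A\<in>X. \<Union>B\<in>Y. \<Union>C\<in>Z. class_set_prod {A} (class_prod B C))"
    by (auto simp: class_set_prod_def)
  ultimately show ?thesis
    by simp
qed

lemma class_set_prod_subset_dual: "class_set_prod X Y \<subseteq> dual"
  using class_prod_subset_dual by (auto simp: class_set_prod_def)

lemma class_prods_Nil: "class_prods D [] = {D}"
  by (simp add: class_prods_def)

lemma class_prods_snoc: "class_prods D (Es @ [F]) = class_set_prod (class_prods D Es) {F}"
  by (simp add: class_prods_def class_set_prod_def)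

lemma class_prods_subset_dual: "D \<in> dual \<Longrightarrow> class_prods D Es \<subseteq> dual"
  by (cases Es rule: rev_cases) (auto simp: class_prods_Nil class_prods_snoc class_set_prod_subset_dual[THEN subsetD])

text \<open>Products are nested to the left, so each further factor of the second list costs one use
  of associativity.\<close>

lemma class_prods_append:
  assumes "D \<in> dual" "F \<in> dual" "set Fs \<subseteq> dual"
  shows "class_prods D (Es @ F # Fs) = class_set_prod (class_prods D Es) (class_prods F Fs)"
  using assms(3)
proof (induction Fs rule: rev_induct)
  case Nil
  show ?case
    by (simp add: class_prods_snoc class_prods_Nil)
next
  case (snoc G Fs)
  have "class_prods D (Es @ F # Fs @ [G]) = class_set_prod (class_prods D (Es @ F # Fs)) {G}"
    using class_prods_snoc[of D "Es @ F # Fs" G] by simp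
  also have "\<dots> = class_set_prod (class_set_prod (class_prods D Es) (class_prods F Fs)) {G}"
    using snoc by simp
  also have "\<dots> = class_set_prod (class_prods D Es) (class_set_prod (class_prods F Fs) {G})"
    using snoc class_prods_subset_dual[OF assms(1)] class_prods_subset_dual[OF assms(2)]
    by (intro class_set_prod_assoc) auto
  finally show ?case
    by (simp add: class_prods_snoc)
qed

section \<open>Chain equivalence\<close>

lemma chain_equivI:
  assumes "E \<in> dual" "set Es \<subseteq> dual" "D \<in> class_prods E Es" "D' \<in> class_prods E Es"
  shows "chain_equiv D D'"
  using assms class_prods_subset_dual[OF assms(1)] unfolding chain_equiv_def by blast

lemma chain_equivE:
  assumes "chain_equiv D D'"
  obtains E Es where "E \<in> dual" "set Es \<subseteq> dual" "D \<in> class_prods E Es" "D' \<in> class_prods E Es"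
  using assms unfolding chain_equiv_def by blast

lemma chain_equiv_dual: "chain_equiv D D' \<Longrightarrow> D \<in> dual \<and> D' \<in> dual"
  by (simp add: chain_equiv_def)

lemma chain_equiv_refl: "D \<in> dual \<Longrightarrow> chain_equiv D D"
  by (rule chain_equivI[of D "[]"]) (auto simp: class_prods_Nil)

lemma chain_equiv_sym: "chain_equiv D D' \<Longrightarrow> chain_equiv D' D"
  unfolding chain_equiv_def by blast

text \<open>
  If \<open>D, D' \<in> X\<close> and \<open>D', D'' \<in> Y\<close>, then \<open>D\<close> and \<open>D''\<close> both occur in \<open>X \<times> C \<times> Y\<close> for \<open>C\<close>
  conjugate to \<open>D'\<close>: \<open>C \<times> D'\<close> and \<open>D' \<times> C\<close> contain the trivial class.
\<close>

lemma chain_equiv_trans: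
  assumes "chain_equiv D D'" "chain_equiv D' D''"
  shows "chain_equiv D D''"
proof -
  obtain E Es where E: "E \<in> dual" "set Es \<subseteq> dual" "D \<in> class_prods E Es" "D' \<in> class_prods E Es"
    using assms(1) by (rule chain_equivE)
  obtain F Fs where F: "F \<in> dual" "set Fs \<subseteq> dual" "D' \<in> class_prods F Fs" "D'' \<in> class_prods F Fs"
    using assms(2) by (rule chain_equivE)
  have D: "D \<in> dual" "D' \<in> dual" "D'' \<in> dual"
    using assms chain_equiv_dual by auto
  obtain C where C: "C \<in> dual" "trivial_class \<in> class_prod C D'" "trivial_class \<in> class_prod D' C"
    by (rule class_prod_conjugate[OF D(2)])
  define X where "X = class_prods E Es"
  define Y where "Y = class_prods F Fs"
  have XY: "X \<subseteq> dual" "Y \<subseteq> dual" "{C} \<subseteq> dual"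
    using class_prods_subset_dual E(1) F(1) C(1) by (auto simp: X_def Y_def)
  have eq: "class_prods E (Es @ C # F # Fs) = class_set_prod X (class_set_prod {C} Y)"
    using class_prods_append[of E C "F # Fs" Es] class_prods_append[of C F Fs "[]"] E F C
    by (simp add: X_def Y_def class_prods_Nil)
  have "trivial_class \<in> class_set_prod {C} Y"
    using F(3) C(2) by (auto simp: class_set_prod_def Y_def)
  \<comment> \<open>The two ends use different bracketings: \<open>D\<close> arises from
    \<open>D\<close> and the trivial class in C x Y, while \<open>D''\<close> arises from the
    trivial class in X x C and \<open>D''\<close>.\<close>
  then have "D \<in> class_set_prod X (class_set_prod {C} Y)"
    using E(3) class_prod_trivial(2)[OF D(1)] unfolding X_def[symmetric] class_set_prod_def[of X] by blast
  moreover have "trivial_class \<in> class_set_prod X {C}"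
    using E(4) C(3) by (auto simp: class_set_prod_def X_def)
  then have "D'' \<in> class_set_prod (class_set_prod X {C}) Y"
    using F(4) class_prod_trivial(1)[OF D(3)] unfolding Y_def[symmetric] class_set_prod_def[of _ Y] by blast
  ultimately show ?thesis
    using E F C class_set_prod_assoc[OF XY(1,3,2)] by (intro chain_equivI[of E "Es @ C # F # Fs"]) (auto simp: eq)
qed

text \<open>Concatenating a chain for D, D' with a chain for E, E' gives a single chain that
  contains the constituents of both products.\<close>

lemma chain_equiv_class_prod:
  assumes "chain_equiv D D'" "chain_equiv E E'" "F \<in> class_prod D E" "F' \<in> class_prod D' E'"
  shows "chain_equiv F F'"
proof -
  obtain A As where A: "A \<in> dual" "set As \<subseteq> dual" "D \<in> class_prods A As" "D' \<in> class_prods A As"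
    using assms(1) by (rule chain_equivE)
  obtain B Bs where B: "B \<in> dual" "set Bs \<subseteq> dual" "E \<in> class_prods B Bs" "E' \<in> class_prods B Bs"
    using assms(2) by (rule chain_equivE)
  have "F \<in> class_prods A (As @ B # Bs)" "F' \<in> class_prods A (As @ B # Bs)"
    using assms A B by (auto simp: class_prods_append class_set_prod_def)
  then show ?thesis
    using A B by (intro chain_equivI[of A "As @ B # Bs"]) auto
qed

lemma equiv_chain_rel: "equiv dual chain_rel"
proof (rule equivI)
  show "refl_on dual chain_rel"
    by (auto simp: refl_on_def chain_rel_def intro: chain_equiv_refl)
  show "sym chain_rel"
    by (auto simp: sym_def chain_rel_def intro: chain_equiv_sym)
  show "trans chain_rel"
    by (auto simp: trans_def chain_rel_def intro: chain_equiv_trans)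
  show "chain_rel \<subseteq> dual \<times> dual"
    using chain_equiv_dual by (auto simp: chain_rel_def)
qed

lemma chain_class_eq_iff:
  "D \<in> dual \<Longrightarrow> E \<in> dual \<Longrightarrow> chain_class D = chain_class E \<longleftrightarrow> chain_equiv D E"
  using eq_equiv_class_iff[OF equiv_chain_rel, of D E, folded chain_class_def]
  unfolding chain_rel_def by simp

lemma chain_class_mem: "E \<in> chain_class D \<longleftrightarrow> chain_equiv D E"
  by (simp add: chain_class_def chain_rel_def)

section \<open>The chain group\<close>

lemma carrier_chain_groupE:
  assumes "c \<in> carrier chain_group"
  obtains D where "D \<in> dual" "c = chain_class D"
  using assms by (auto simp: chain_group_def chain_class_def elim: quotientE)

lemma chain_class_carrier: "D \<in> dual \<Longrightarrow> chain_class D \<in> carrier chain_group"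
  by (auto simp: chain_group_def chain_class_def intro: quotientI)

text \<open>All constituents of all products of representatives are chain equivalent, so the set
  under \<open>the_elem\<close> is a singleton and any one constituent computes the product.\<close>

lemma chain_group_mult:
  assumes D: "D \<in> dual" "E \<in> dual" and F: "F \<in> class_prod D E"
  shows "chain_class D \<otimes>\<^bsub>chain_group\<^esub> chain_class E = chain_class F"
proof -
  have Fd: "F \<in> dual"
    using F class_prod_subset_dual by blast
  have "chain_class ` (\<Union>D\<^sub>0\<in>chain_class D. \<Union>D\<^sub>1\<in>chain_class E. class_prod D\<^sub>0 D\<^sub>1) = {chain_class F}"
  proof (intro equalityI subsetI)
    fix c assume "c \<in> chain_class ` (\<Union>D\<^sub>0\<in>chain_class D. \<Union>D\<^sub>1\<in>chain_class E. class_prod D\<^sub>0 D\<^sub>1)"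
    then obtain D' E' F' where *: "chain_equiv D D'" "chain_equiv E E'" "F' \<in> class_prod D' E'" "c = chain_class F'"
      by (auto simp: chain_class_mem)
    then have "chain_equiv F F'"
      using chain_equiv_class_prod F by blast
    then show "c \<in> {chain_class F}"
      using * chain_class_eq_iff chain_equiv_dual by blast
  next
    fix c assume "c \<in> {chain_class F}"
    moreover have "D \<in> chain_class D" "E \<in> chain_class E"
      using D chain_equiv_refl by (simp_all add: chain_class_mem)
    ultimately show "c \<in> chain_class ` (\<Union>D\<^sub>0\<in>chain_class D. \<Union>D\<^sub>1\<in>chain_class E. class_prod D\<^sub>0 D\<^sub>1)"
      using F by blast
  qed
  then show ?thesis
    by (simp add: chain_group_def)
qed

lemma group_chain_group: "group (chain_group :: 'g::{topological_group_add, t2_space} rep set set monoid)"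
proof (rule groupI)
  fix x y :: "'g rep set set"
  assume "x \<in> carrier chain_group" "y \<in> carrier chain_group"
  then obtain D E where D: "D \<in> dual" "E \<in> dual" and xy: "x = chain_class D" "y = chain_class E"
    by (meson carrier_chain_groupE)
  obtain F where F: "F \<in> class_prod D E"
    using class_prod_nonempty[OF D] by blast
  then show "x \<otimes>\<^bsub>chain_group\<^esub> y \<in> carrier chain_group"
    using chain_group_mult[OF D F] chain_class_carrier class_prod_subset_dual xy by fastforce
next
  show "\<one>\<^bsub>chain_group\<^esub> \<in> carrier (chain_group :: 'g rep set set monoid)"
    using chain_class_carrier[OF trivial_class_mem(2)] by (simp add: chain_group_def)
next
  fix x y z :: "'g rep set set"
  assume "x \<in> carrier chain_group" "y \<in> carrier chain_group" "z \<in> carrier chain_group"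
  then obtain A B C where D: "A \<in> dual" "B \<in> dual" "C \<in> dual"
    and xyz: "x = chain_class A" "y = chain_class B" "z = chain_class C"
    by (meson carrier_chain_groupE)
  obtain E where E: "E \<in> class_prod A B"
    using class_prod_nonempty D by blast
  then have Ed: "E \<in> dual"
    using class_prod_subset_dual by blast
  obtain X where X: "X \<in> class_prod E C"
    using class_prod_nonempty[OF Ed D(3)] by blast
  \<comment> \<open>One constituent X of the triple product is reached through both
    bracketings.\<close>
  have "X \<in> class_set_prod (class_set_prod {A} {B}) {C}"
    using E X by (auto simp: class_set_prod_def)
  then have "X \<in> class_set_prod {A} (class_set_prod {B} {C})"
    using class_set_prod_assoc[of "{A}" "{B}" "{C}"] D by simp
  then obtain F where F: "F \<in> class_prod B C" "X \<in> class_prod A F"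
    by (auto simp: class_set_prod_def)
  then have Fd: "F \<in> dual"
    using class_prod_subset_dual by blast
  show "x \<otimes>\<^bsub>chain_group\<^esub> y \<otimes>\<^bsub>chain_group\<^esub> z = x \<otimes>\<^bsub>chain_group\<^esub> (y \<otimes>\<^bsub>chain_group\<^esub> z)"
    unfolding xyz chain_group_mult[OF D(1,2) E] chain_group_mult[OF Ed D(3) X]
      chain_group_mult[OF D(2,3) F(1)] chain_group_mult[OF D(1) Fd F(2)] ..
next
  have one: "\<one>\<^bsub>chain_group\<^esub> = chain_class (trivial_class :: 'g rep set)"
    by (simp add: chain_group_def)
  fix x :: "'g rep set set"
  assume "x \<in> carrier chain_group"
  then obtain D where D: "D \<in> dual" and x: "x = chain_class D"
    by (rule carrier_chain_groupE)
  show "\<one>\<^bsub>chain_group\<^esub> \<otimes>\<^bsub>chain_group\<^esub> x = x"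
    unfolding one x by (rule chain_group_mult[OF trivial_class_mem(2) D class_prod_trivial(1)[OF D]])
  obtain E where E: "E \<in> dual" "trivial_class \<in> class_prod E D"
    by (rule class_prod_conjugate[OF D])
  show "\<exists>y\<in>carrier chain_group. y \<otimes>\<^bsub>chain_group\<^esub> x = \<one>\<^bsub>chain_group\<^esub>"
    unfolding one x using chain_group_mult[OF E(1) D E(2)] chain_class_carrier[OF E(1)] by blast
qed

section \<open>Algebraic Hilbert spaces\<close>

declare star_star [simp]

lemma star_zero [simp]: "star (0 :: 'f::unital_cstar_algebra) = 0"
  using star_add[of 0 "0 :: 'f"] by simp

lemma star_one [simp]: "star (1 :: 'f::unital_cstar_algebra) = 1"
  by (metis mult.right_neutral star_mult star_star)

lemma star_sum: "star (\<Sum>i\<in>I. f i) = (\<Sum>i\<in>I. star (f i :: 'f::unital_cstar_algebra))"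
  by (induction I rule: infinite_finite_induct) (simp_all add: star_add)

lemma scalar_prod_algI:
  fixes A B :: "'f::unital_cstar_algebra"
  assumes "star A * B = c *\<^sub>C 1"
  shows "scalar_prod_alg A B = c"
  unfolding scalar_prod_alg_def using assms by (intro the_equality) (auto simp: complex_vector.scale_cancel_right)

lemma algebraic_hilbert_space_star_mult:
  assumes "algebraic_hilbert_space H" "x \<in> H" "y \<in> H"
  shows "star x * y = scalar_prod_alg x y *\<^sub>C 1"
  using assms scalar_prod_algI unfolding algebraic_hilbert_space_def by metis

lemma is_onb_nth_mem: "is_onb H \<Phi> \<Longrightarrow> i < length \<Phi> \<Longrightarrow> \<Phi> ! i \<in> H"
  using complex_vector.span_base[of "\<Phi> ! i" "set \<Phi>"] by (auto simp: is_onb_def)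

lemma is_onb_orthonormal:
  fixes H :: "'f::unital_cstar_algebra set"
  assumes "algebraic_hilbert_space H" "is_onb H \<Phi>" "i < length \<Phi>" "j < length \<Phi>"
  shows "star (\<Phi> ! i) * \<Phi> ! j = (if i = j then 1 else 0)"
  using algebraic_hilbert_space_star_mult[OF assms(1) is_onb_nth_mem[OF assms(2,3)] is_onb_nth_mem[OF assms(2,4)]] assms
  by (auto simp: is_onb_def)

text \<open>Orthonormality gives this for basis vectors, and both sides are linear in x.\<close>

lemma is_onb_expansion:
  fixes H :: "'f::unital_cstar_algebra set"
  assumes H: "algebraic_hilbert_space H" and \<Phi>: "is_onb H \<Phi>" and x: "x \<in> H"
  shows "(\<Sum>i<length \<Phi>. \<Phi> ! i * (star (\<Phi> ! i) * x)) = x"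
proof -
  define T where "T = {x. (\<Sum>i<length \<Phi>. \<Phi> ! i * (star (\<Phi> ! i) * x)) = x}"
  have "complex_vector.subspace T"
    by (rule complex_vector.subspaceI)
      (auto simp: T_def distrib_left sum.distrib scaleC_mult_right complex_vector.scale_sum_right[symmetric])
  moreover have "set \<Phi> \<subseteq> T"
  proof
    fix y assume "y \<in> set \<Phi>"
    then obtain j where j: "j < length \<Phi>" "y = \<Phi> ! j"
      by (metis in_set_conv_nth)
    have "(\<Sum>i<length \<Phi>. \<Phi> ! i * (star (\<Phi> ! i) * y)) = (\<Sum>i<length \<Phi>. if i = j then \<Phi> ! i else 0)"
      using j is_onb_orthonormal[OF H \<Phi> _ j(1)] by (intro sum.cong refl) simp
    then show "y \<in> T"
      using j by (simp add: T_def)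
  qed
  ultimately have "complex_vector.span (set \<Phi>) \<subseteq> T"
    by (rule complex_vector.span_minimal[rotated])
  then show ?thesis
    using \<Phi> x by (auto simp: is_onb_def T_def)
qed

lemma sum_list_conv_sum_nth: "(\<Sum>x\<leftarrow>xs. f x) = (\<Sum>i<length xs. f (xs ! i))"
  by (simp add: sum_list_sum_nth atLeast0LessThan)

text \<open>The definition grants support 1 for some basis \<Psi>. For any basis the sum Q satisfies
  Q x = x on H, so multiplying Q by the support of \<Psi> gives Q = 1.\<close>

lemma is_onb_support:
  fixes H :: "'f::unital_cstar_algebra set"
  assumes H: "algebraic_hilbert_space H" and \<Phi>: "is_onb H \<Phi>"
  shows "(\<Sum>i<length \<Phi>. \<Phi> ! i * star (\<Phi> ! i)) = 1"
proof -
  define Q where "Q = (\<Sum>i<length \<Phi>. \<Phi> ! i * star (\<Phi> ! i))"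
  have Q: "Q * x = x" if "x \<in> H" for x
    using is_onb_expansion[OF H \<Phi> that] by (simp add: Q_def sum_distrib_right mult.assoc)
  obtain \<Psi> where \<Psi>: "is_onb H \<Psi>" "(\<Sum>\<psi>\<leftarrow>\<Psi>. \<psi> * star \<psi>) = 1"
    using H by (auto simp: algebraic_hilbert_space_def)
  have "Q = Q * (\<Sum>i<length \<Psi>. \<Psi> ! i * star (\<Psi> ! i))"
    using \<Psi>(2) by (simp add: sum_list_conv_sum_nth)
  also have "\<dots> = (\<Sum>i<length \<Psi>. Q * \<Psi> ! i * star (\<Psi> ! i))"
    by (simp add: sum_distrib_left mult.assoc)
  also have "\<dots> = (\<Sum>i<length \<Psi>. \<Psi> ! i * star (\<Psi> ! i))"
    using Q is_onb_nth_mem[OF \<Psi>(1)] by (intro sum.cong) auto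
  finally show ?thesis
    using \<Psi>(2) by (simp add: sum_list_conv_sum_nth Q_def)
qed

text \<open>The sum R satisfies R x = x A for all x in H, a condition that mentions no basis.
  Multiplying R by the support of the basis chosen by \<open>SOME\<close> turns it into
  \<open>canonical_endo H A\<close>.\<close>

lemma canonical_endo_eq:
  fixes H :: "'f::unital_cstar_algebra set"
  assumes H: "algebraic_hilbert_space H" and \<Phi>: "is_onb H \<Phi>"
  shows "canonical_endo H A = (\<Sum>i<length \<Phi>. \<Phi> ! i * A * star (\<Phi> ! i))"
proof -
  define \<Psi> where "\<Psi> = (SOME \<Phi>. is_onb H \<Phi>)"
  have \<Psi>: "is_onb H \<Psi>"
    unfolding \<Psi>_def using \<Phi> by (rule someI)
  define R where "R = (\<Sum>i<length \<Phi>. \<Phi> ! i * A * star (\<Phi> ! i))"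
  have R: "R * x = x * A" if x: "x \<in> H" for x
  proof -
    define c where "c i = scalar_prod_alg (\<Phi> ! i) x" for i
    have c: "star (\<Phi> ! i) * x = c i *\<^sub>C 1" if "i < length \<Phi>" for i
      unfolding c_def by (rule algebraic_hilbert_space_star_mult[OF H is_onb_nth_mem[OF \<Phi> that] x])
    have "R * x = (\<Sum>i<length \<Phi>. \<Phi> ! i * A * (c i *\<^sub>C 1))"
      using c by (simp add: R_def sum_distrib_right mult.assoc)
    also have "\<dots> = (\<Sum>i<length \<Phi>. \<Phi> ! i * (c i *\<^sub>C 1)) * A"
      by (simp add: sum_distrib_right scaleC_mult_right scaleC_mult_left)
    also have "(\<Sum>i<length \<Phi>. \<Phi> ! i * (c i *\<^sub>C 1)) = x"
      using is_onb_expansion[OF H \<Phi> x] c by simp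
    finally show ?thesis .
  qed
  have "R = R * (\<Sum>i<length \<Psi>. \<Psi> ! i * star (\<Psi> ! i))"
    using is_onb_support[OF H \<Psi>] by simp
  also have "\<dots> = (\<Sum>i<length \<Psi>. R * \<Psi> ! i * star (\<Psi> ! i))"
    by (simp add: sum_distrib_left mult.assoc)
  also have "\<dots> = (\<Sum>i<length \<Psi>. \<Psi> ! i * A * star (\<Psi> ! i))"
    using R is_onb_nth_mem[OF \<Psi>] by (intro sum.cong) auto
  finally show ?thesis
    by (simp add: canonical_endo_def sum_list_conv_sum_nth R_def flip: \<Psi>_def)
qed

text \<open>A coordinate with respect to a Hamel basis through x. Such functionals reduce identities
  in the algebra to identities between complex numbers, where Schur's lemma for matrices
  applies.\<close>

lemma complex_linear_functional_separates:
  fixes x :: "'f::unital_cstar_algebra"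
  assumes "x \<noteq> 0"
  obtains f :: "'f \<Rightarrow> complex" where "\<And>a b. f (a + b) = f a + f b" "\<And>c a. f (c *\<^sub>C a) = c * f a" "f x \<noteq> 0"
proof -
  have ind: "complex_vector.independent {x}"
    using assms by (simp add: complex_vector.independent_insert)
  define B where "B = complex_vector.extend_basis {x}"
  have B: "complex_vector.independent B" "complex_vector.span B = UNIV" "x \<in> B"
    using complex_vector.independent_extend_basis[OF ind] complex_vector.span_extend_basis[OF ind]
      complex_vector.extend_basis_superset[OF ind] by (auto simp: B_def)
  show thesis
    by (rule that[of "\<lambda>a. complex_vector.representation B a x"])
      (simp_all add: complex_vector.representation_add complex_vector.representation_scale
        complex_vector.representation_basis B)
qed

section \<open>Multiplets\<close>

text \<open>Isometries with mutually orthogonal ranges that transform by the matrices of U. Their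
  support may be smaller than 1, as happens for a constituent of a product;
  \<open>full_multiplet\<close> adds the support condition that bases of \<open>H D\<close>
  satisfy.\<close>

definition multiplet ::
    "('g::group_add \<Rightarrow> 'f::unital_cstar_algebra \<Rightarrow> 'f) \<Rightarrow> 'g rep \<Rightarrow> (nat \<Rightarrow> 'f) \<Rightarrow> bool" where
  "multiplet \<alpha> U \<phi> \<longleftrightarrow>
     (\<forall>i<rep_dim U. \<forall>j<rep_dim U. star (\<phi> i) * \<phi> j = (if i = j then 1 else 0)) \<and>
     (\<forall>g. \<forall>j<rep_dim U. \<alpha> g (\<phi> j) = (\<Sum>i<rep_dim U. U g $$ (i, j) *\<^sub>C \<phi> i))"

definition full_multiplet ::
    "('g::group_add \<Rightarrow> 'f::unital_cstar_algebra \<Rightarrow> 'f) \<Rightarrow> 'g rep \<Rightarrow> (nat \<Rightarrow> 'f) \<Rightarrow> bool" where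
  "full_multiplet \<alpha> U \<phi> \<longleftrightarrow> multiplet \<alpha> U \<phi> \<and> (\<Sum>i<rep_dim U. \<phi> i * star (\<phi> i)) = 1"

text \<open>Expanding \<alpha>_g(\<Phi>_j) in the orthonormal basis produces the entries of
  \<open>action_matrix\<close> as coefficients, so the basis itself is the multiplet.\<close>

lemma spectral_hilbert_space_multiplet:
  fixes \<alpha> :: "'g::{topological_group_add, t2_space} \<Rightarrow> 'f::unital_cstar_algebra \<Rightarrow> 'f"
  assumes "spectral_hilbert_space \<alpha> D H"
  obtains U \<phi> where "U \<in> D" "full_multiplet \<alpha> U \<phi>"
    "\<forall>A. canonical_endo H A = (\<Sum>i<rep_dim U. \<phi> i * A * star (\<phi> i))"
proof -
  obtain \<Phi> where H: "algebraic_hilbert_space H" and inv: "\<And>g x. x \<in> H \<Longrightarrow> \<alpha> g x \<in> H"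
    and \<Phi>: "is_onb H \<Phi>" and D: "action_matrix \<alpha> \<Phi> \<in> D"
    using assms unfolding spectral_hilbert_space_def invariant_hilbert_space_def by blast
  have n: "rep_dim (action_matrix \<alpha> \<Phi>) = length \<Phi>"
    by (simp add: rep_dim_def action_matrix_def)
  have "\<alpha> g (\<Phi> ! j) = (\<Sum>i<length \<Phi>. action_matrix \<alpha> \<Phi> g $$ (i, j) *\<^sub>C \<Phi> ! i)" if j: "j < length \<Phi>" for g j
  proof -
    have a: "\<alpha> g (\<Phi> ! j) \<in> H"
      by (rule inv[OF is_onb_nth_mem[OF \<Phi> j]])
    have "\<alpha> g (\<Phi> ! j) = (\<Sum>i<length \<Phi>. \<Phi> ! i * (star (\<Phi> ! i) * \<alpha> g (\<Phi> ! j)))"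
      using is_onb_expansion[OF H \<Phi> a] by simp
    also have "\<dots> = (\<Sum>i<length \<Phi>. action_matrix \<alpha> \<Phi> g $$ (i, j) *\<^sub>C \<Phi> ! i)"
      using j algebraic_hilbert_space_star_mult[OF H is_onb_nth_mem[OF \<Phi>] a]
      by (intro sum.cong refl) (simp add: action_matrix_def scaleC_mult_right)
    finally show ?thesis .
  qed
  then have "full_multiplet \<alpha> (action_matrix \<alpha> \<Phi>) ((!) \<Phi>)"
    using is_onb_orthonormal[OF H \<Phi>] is_onb_support[OF H \<Phi>]
    by (simp add: full_multiplet_def multiplet_def n)
  then show thesis
    using that[OF D] canonical_endo_eq[OF H \<Phi>] by (simp add: n)
qed

section \<open>The fixed point algebra, its center and covariant sums\<close>

locale cstar_action =
  fixes \<alpha> :: "'g::{topological_group_add, t2_space} \<Rightarrow> 'f::unital_cstar_algebra \<Rightarrow> 'f"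
  assumes automorphism: "\<alpha> g \<in> star_auts UNIV"
begin

lemma action_add: "\<alpha> g (x + y) = \<alpha> g x + \<alpha> g y"
  and action_mult: "\<alpha> g (x * y) = \<alpha> g x * \<alpha> g y"
  and action_scaleC: "\<alpha> g (c *\<^sub>C x) = c *\<^sub>C \<alpha> g x"
  and action_star: "\<alpha> g (star x) = star (\<alpha> g x)"
  and action_surj: "\<exists>x. \<alpha> g x = y"
  using automorphism[of g] bij_is_surj[of "\<alpha> g", unfolded surj_def]
  by (auto simp: star_auts_def Bij_def; metis)+

lemma action_one: "\<alpha> g 1 = 1"
  by (metis action_mult action_surj mult.left_neutral mult.right_neutral)

lemma action_zero: "\<alpha> g 0 = 0"
  using action_add[of g 0 0] by simp

lemma action_sum: "\<alpha> g (\<Sum>i\<in>I. f i) = (\<Sum>i\<in>I. \<alpha> g (f i))"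
  by (induction I rule: infinite_finite_induct) (simp_all add: action_add action_zero)

lemma fixed_algebra_closed:
  "x \<in> fixed_algebra \<alpha> \<Longrightarrow> y \<in> fixed_algebra \<alpha> \<Longrightarrow> x + y \<in> fixed_algebra \<alpha>"
  "x \<in> fixed_algebra \<alpha> \<Longrightarrow> y \<in> fixed_algebra \<alpha> \<Longrightarrow> x * y \<in> fixed_algebra \<alpha>"
  "x \<in> fixed_algebra \<alpha> \<Longrightarrow> c *\<^sub>C x \<in> fixed_algebra \<alpha>"
  "x \<in> fixed_algebra \<alpha> \<Longrightarrow> star x \<in> fixed_algebra \<alpha>"
  "1 \<in> fixed_algebra \<alpha>"
  by (simp_all add: fixed_algebra_def action_add action_mult action_scaleC action_star action_one)

lemma center_fixed: "z \<in> center \<alpha> \<Longrightarrow> z \<in> fixed_algebra \<alpha>"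
  by (simp add: center_def)

lemma center_commute: "z \<in> center \<alpha> \<Longrightarrow> a \<in> fixed_algebra \<alpha> \<Longrightarrow> z * a = a * z"
  by (simp add: center_def commutant_def)

lemma centerI: "z \<in> fixed_algebra \<alpha> \<Longrightarrow> (\<And>a. a \<in> fixed_algebra \<alpha> \<Longrightarrow> z * a = a * z) \<Longrightarrow> z \<in> center \<alpha>"
  unfolding center_def commutant_def by blast

lemma center_add: "x + y \<in> center \<alpha>" if "x \<in> center \<alpha>" "y \<in> center \<alpha>"
  using that by (intro centerI) (simp_all add: center_fixed fixed_algebra_closed center_commute distrib_left distrib_right)

lemma center_mult: "x * y \<in> center \<alpha>" if "x \<in> center \<alpha>" "y \<in> center \<alpha>"
proof (rule centerI)
  fix a assume "a \<in> fixed_algebra \<alpha>"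
  then have "x * a = a * x" "y * a = a * y"
    using that center_commute by auto
  then show "x * y * a = a * (x * y)"
    by (metis mult.assoc)
qed (use that in \<open>simp add: center_fixed fixed_algebra_closed\<close>)

lemma center_scaleC: "c *\<^sub>C x \<in> center \<alpha>" if "x \<in> center \<alpha>"
  using that
  by (intro centerI) (simp_all add: center_fixed fixed_algebra_closed center_commute scaleC_mult_left scaleC_mult_right)

lemma center_star: "star x \<in> center \<alpha>" if "x \<in> center \<alpha>"
proof (rule centerI)
  fix a assume "a \<in> fixed_algebra \<alpha>"
  then have "x * star a = star a * x"
    using that center_commute fixed_algebra_closed(4) by blast
  then show "star x * a = a * star x"
    by (metis star_mult star_star)
qed (use that in \<open>simp add: center_fixed fixed_algebra_closed\<close>)

text \<open>The two families are transformed by U(g) and its conjugate; summing over k leaves the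
  entries of \<open>U g * mat_adjoint (U g)\<close>, the identity.\<close>

lemma multiplet_sum_fixed:
  assumes U: "unitary_rep U" and \<xi>: "multiplet \<alpha> U \<xi>" and \<eta>: "multiplet \<alpha> U \<eta>"
    and A: "A \<in> fixed_algebra \<alpha>"
  shows "(\<Sum>k<rep_dim U. \<xi> k * A * star (\<eta> k)) \<in> fixed_algebra \<alpha>"
proof -
  define n where "n = rep_dim U"
  have "\<alpha> g (\<Sum>k<n. \<xi> k * A * star (\<eta> k)) = (\<Sum>k<n. \<xi> k * A * star (\<eta> k))" for g
  proof -
    have Uc: "U g \<in> carrier_mat n n"
      using unitary_rep_carrier[OF U] by (simp add: n_def)
    have UU: "(\<Sum>k<n. U g $$ (l, k) * cnj (U g $$ (m, k))) = (if l = m then 1 else 0)" if "l < n" "m < n" for l m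
    proof -
      have "(U g * mat_adjoint (U g)) $$ (l, m) = (\<Sum>k<n. U g $$ (l, k) * cnj (U g $$ (m, k)))"
        using that Uc by (subst index_mult_mat_sum) auto
      then show ?thesis
        using that unitary_rep_mult_adjoint[OF U, of g] by (simp add: n_def)
    qed
    have a: "\<alpha> g A = A"
      using A by (simp add: fixed_algebra_def)
    have "\<alpha> g (\<Sum>k<n. \<xi> k * A * star (\<eta> k)) =
        (\<Sum>k<n. (\<Sum>l<n. U g $$ (l, k) *\<^sub>C \<xi> l) * A * star (\<Sum>m<n. U g $$ (m, k) *\<^sub>C \<eta> m))"
      using \<xi> \<eta> by (auto simp: action_sum action_mult action_star a multiplet_def n_def intro!: sum.cong)
    also have "\<dots> = (\<Sum>k<n. \<Sum>m<n. \<Sum>l<n. (U g $$ (l, k) * cnj (U g $$ (m, k))) *\<^sub>C (\<xi> l * A * star (\<eta> m)))"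
      by (simp add: star_sum star_scaleC sum_distrib_left sum_distrib_right scaleC_mult_left
          scaleC_mult_right complex_vector.scale_sum_right mult.commute)
    also have "\<dots> = (\<Sum>m<n. \<Sum>l<n. (\<Sum>k<n. U g $$ (l, k) * cnj (U g $$ (m, k))) *\<^sub>C (\<xi> l * A * star (\<eta> m)))"
      by (subst sum.swap, rule sum.cong[OF refl], subst sum.swap) (simp add: complex_vector.scale_sum_left)
    also have "\<dots> = (\<Sum>m<n. \<Sum>l<n. if l = m then \<xi> l * A * star (\<eta> m) else 0)"
      by (intro sum.cong refl) (simp add: UU)
    also have "\<dots> = (\<Sum>k<n. \<xi> k * A * star (\<eta> k))"
      by simp
    finally show ?thesis .
  qed
  then show ?thesis
    by (simp add: fixed_algebra_def n_def)
qed

text \<open>Orthonormality comes from T being isometric, covariance from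
  \<open>T * U g = V g * T\<close>. The new family need not have full support, even if \<theta>
  has.\<close>

lemma multiplet_intertwiner:
  assumes U: "unitary_rep U" and V: "unitary_rep V"
    and mult: "multiplet \<alpha> V \<theta>" and T: "isometric_intertwiner U V T"
  shows "multiplet \<alpha> U (\<lambda>k. \<Sum>p<rep_dim V. T $$ (p, k) *\<^sub>C \<theta> p)"
proof -
  define n where "n = rep_dim U"
  define m where "m = rep_dim V"
  have Tc: "T \<in> carrier_mat m n" and TT: "mat_adjoint T * T = 1\<^sub>m n" and TU: "\<And>g. T * U g = V g * T"
    using T by (auto simp: isometric_intertwiner_def intertwiner_def n_def m_def)
  have \<theta>: "\<And>p q. p < m \<Longrightarrow> q < m \<Longrightarrow> star (\<theta> p) * \<theta> q = (if p = q then 1 else 0)"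
    "\<And>g q. q < m \<Longrightarrow> \<alpha> g (\<theta> q) = (\<Sum>p<m. V g $$ (p, q) *\<^sub>C \<theta> p)"
    using mult by (auto simp: multiplet_def m_def)
  have dim: "\<And>g. V g \<in> carrier_mat m m" "\<And>g. U g \<in> carrier_mat n n"
    using unitary_rep_carrier[OF U] unitary_rep_carrier[OF V] by (auto simp: n_def m_def)
  define \<xi> where "\<xi> = (\<lambda>k. \<Sum>p<m. T $$ (p, k) *\<^sub>C \<theta> p)"
  have "star (\<xi> k) * \<xi> l = (if k = l then 1 else 0)" if kl: "k < n" "l < n" for k l
  proof -
    have "star (\<xi> k) * \<xi> l = (\<Sum>p<m. \<Sum>q<m. (cnj (T $$ (p, k)) * T $$ (q, l)) *\<^sub>C (star (\<theta> p) * \<theta> q))"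
      by (simp add: \<xi>_def star_sum star_scaleC sum_product scaleC_mult_left scaleC_mult_right scaleC_scaleC mult.commute)
    also have "\<dots> = (\<Sum>p<m. \<Sum>q<m. if p = q then (cnj (T $$ (p, k)) * T $$ (q, l)) *\<^sub>C 1 else 0)"
      by (intro sum.cong refl) (simp add: \<theta>)
    also have "\<dots> = (\<Sum>p<m. cnj (T $$ (p, k)) * T $$ (p, l)) *\<^sub>C 1"
      by (simp add: complex_vector.scale_sum_left)
    also have "(\<Sum>p<m. cnj (T $$ (p, k)) * T $$ (p, l)) = (mat_adjoint T * T) $$ (k, l)"
      using kl Tc by (subst index_mult_mat_sum) auto
    finally show ?thesis
      using kl by (simp add: TT)
  qed
  moreover have "\<alpha> g (\<xi> k) = (\<Sum>l<n. U g $$ (l, k) *\<^sub>C \<xi> l)" if k: "k < n" for g k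
  proof -
    have "\<alpha> g (\<xi> k) = (\<Sum>p<m. T $$ (p, k) *\<^sub>C (\<Sum>q<m. V g $$ (q, p) *\<^sub>C \<theta> q))"
      by (simp add: \<xi>_def action_sum action_scaleC \<theta>)
    also have "\<dots> = (\<Sum>q<m. (\<Sum>p<m. V g $$ (q, p) * T $$ (p, k)) *\<^sub>C \<theta> q)"
      unfolding complex_vector.scale_sum_right complex_vector.scale_sum_left
      by (subst sum.swap) (simp add: scaleC_scaleC mult.commute)
    also have "\<dots> = (\<Sum>q<m. (T * U g) $$ (q, k) *\<^sub>C \<theta> q)"
      using k dim(1)[of g] Tc unfolding TU by (intro sum.cong refl) (subst index_mult_mat_sum, auto)
    also have "\<dots> = (\<Sum>q<m. (\<Sum>l<n. T $$ (q, l) * U g $$ (l, k)) *\<^sub>C \<theta> q)"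
      using k dim(2)[of g] Tc by (intro sum.cong refl) (subst index_mult_mat_sum, auto)
    also have "\<dots> = (\<Sum>l<n. U g $$ (l, k) *\<^sub>C \<xi> l)"
      unfolding \<xi>_def complex_vector.scale_sum_right complex_vector.scale_sum_left
      by (subst sum.swap) (simp add: scaleC_scaleC mult.commute)
    finally show ?thesis .
  qed
  ultimately show ?thesis
    by (simp add: multiplet_def \<xi>_def n_def m_def)
qed

end

section \<open>Endomorphisms implemented by a multiplet\<close>

definition multiplet_endo :: "nat \<Rightarrow> (nat \<Rightarrow> 'f::unital_cstar_algebra) \<Rightarrow> 'f \<Rightarrow> 'f" where
  "multiplet_endo n \<phi> A = (\<Sum>i<n. \<phi> i * A * star (\<phi> i))"

lemma multiplet_endo_mult_right:
  assumes "multiplet \<alpha> U \<phi>" "j < rep_dim U"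
  shows "multiplet_endo (rep_dim U) \<phi> A * \<phi> j = \<phi> j * A"
proof -
  have "multiplet_endo (rep_dim U) \<phi> A * \<phi> j = (\<Sum>i<rep_dim U. if i = j then \<phi> i * A else 0)"
    unfolding multiplet_endo_def sum_distrib_right
    using assms by (intro sum.cong refl) (simp add: mult.assoc multiplet_def)
  then show ?thesis
    using assms(2) by simp
qed

text \<open>For a full multiplet the relations X \<phi>_j = \<phi>_j A determine X, since the range
  projections sum to 1. Multiplicativity, surjectivity onto the center and irreducibility are all
  read off from this.\<close>

lemma multiplet_endo_eqI:
  assumes "full_multiplet \<alpha> U \<phi>" "\<And>j. j < rep_dim U \<Longrightarrow> X * \<phi> j = \<phi> j * A"
  shows "X = multiplet_endo (rep_dim U) \<phi> A"
proof -
  have "X = X * (\<Sum>i<rep_dim U. \<phi> i * star (\<phi> i))"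
    using assms(1) by (simp add: full_multiplet_def)
  also have "\<dots> = (\<Sum>i<rep_dim U. X * \<phi> i * star (\<phi> i))"
    by (simp add: sum_distrib_left mult.assoc)
  also have "\<dots> = multiplet_endo (rep_dim U) \<phi> A"
    unfolding multiplet_endo_def using assms(2) by (intro sum.cong) auto
  finally show ?thesis .
qed

lemma multiplet_endo_star: "star (multiplet_endo n \<phi> A) = multiplet_endo n \<phi> (star A)"
  by (simp add: multiplet_endo_def star_sum star_mult mult.assoc)

lemma multiplet_endo_add: "multiplet_endo n \<phi> (A + B) = multiplet_endo n \<phi> A + multiplet_endo n \<phi> B"
  by (simp add: multiplet_endo_def distrib_left distrib_right sum.distrib)

lemma multiplet_endo_scaleC: "multiplet_endo n \<phi> (c *\<^sub>C A) = c *\<^sub>C multiplet_endo n \<phi> A"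
  by (simp add: multiplet_endo_def scaleC_mult_left scaleC_mult_right complex_vector.scale_sum_right)

lemma multiplet_endo_mult:
  assumes "full_multiplet \<alpha> U \<phi>"
  shows "multiplet_endo (rep_dim U) \<phi> (A * B) = multiplet_endo (rep_dim U) \<phi> A * multiplet_endo (rep_dim U) \<phi> B"
proof -
  have m: "multiplet \<alpha> U \<phi>"
    using assms by (simp add: full_multiplet_def)
  have "multiplet_endo (rep_dim U) \<phi> A * multiplet_endo (rep_dim U) \<phi> B * \<phi> j = \<phi> j * (A * B)"
    if "j < rep_dim U" for j
  proof -
    have "multiplet_endo (rep_dim U) \<phi> A * (multiplet_endo (rep_dim U) \<phi> B * \<phi> j) =
        multiplet_endo (rep_dim U) \<phi> A * \<phi> j * B"
      unfolding multiplet_endo_mult_right[OF m that, of B] by (simp only: mult.assoc)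
    then show ?thesis
      unfolding multiplet_endo_mult_right[OF m that, of A] by (simp only: mult.assoc)
  qed
  then show ?thesis
    using multiplet_endo_eqI[OF assms] by metis
qed

text \<open>The element \<open>\<phi> 0\<close> is an isometry and can be cancelled on the
  left.\<close>

lemma multiplet_endo_inj:
  assumes m: "multiplet \<alpha> U \<phi>" and n: "0 < rep_dim U"
    and eq: "multiplet_endo (rep_dim U) \<phi> A = multiplet_endo (rep_dim U) \<phi> B"
  shows "A = B"
proof -
  have one: "star (\<phi> 0) * \<phi> 0 = 1"
    using m n by (simp add: multiplet_def)
  have "\<phi> 0 * A = \<phi> 0 * B"
    using multiplet_endo_mult_right[OF m n, of A] multiplet_endo_mult_right[OF m n, of B] eq by simp
  then have "star (\<phi> 0) * \<phi> 0 * A = star (\<phi> 0) * \<phi> 0 * B"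
    by (simp add: mult.assoc)
  then show ?thesis
    by (simp add: one)
qed

text \<open>The pair (i, j) sits at index \<open>i * rep_dim V + j\<close>, as in
  \<open>tensor_mat\<close>, so that the coefficients of transformed products are entries of the
  Kronecker product.\<close>

lemma multiplet_tensor:
  assumes \<phi>: "multiplet \<alpha> U \<phi>" and \<psi>: "multiplet \<alpha> V \<psi>" and act: "\<And>g x y. \<alpha> g (x * y) = \<alpha> g x * \<alpha> g y"
    and U: "unitary_rep U" and V: "unitary_rep V"
  shows "multiplet \<alpha> (tensor_rep U V) (\<lambda>p. \<phi> (p div rep_dim V) * \<psi> (p mod rep_dim V))"
proof -
  define n where "n = rep_dim U"
  define m where "m = rep_dim V"
  have \<phi>': "\<And>i j. i < n \<Longrightarrow> j < n \<Longrightarrow> star (\<phi> i) * \<phi> j = (if i = j then 1 else 0)"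
    "\<And>g j. j < n \<Longrightarrow> \<alpha> g (\<phi> j) = (\<Sum>i<n. U g $$ (i, j) *\<^sub>C \<phi> i)"
    using \<phi> by (auto simp: multiplet_def n_def)
  have \<psi>': "\<And>i j. i < m \<Longrightarrow> j < m \<Longrightarrow> star (\<psi> i) * \<psi> j = (if i = j then 1 else 0)"
    "\<And>g j. j < m \<Longrightarrow> \<alpha> g (\<psi> j) = (\<Sum>i<m. V g $$ (i, j) *\<^sub>C \<psi> i)"
    using \<psi> by (auto simp: multiplet_def m_def)
  have d: "dim_row (U g) = n" "dim_col (U g) = n" "dim_row (V g) = m" "dim_col (V g) = m" for g
    using unitary_rep_carrier[OF U, of g] unitary_rep_carrier[OF V, of g] by (auto simp: n_def m_def)
  have "star (\<phi> (p div m) * \<psi> (p mod m)) * (\<phi> (q div m) * \<psi> (q mod m)) = (if p = q then 1 else 0)"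
    if "p < n * m" "q < n * m" for p q
  proof -
    note p = less_mult_imp_div_less[OF that(1)] less_mult_mod_less[OF that(1)]
    note q = less_mult_imp_div_less[OF that(2)] less_mult_mod_less[OF that(2)]
    have iff: "p = q \<longleftrightarrow> p div m = q div m \<and> p mod m = q mod m"
      by (metis div_mult_mod_eq)
    have "star (\<phi> (p div m) * \<psi> (p mod m)) * (\<phi> (q div m) * \<psi> (q mod m)) =
        star (\<psi> (p mod m)) * (star (\<phi> (p div m)) * \<phi> (q div m)) * \<psi> (q mod m)"
      by (simp add: star_mult mult.assoc)
    then show ?thesis
      unfolding \<phi>'(1)[OF p(1) q(1)] iff using \<psi>'(1)[OF p(2) q(2)] \<psi>'(1)[OF q(2) q(2)] by simp
  qed
  moreover have "\<alpha> g (\<phi> (q div m) * \<psi> (q mod m)) =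
      (\<Sum>p<n * m. tensor_rep U V g $$ (p, q) *\<^sub>C (\<phi> (p div m) * \<psi> (p mod m)))"
    if "q < n * m" for g q
  proof -
    note q = less_mult_imp_div_less[OF that] less_mult_mod_less[OF that]
    have "\<alpha> g (\<phi> (q div m) * \<psi> (q mod m)) =
        (\<Sum>i<n. \<Sum>j<m. (U g $$ (i, q div m) * V g $$ (j, q mod m)) *\<^sub>C (\<phi> i * \<psi> j))"
      by (simp add: act \<phi>'(2)[OF q(1)] \<psi>'(2)[OF q(2)] sum_product scaleC_mult_left scaleC_mult_right mult.commute)
    also have "\<dots> = (\<Sum>i<n. \<Sum>j<m. tensor_rep U V g $$ (j + i * m, q) *\<^sub>C (\<phi> ((j + i * m) div m) * \<psi> ((j + i * m) mod m)))"
      using that mult_add_less[of _ n _ m]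
      by (intro sum.cong refl) (simp add: tensor_rep_def index_tensor_mat d add.commute)
    also have "\<dots> = (\<Sum>p<n * m. tensor_rep U V g $$ (p, q) *\<^sub>C (\<phi> (p div m) * \<psi> (p mod m)))"
      by (rule sum_mult_product[symmetric])
    finally show ?thesis .
  qed
  ultimately show ?thesis
    by (simp add: multiplet_def n_def m_def)
qed

context cstar_action
begin

lemma full_multiplet_trivial: "full_multiplet \<alpha> (\<lambda>g. 1\<^sub>m 1) (\<lambda>i. 1)"
  by (simp add: full_multiplet_def multiplet_def action_one)

lemma multiplet_endo_fixed:
  assumes "unitary_rep U" "multiplet \<alpha> U \<phi>" "A \<in> fixed_algebra \<alpha>"
  shows "multiplet_endo (rep_dim U) \<phi> A \<in> fixed_algebra \<alpha>"
  unfolding multiplet_endo_def by (rule multiplet_sum_fixed[OF assms(1,2,2,3)])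

text \<open>
  The fixed element \<open>X = \<Sum>\<^sub>k \<xi>\<^sub>k \<eta>\<^sub>k\<^sup>*\<close> is an isometry with \<open>X \<eta>\<^sub>k = \<xi>\<^sub>k\<close>, and it commutes with \<open>z\<close>.
\<close>

lemma multiplet_twist_transfer:
  assumes U: "unitary_rep U" and \<xi>: "multiplet \<alpha> U \<xi>" and \<eta>: "full_multiplet \<alpha> U \<eta>"
    and z: "z \<in> center \<alpha>" and tw: "\<And>k. k < rep_dim U \<Longrightarrow> z * \<xi> k = \<xi> k * w"
  shows "z = multiplet_endo (rep_dim U) \<eta> w"
proof -
  define n where "n = rep_dim U"
  define X where "X = (\<Sum>k<n. \<xi> k * star (\<eta> k))"
  have \<eta>m: "multiplet \<alpha> U \<eta>" and supp: "(\<Sum>i<n. \<eta> i * star (\<eta> i)) = 1"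
    using \<eta> by (simp_all add: full_multiplet_def n_def)
  have Xf: "X \<in> fixed_algebra \<alpha>"
    using multiplet_sum_fixed[OF U \<xi> \<eta>m fixed_algebra_closed(5)] by (simp add: X_def n_def)
  have X\<xi>: "star X * \<xi> l = \<eta> l" if "l < n" for l
  proof -
    have "star X * \<xi> l = (\<Sum>k<n. \<eta> k * (star (\<xi> k) * \<xi> l))"
      by (simp add: X_def star_sum star_mult sum_distrib_right mult.assoc)
    also have "\<dots> = (\<Sum>k<n. if k = l then \<eta> k else 0)"
      using \<xi> that by (intro sum.cong refl) (simp add: multiplet_def n_def)
    finally show ?thesis
      using that by simp
  qed
  have "star X * (\<Sum>k<n. \<xi> k * a * star (\<eta> k)) = (\<Sum>k<n. \<eta> k * a * star (\<eta> k))" for a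
  proof -
    have "star X * (\<Sum>k<n. \<xi> k * a * star (\<eta> k)) = (\<Sum>k<n. star X * \<xi> k * a * star (\<eta> k))"
      by (simp add: sum_distrib_left mult.assoc)
    then show ?thesis
      by (simp add: X\<xi>)
  qed
  note * = this
  have XX: "star X * X = 1"
    using *[of 1] supp by (simp add: X_def)
  \<comment> \<open>The twist evaluates \<open>z * X\<close>; multiplying by \<open>star X\<close>
    then isolates z on one side and turns every \<open>\<xi> k\<close> into \<open>\<eta> k\<close>
    on the other.\<close>
  have "z * X = (\<Sum>k<n. \<xi> k * w * star (\<eta> k))"
    unfolding X_def sum_distrib_left using tw by (intro sum.cong refl) (simp add: n_def flip: mult.assoc)
  moreover have "z * X = X * z"
    by (rule center_commute[OF z Xf])
  ultimately have "star X * X * z = star X * (\<Sum>k<n. \<xi> k * w * star (\<eta> k))"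
    by (simp add: mult.assoc)
  then show ?thesis
    unfolding XX * by (simp add: multiplet_endo_def n_def)
qed

text \<open>Passing \<phi>_i turns z into z1, and passing \<psi>_j turns z1 into z2, so every
  combination of products \<phi>_i \<psi>_j turns z into z2. The hypotheses on z1 and z2 are twist
  relations, so that the lemma serves both for twists obtained from minimality and for twists read
  off from the endomorphisms.\<close>

lemma multiplet_twist_class_prod:
  assumes D: "D \<in> dual" "D\<^sub>1 \<in> dual" "D\<^sub>2 \<in> dual" and prod: "D \<in> class_prod D\<^sub>1 D\<^sub>2"
    and U: "U \<in> D" "U\<^sub>1 \<in> D\<^sub>1" "U\<^sub>2 \<in> D\<^sub>2"
    and m: "full_multiplet \<alpha> U \<eta>" "multiplet \<alpha> U\<^sub>1 \<phi>" "multiplet \<alpha> U\<^sub>2 \<psi>"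
    and z: "z \<in> center \<alpha>" and tw1: "\<And>i. i < rep_dim U\<^sub>1 \<Longrightarrow> z * \<phi> i = \<phi> i * z\<^sub>1"
    and tw2: "\<And>j. j < rep_dim U\<^sub>2 \<Longrightarrow> z\<^sub>1 * \<psi> j = \<psi> j * z\<^sub>2"
  shows "z = multiplet_endo (rep_dim U) \<eta> z\<^sub>2"
proof -
  note u = dual_memD(1)[OF D(1) U(1), THEN irreducible_rep_unitary]
    dual_memD(1)[OF D(2) U(2), THEN irreducible_rep_unitary] dual_memD(1)[OF D(3) U(3), THEN irreducible_rep_unitary]
  define m2 where "m2 = rep_dim U\<^sub>2"
  define \<theta> where "\<theta> = (\<lambda>p. \<phi> (p div m2) * \<psi> (p mod m2))"
  have \<theta>: "multiplet \<alpha> (tensor_rep U\<^sub>1 U\<^sub>2) \<theta>"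
    unfolding \<theta>_def m2_def by (rule multiplet_tensor[OF m(2,3) action_mult u(2,3)])
  obtain T where T: "isometric_intertwiner U (tensor_rep U\<^sub>1 U\<^sub>2) T"
    using prod class_prod_iff_embeds[OF D U] by (auto simp: embeds_def)
  have tw: "z * \<theta> p = \<theta> p * z\<^sub>2" if p: "p < rep_dim U\<^sub>1 * m2" for p
  proof -
    have "z * \<theta> p = z * \<phi> (p div m2) * \<psi> (p mod m2)"
      by (simp add: \<theta>_def mult.assoc)
    also have "\<dots> = \<phi> (p div m2) * (z\<^sub>1 * \<psi> (p mod m2))"
      using tw1[OF less_mult_imp_div_less[OF p]] by (simp add: mult.assoc)
    also have "\<dots> = \<theta> p * z\<^sub>2"
      using tw2[of "p mod m2"] less_mult_mod_less[OF p] by (simp add: \<theta>_def m2_def mult.assoc)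
    finally show ?thesis .
  qed
  show ?thesis
    by (rule multiplet_twist_transfer[OF u(1) multiplet_intertwiner[OF u(1) unitary_rep_tensor[OF u(2,3)] \<theta> T] m(1) z])
      (simp add: sum_distrib_left sum_distrib_right scaleC_mult_left scaleC_mult_right tw m2_def)
qed

end

locale minimal_cstar_action = cstar_action +
  assumes minimal: "commutant (fixed_algebra \<alpha>) = center \<alpha>"
begin

text \<open>
  Schur's lemma over the center: the matrix entries \<open>\<phi>\<^sub>i\<^sup>* X \<phi>\<^sub>j\<close> lie in the relative commutant of the
  fixed point algebra, hence in the center, and are therefore themselves invariant. So every linear
  functional turns them into a scalar matrix commuting with \<open>U\<close>.
\<close>

lemma multiplet_schur:
  assumes U: "irreducible_rep U" and \<phi>: "full_multiplet \<alpha> U \<phi>" and X: "X \<in> fixed_algebra \<alpha>"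
    and comm: "\<And>A. A \<in> fixed_algebra \<alpha> \<Longrightarrow>
      X * multiplet_endo (rep_dim U) \<phi> A = multiplet_endo (rep_dim U) \<phi> A * X"
  obtains w where "w \<in> center \<alpha>" "\<forall>j<rep_dim U. X * \<phi> j = \<phi> j * w"
proof -
  note Uu = irreducible_rep_unitary[OF U]
  define n where "n = rep_dim U"
  have n: "n > 0"
    using U by (simp add: irreducible_rep_def n_def)
  have m: "multiplet \<alpha> U \<phi>" and supp: "(\<Sum>i<n. \<phi> i * star (\<phi> i)) = 1"
    using \<phi> by (simp_all add: full_multiplet_def n_def)
  have orth: "star (\<phi> i) * \<phi> j = (if i = j then 1 else 0)" if "i < n" "j < n" for i j
    using m that by (simp add: multiplet_def n_def)
  have act: "\<alpha> g (\<phi> j) = (\<Sum>i<n. U g $$ (i, j) *\<^sub>C \<phi> i)" if "j < n" for g j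
    using m that by (simp add: multiplet_def n_def)
  have Uc: "U g \<in> carrier_mat n n" for g
    using unitary_rep_carrier[OF Uu] by (simp add: n_def)
  define w where "w i j = star (\<phi> i) * X * \<phi> j" for i j
  have wZ: "w i j \<in> center \<alpha>" if ij: "i < n" "j < n" for i j
  proof -
    have "w i j * A = A * w i j" if A: "A \<in> fixed_algebra \<alpha>" for A
    proof -
      define R where "R B = multiplet_endo n \<phi> B" for B
      have R: "R B * \<phi> k = \<phi> k * B" if "k < n" for B k
        using multiplet_endo_mult_right[OF m] that by (simp add: R_def n_def)
      have R': "star (\<phi> i) * R A = A * star (\<phi> i)"
      proof -
        have "star (R (star A) * \<phi> i) = star (\<phi> i * star A)"
          by (simp add: R ij)
        then show ?thesis
          by (simp add: star_mult R_def multiplet_endo_star)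
      qed
      have "w i j * A = star (\<phi> i) * (X * R A) * \<phi> j"
        by (simp add: w_def mult.assoc R ij)
      also have "X * R A = R A * X"
        using comm[OF A] by (simp add: R_def n_def)
      also have "star (\<phi> i) * (R A * X) * \<phi> j = (star (\<phi> i) * R A) * (X * \<phi> j)"
        by (simp add: mult.assoc)
      also have "\<dots> = A * w i j"
        unfolding R' by (simp add: w_def mult.assoc)
      finally show ?thesis .
    qed
    \<comment> \<open>Minimality turns commutation with the fixed point algebra into membership in
      the center, which also makes \<open>w i j\<close> invariant.\<close>
    then show ?thesis
      using minimal by (auto simp: commutant_def)
  qed
  have X\<phi>: "X * \<phi> j = (\<Sum>i<n. \<phi> i * w i j)" for j
  proof -
    have "X * \<phi> j = (\<Sum>i<n. \<phi> i * star (\<phi> i)) * (X * \<phi> j)"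
      by (simp add: supp)
    then show ?thesis
      by (simp add: w_def sum_distrib_right mult.assoc)
  qed
  \<comment> \<open>Two evaluations of \<open>star (\<phi> l) * (X * \<alpha> g (\<phi> j))\<close>:
    expanding \<alpha>_g(\<phi>_j) directly, or first moving X inside \<alpha>_g and using the
    invariance of the entries of w.\<close>
  have inter: "(\<Sum>k<n. U g $$ (k, j) *\<^sub>C w l k) = (\<Sum>i<n. U g $$ (l, i) *\<^sub>C w i j)"
    if lj: "l < n" "j < n" for g l j
  proof -
    have "(\<Sum>k<n. U g $$ (k, j) *\<^sub>C w l k) = star (\<phi> l) * (X * \<alpha> g (\<phi> j))"
      using lj by (simp add: act w_def sum_distrib_left scaleC_mult_right mult.assoc)
    also have "X * \<alpha> g (\<phi> j) = \<alpha> g (X * \<phi> j)"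
      using X by (simp add: action_mult fixed_algebra_def)
    also have "\<dots> = (\<Sum>i<n. \<alpha> g (\<phi> i) * w i j)"
      using wZ[THEN center_fixed] lj by (simp add: X\<phi> action_sum action_mult fixed_algebra_def)
    also have "star (\<phi> l) * \<dots> = (\<Sum>i<n. (\<Sum>k<n. U g $$ (k, i) *\<^sub>C (star (\<phi> l) * \<phi> k)) * w i j)"
      by (simp add: act sum_distrib_left sum_distrib_right scaleC_mult_right scaleC_mult_left mult.assoc)
    also have "\<dots> = (\<Sum>i<n. (\<Sum>k<n. if l = k then U g $$ (k, i) *\<^sub>C 1 else 0) * w i j)"
      using lj by (intro sum.cong refl arg_cong2[where f = times]) (simp add: orth)
    also have "\<dots> = (\<Sum>i<n. U g $$ (l, i) *\<^sub>C w i j)"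
      using lj by (simp add: scaleC_mult_left)
    finally show ?thesis .
  qed
  \<comment> \<open>Applying f entrywise turns \<open>inter\<close> into the statement that a
    complex matrix M commutes with every \<open>U g\<close>.\<close>
  have scalar: "f (w i j) = (if i = j then f (w 0 0) else 0)"
    if f: "\<And>a b. f (a + b) = f a + f b" "\<And>c a. f (c *\<^sub>C a) = c * f a" and ij: "i < n" "j < n"
    for f :: "'b \<Rightarrow> complex" and i j
  proof -
    have f0: "f 0 = 0"
      using f(2)[of 0 0] by simp
    have fsum: "f (\<Sum>i\<in>I. h i) = (\<Sum>i\<in>I. f (h i))" for I :: "nat set" and h
      by (induction I rule: infinite_finite_induct) (simp_all add: f f0)
    define M where "M = Matrix.mat n n (\<lambda>(i, j). f (w i j))"
    have Mc: "M \<in> carrier_mat n n"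
      by (simp add: M_def)
    have "M * U g = U g * M" for g
    proof (rule eq_matI)
      fix l j assume "l < dim_row (U g * M)" "j < dim_col (U g * M)"
      then have lj: "l < n" "j < n"
        using Uc[of g] Mc by auto
      have "(M * U g) $$ (l, j) = (\<Sum>k<n. f (w l k) * U g $$ (k, j))"
        using lj Uc[of g] Mc by (subst index_mult_mat_sum) (auto simp: M_def)
      also have "\<dots> = f (\<Sum>k<n. U g $$ (k, j) *\<^sub>C w l k)"
        by (simp add: fsum f mult.commute)
      also have "\<dots> = (\<Sum>i<n. U g $$ (l, i) * f (w i j))"
        unfolding inter[OF lj] by (simp add: fsum f)
      also have "\<dots> = (U g * M) $$ (l, j)"
        using lj Uc[of g] Mc by (subst index_mult_mat_sum) (auto simp: M_def)
      finally show "(M * U g) $$ (l, j) = (U g * M) $$ (l, j)" .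
    qed (use Uc[of g] Mc in auto)
    then have "intertwiner U U M"
      using Mc by (simp add: intertwiner_def n_def)
    then obtain c where c: "M = c \<cdot>\<^sub>m 1\<^sub>m n"
      using schur_scalar[OF U] unfolding n_def by blast
    have "f (w i j) = M $$ (i, j)" "f (w 0 0) = M $$ (0, 0)"
      using ij n by (simp_all add: M_def)
    then show ?thesis
      using ij n by (simp add: c)
  qed
  have w: "w i j = (if i = j then w 0 0 else 0)" if ij: "i < n" "j < n" for i j
  proof (rule ccontr)
    assume "w i j \<noteq> (if i = j then w 0 0 else 0)"
    then have "w i j - (if i = j then w 0 0 else 0) \<noteq> 0"
      by simp
    then obtain f :: "'b \<Rightarrow> complex" where f: "\<And>a b. f (a + b) = f a + f b" "\<And>c a. f (c *\<^sub>C a) = c * f a"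
      "f (w i j - (if i = j then w 0 0 else 0)) \<noteq> 0"
      by (rule complex_linear_functional_separates) blast
    have "f 0 = 0"
      using f(2)[of 0 0] by simp
    moreover have "f (a - b) = f a - f b" for a b
      using f(1)[of "a - b" b] by simp
    ultimately show False
      using f(3) scalar[OF f(1,2) ij] by (cases "i = j") simp_all
  qed
  have "X * \<phi> j = \<phi> j * w 0 0" if j: "j < n" for j
  proof -
    have "X * \<phi> j = (\<Sum>i<n. if i = j then \<phi> i * w 0 0 else 0)"
      unfolding X\<phi> by (intro sum.cong refl) (simp add: w[OF _ j])
    then show ?thesis
      using j by simp
  qed
  then show thesis
    using that[OF wZ[OF n n]] by (simp add: n_def)
qed

text \<open>The elements \<rho>(A) are invariant and so commute with z, which makes Schur's lemma
  over the center applicable; w is \<sigma>(z).\<close>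

lemma center_twist:
  assumes U: "irreducible_rep U" and \<phi>: "full_multiplet \<alpha> U \<phi>" and z: "z \<in> center \<alpha>"
  obtains w where "w \<in> center \<alpha>" "\<forall>j<rep_dim U. z * \<phi> j = \<phi> j * w"
proof (rule multiplet_schur[OF U \<phi> center_fixed[OF z]])
  fix A assume "A \<in> fixed_algebra \<alpha>"
  then have "multiplet_endo (rep_dim U) \<phi> A \<in> fixed_algebra \<alpha>"
    using multiplet_endo_fixed[OF irreducible_rep_unitary[OF U]] \<phi> by (simp add: full_multiplet_def)
  then show "z * multiplet_endo (rep_dim U) \<phi> A = multiplet_endo (rep_dim U) \<phi> A * z"
    by (rule center_commute[OF z])
qed (rule that)

end

section \<open>Automorphisms of the center\<close>

text \<open>Obtained as a subgroup of the group of bijections of S. For the inverse h of f, each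
  operation is checked by applying h to f of the same operation on values of h, as in h (f (h x + h
  y)) = h x + h y.\<close>

lemma group_aut_group:
  fixes S :: "'f::unital_cstar_algebra set"
  assumes add: "\<And>x y. x \<in> S \<Longrightarrow> y \<in> S \<Longrightarrow> x + y \<in> S" and mult: "\<And>x y. x \<in> S \<Longrightarrow> y \<in> S \<Longrightarrow> x * y \<in> S"
    and scale: "\<And>c x. x \<in> S \<Longrightarrow> c *\<^sub>C x \<in> S" and star: "\<And>x. x \<in> S \<Longrightarrow> star x \<in> S"
  shows "group (aut_group S)"
proof -
  have inS: "f x \<in> S" if "f \<in> Bij S" "x \<in> S" for f x
    using that by (auto simp: Bij_def bij_betw_def)
  have "subgroup (star_auts S) (BijGroup S)"
  proof (rule group.subgroupI[OF group_BijGroup])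
    show "star_auts S \<subseteq> carrier (BijGroup S)"
      by (auto simp: star_auts_def BijGroup_def)
    have "(\<lambda>x\<in>S. x) \<in> star_auts S"
      by (simp add: star_auts_def id_Bij assms)
    then show "star_auts S \<noteq> {}"
      by blast
  next
    fix f assume f: "f \<in> star_auts S"
    then have fB: "f \<in> Bij S"
      by (simp add: star_auts_def)
    define h where "h = inv_into S f"
    have hS: "h y \<in> S" and fh: "f (h y) = y" if "y \<in> S" for y
      using that fB by (auto simp: h_def Bij_def bij_betw_def inv_into_into f_inv_into_f)
    have hf: "h (f x) = x" if "x \<in> S" for x
      using that fB by (auto simp: h_def Bij_def bij_betw_def)
    have fops: "f (x + y) = f x + f y" "f (x * y) = f x * f y" "f (c *\<^sub>C x) = c *\<^sub>C f x" "f (star x) = star (f x)"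
      if "x \<in> S" "y \<in> S" for x y c
      using f that by (auto simp: star_auts_def)
    have "h (x + y) = h x + h y" "h (x * y) = h x * h y" "h (c *\<^sub>C x) = c *\<^sub>C h x" "h (star x) = star (h x)"
      if "x \<in> S" "y \<in> S" for x y c
    proof -
      have "h (f (h x + h y)) = h x + h y" "h (f (h x * h y)) = h x * h y"
        "h (f (c *\<^sub>C h x)) = c *\<^sub>C h x" "h (f (star (h x))) = star (h x)"
        using that by (auto intro!: hf hS add mult scale star)
      then show "h (x + y) = h x + h y" "h (x * y) = h x * h y" "h (c *\<^sub>C x) = c *\<^sub>C h x" "h (star x) = star (h x)"
        using that by (simp_all add: fops hS fh)
    qed
    then have "(\<lambda>x\<in>S. h x) \<in> star_auts S"
      using restrict_inv_into_Bij[OF fB] assms by (auto simp: star_auts_def h_def)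
    then show "inv\<^bsub>BijGroup S\<^esub> f \<in> star_auts S"
      by (simp add: inv_BijGroup[OF fB] h_def)
  next
    fix f h assume fh: "f \<in> star_auts S" "h \<in> star_auts S"
    then have B: "f \<in> Bij S" "h \<in> Bij S"
      by (auto simp: star_auts_def)
    have "compose S f h \<in> star_auts S"
      using fh assms compose_Bij[OF B] inS[OF B(2)] by (auto simp: star_auts_def compose_def)
    then show "f \<otimes>\<^bsub>BijGroup S\<^esub> h \<in> star_auts S"
      using B by (simp add: BijGroup_def)
  qed
  then show ?thesis
    unfolding aut_group_def by (rule subgroup.subgroup_is_group[OF _ group_BijGroup])
qed

lemma aut_group_mult:
  "f \<in> star_auts S \<Longrightarrow> h \<in> star_auts S \<Longrightarrow> f \<otimes>\<^bsub>aut_group S\<^esub> h = compose S f h"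
  by (simp add: aut_group_def BijGroup_def star_auts_def)

lemma carrier_aut_group: "carrier (aut_group S) = star_auts S"
  by (simp add: aut_group_def)

locale spectral_system = minimal_cstar_action \<alpha>
  for \<alpha> :: "'g::{topological_group_add, t2_space} \<Rightarrow> 'f::unital_cstar_algebra \<Rightarrow> 'f" +
  fixes H :: "'g rep set \<Rightarrow> 'f set"
  assumes spectral: "D \<in> dual \<Longrightarrow> spectral_hilbert_space \<alpha> D (H D)"
begin

lemma class_multiplet:
  assumes "D \<in> dual"
  obtains U \<phi> where "U \<in> D" "irreducible_rep U" "full_multiplet \<alpha> U \<phi>"
    "canonical_endo (H D) = multiplet_endo (rep_dim U) \<phi>"
proof -
  obtain U \<phi> where *: "U \<in> D" "full_multiplet \<alpha> U \<phi>"
    "\<forall>A. canonical_endo (H D) A = (\<Sum>i<rep_dim U. \<phi> i * A * star (\<phi> i))"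
    by (rule spectral_hilbert_space_multiplet[OF spectral[OF assms]])
  then show thesis
    using that[OF *(1) dual_memD(1)[OF assms *(1)] *(2)] by (simp add: multiplet_endo_def fun_eq_iff)
qed

text \<open>Moving w through multiplets of the conjugate class E and then of D yields central
  elements v and u. Since the trivial class occurs in E x D, u equals w; hence v \<phi>_j = \<phi>_j
  w, and the image of w is the central element v.\<close>

lemma canonical_endo_center:
  assumes D: "D \<in> dual" and w: "w \<in> center \<alpha>"
  shows "canonical_endo (H D) w \<in> center \<alpha>"
proof -
  obtain E where E: "E \<in> dual" "trivial_class \<in> class_prod E D"
    by (rule class_prod_conjugate[OF D])
  obtain U \<phi> where U: "U \<in> D" "irreducible_rep U" "full_multiplet \<alpha> U \<phi>"
    "canonical_endo (H D) = multiplet_endo (rep_dim U) \<phi>"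
    by (rule class_multiplet[OF D])
  obtain V \<psi> where V: "V \<in> E" "irreducible_rep V" "full_multiplet \<alpha> V \<psi>"
    by (rule class_multiplet[OF E(1)])
  obtain v where v: "v \<in> center \<alpha>" "\<forall>j<rep_dim V. w * \<psi> j = \<psi> j * v"
    by (rule center_twist[OF V(2,3) w])
  obtain u where u: "u \<in> center \<alpha>" "\<forall>j<rep_dim U. v * \<phi> j = \<phi> j * u"
    by (rule center_twist[OF U(2,3) v(1)])
  have m: "multiplet \<alpha> V \<psi>" "multiplet \<alpha> U \<phi>"
    using U V by (simp_all add: full_multiplet_def)
  \<comment> \<open>The trivial representation carries the multiplet consisting of the unit alone,
    whose endomorphism is the identity.\<close>
  have "w = multiplet_endo (rep_dim (\<lambda>g :: 'g. 1\<^sub>m 1)) (\<lambda>i. 1) u"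
    by (rule multiplet_twist_class_prod[OF trivial_class_mem(2) E(1) D E(2) trivial_class_mem(1) V(1) U(1)
          full_multiplet_trivial m w v(2)[rule_format] u(2)[rule_format]])
  then have "w = u"
    by (simp add: multiplet_endo_def)
  then have "v = canonical_endo (H D) w"
    using multiplet_endo_eqI[OF U(3), of v w] u(2) U(4) by simp
  then show ?thesis
    using v by simp
qed

text \<open>Injectivity comes from cancelling an isometry, the image stays in the center by
  \<open>canonical_endo_center\<close>, and every central z is reached as
  \<rho>(\<sigma>(z)).\<close>

lemma class_aut_mem: 
  assumes D: "D \<in> dual"
  shows "class_aut \<alpha> H D \<in> star_auts (center \<alpha>)"
proof -
  obtain U \<phi> where U: "U \<in> D" "irreducible_rep U" "full_multiplet \<alpha> U \<phi>"
    and \<rho>: "canonical_endo (H D) = multiplet_endo (rep_dim U) \<phi>"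
    by (rule class_multiplet[OF D])
  have m: "multiplet \<alpha> U \<phi>" and n: "0 < rep_dim U"
    using U by (simp_all add: full_multiplet_def irreducible_rep_def)
  have "bij_betw (class_aut \<alpha> H D) (center \<alpha>) (center \<alpha>)"
    unfolding bij_betw_def
  proof (intro conjI equalityI subsetI)
    show "inj_on (class_aut \<alpha> H D) (center \<alpha>)"
      using multiplet_endo_inj[OF m n] by (auto simp: inj_on_def class_aut_def \<rho>)
  next
    fix z assume "z \<in> class_aut \<alpha> H D ` center \<alpha>"
    then show "z \<in> center \<alpha>"
      using canonical_endo_center[OF D] by (auto simp: class_aut_def)
  next
    fix z assume z: "z \<in> center \<alpha>"
    obtain w where w: "w \<in> center \<alpha>" "\<forall>j<rep_dim U. z * \<phi> j = \<phi> j * w"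
      by (rule center_twist[OF U(2,3) z])
    then have "z = class_aut \<alpha> H D w"
      using multiplet_endo_eqI[OF U(3) w(2)[rule_format]] by (simp add: class_aut_def \<rho>)
    then show "z \<in> class_aut \<alpha> H D ` center \<alpha>"
      using w by blast
  qed
  then have "class_aut \<alpha> H D \<in> Bij (center \<alpha>)"
    by (simp add: Bij_def class_aut_def)
  then show ?thesis
    by (simp add: star_auts_def class_aut_def center_add center_mult center_scaleC center_star \<rho>
        multiplet_endo_add multiplet_endo_mult[OF U(3)] multiplet_endo_scaleC multiplet_endo_star)
qed

text \<open>For central w the element \<rho>1(\<rho>2(w)) becomes \<rho>2(w) after passing \<phi>
  and w after passing \<psi>, so \<open>multiplet_twist_class_prod\<close> identifies it with the
  image of w under the endomorphism of D.\<close>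

lemma class_aut_class_prod:
  assumes D: "D\<^sub>1 \<in> dual" "D\<^sub>2 \<in> dual" and prod: "D \<in> class_prod D\<^sub>1 D\<^sub>2"
  shows "class_aut \<alpha> H D = compose (center \<alpha>) (class_aut \<alpha> H D\<^sub>1) (class_aut \<alpha> H D\<^sub>2)"
proof -
  have Dd: "D \<in> dual"
    using prod class_prod_subset_dual by blast
  obtain U \<eta> where U: "U \<in> D" "irreducible_rep U" "full_multiplet \<alpha> U \<eta>"
    "canonical_endo (H D) = multiplet_endo (rep_dim U) \<eta>"
    by (rule class_multiplet[OF Dd])
  obtain U1 \<phi> where U1: "U1 \<in> D\<^sub>1" "irreducible_rep U1" "full_multiplet \<alpha> U1 \<phi>"
    "canonical_endo (H D\<^sub>1) = multiplet_endo (rep_dim U1) \<phi>"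
    by (rule class_multiplet[OF D(1)])
  obtain U2 \<psi> where U2: "U2 \<in> D\<^sub>2" "irreducible_rep U2" "full_multiplet \<alpha> U2 \<psi>"
    "canonical_endo (H D\<^sub>2) = multiplet_endo (rep_dim U2) \<psi>"
    by (rule class_multiplet[OF D(2)])
  have m: "multiplet \<alpha> U1 \<phi>" "multiplet \<alpha> U2 \<psi>"
    using U1 U2 by (simp_all add: full_multiplet_def)
  have "canonical_endo (H D\<^sub>1) (canonical_endo (H D\<^sub>2) w) = canonical_endo (H D) w" if w: "w \<in> center \<alpha>" for w
    unfolding U(4)
  proof (rule multiplet_twist_class_prod[OF Dd D prod U(1) U1(1) U2(1) U(3) m])
    show "canonical_endo (H D\<^sub>1) (canonical_endo (H D\<^sub>2) w) \<in> center \<alpha>"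
      by (intro canonical_endo_center D w)
  next
    fix i assume "i < rep_dim U1"
    then show "canonical_endo (H D\<^sub>1) (canonical_endo (H D\<^sub>2) w) * \<phi> i = \<phi> i * canonical_endo (H D\<^sub>2) w"
      unfolding U1(4) by (rule multiplet_endo_mult_right[OF m(1)])
  next
    fix j assume "j < rep_dim U2"
    then show "canonical_endo (H D\<^sub>2) w * \<psi> j = \<psi> j * w"
      unfolding U2(4) by (rule multiplet_endo_mult_right[OF m(2)])
  qed
  then show ?thesis
    using canonical_endo_center[OF D(2)] by (auto simp: class_aut_def compose_def restrict_def)
qed

text \<open>Every constituent of a product of classes has as automorphism the composition of those
  of the factors, in order. The induction removes the last factor, which both constituents
  share.\<close>

lemma class_aut_chain_equiv:
  assumes "chain_equiv D D'"
  shows "class_aut \<alpha> H D = class_aut \<alpha> H D'"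
proof -
  have "class_aut \<alpha> H D = class_aut \<alpha> H D'"
    if "E \<in> dual" "set Es \<subseteq> dual" "D \<in> class_prods E Es" "D' \<in> class_prods E Es" for E Es D D'
    using that(2-4)
  proof (induction Es arbitrary: D D' rule: rev_induct)
    case Nil
    then show ?case
      by (simp add: class_prods_Nil)
  next
    case (snoc F Es)
    obtain X X' where X: "X \<in> class_prods E Es" "D \<in> class_prod X F" "X' \<in> class_prods E Es" "D' \<in> class_prod X' F"
      using snoc.prems by (auto simp: class_prods_snoc class_set_prod_def)
    then have "X \<in> dual" "X' \<in> dual"
      using class_prods_subset_dual[OF that(1)] by auto
    then show ?case
      using class_aut_class_prod[of X F D] class_aut_class_prod[of X' F D'] X snoc.IH[OF _ X(1,3)] snoc.prems by simp
  qed
  then show ?thesis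
    using assms by (meson chain_equivE)
qed

lemma chain_aut_chain_class:
  assumes "D \<in> dual"
  shows "chain_aut \<alpha> H (chain_class D) = class_aut \<alpha> H D"
proof -
  have "class_aut \<alpha> H E = class_aut \<alpha> H D" if "E \<in> chain_class D" for E
    using class_aut_chain_equiv[of D E] that by (simp add: chain_class_mem)
  moreover have "D \<in> chain_class D"
    using chain_equiv_refl[OF assms] by (simp add: chain_class_mem)
  ultimately have "class_aut \<alpha> H ` chain_class D = {class_aut \<alpha> H D}"
    by blast
  then show ?thesis
    by (simp add: chain_aut_def)
qed

lemma group_aut_group_center: "group (aut_group (center \<alpha>))"
  by (intro group_aut_group center_add center_mult center_scaleC center_star)

lemma chain_aut_hom: "chain_aut \<alpha> H \<in> hom chain_group (aut_group (center \<alpha>))"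
proof (rule homI)
  fix x assume "x \<in> carrier (chain_group :: 'g rep set set monoid)"
  then show "chain_aut \<alpha> H x \<in> carrier (aut_group (center \<alpha>))"
    using class_aut_mem chain_aut_chain_class by (auto simp: carrier_aut_group elim!: carrier_chain_groupE)
next
  fix x y :: "'g rep set set"
  assume "x \<in> carrier chain_group" "y \<in> carrier chain_group"
  then obtain D E where D: "D \<in> dual" "E \<in> dual" and xy: "x = chain_class D" "y = chain_class E"
    by (meson carrier_chain_groupE)
  obtain F where F: "F \<in> class_prod D E"
    using class_prod_nonempty[OF D] by blast
  then have Fd: "F \<in> dual"
    using class_prod_subset_dual by blast
  show "chain_aut \<alpha> H (x \<otimes>\<^bsub>chain_group\<^esub> y) = chain_aut \<alpha> H x \<otimes>\<^bsub>aut_group (center \<alpha>)\<^esub> chain_aut \<alpha> H y"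
    unfolding xy chain_group_mult[OF D F] chain_aut_chain_class[OF D(1)] chain_aut_chain_class[OF D(2)]
      chain_aut_chain_class[OF Fd] aut_group_mult[OF class_aut_mem[OF D(1)] class_aut_mem[OF D(2)]]
    by (rule class_aut_class_prod[OF D F])
qed

text \<open>Applied to a self-intertwiner X instead of a central element,
  \<open>multiplet_schur\<close> gives a central w with X = \<rho>(w). The converse inclusion holds
  because \<rho> is multiplicative and preserves the fixed point algebra.\<close>

lemma irreducible_canonical_endo:
  assumes D: "D \<in> dual"
  shows "irreducible_endo \<alpha> (canonical_endo (H D))"
proof -
  obtain U \<phi> where U: "U \<in> D" "irreducible_rep U" "full_multiplet \<alpha> U \<phi>"
    and \<rho>: "canonical_endo (H D) = multiplet_endo (rep_dim U) \<phi>"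
    by (rule class_multiplet[OF D])
  have m: "multiplet \<alpha> U \<phi>"
    using U by (simp add: full_multiplet_def)
  have "self_intertwiners \<alpha> (canonical_endo (H D)) = canonical_endo (H D) ` center \<alpha>"
    unfolding \<rho>
  proof (intro equalityI subsetI)
    fix X assume "X \<in> self_intertwiners \<alpha> (multiplet_endo (rep_dim U) \<phi>)"
    then have X: "X \<in> fixed_algebra \<alpha>" "\<And>A. A \<in> fixed_algebra \<alpha> \<Longrightarrow>
        X * multiplet_endo (rep_dim U) \<phi> A = multiplet_endo (rep_dim U) \<phi> A * X"
      by (auto simp: self_intertwiners_def)
    obtain w where "w \<in> center \<alpha>" "\<forall>j<rep_dim U. X * \<phi> j = \<phi> j * w"
      by (rule multiplet_schur[OF U(2,3) X])
    then show "X \<in> multiplet_endo (rep_dim U) \<phi> ` center \<alpha>"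
      using multiplet_endo_eqI[OF U(3)] by blast
  next
    fix X assume "X \<in> multiplet_endo (rep_dim U) \<phi> ` center \<alpha>"
    then obtain w where w: "w \<in> center \<alpha>" and X: "X = multiplet_endo (rep_dim U) \<phi> w"
      by blast
    have "X * multiplet_endo (rep_dim U) \<phi> A = multiplet_endo (rep_dim U) \<phi> A * X"
      if "A \<in> fixed_algebra \<alpha>" for A
      using center_commute[OF w that] by (simp add: X flip: multiplet_endo_mult[OF U(3)])
    moreover have "X \<in> fixed_algebra \<alpha>"
      unfolding X by (rule multiplet_endo_fixed[OF irreducible_rep_unitary[OF U(2)] m center_fixed[OF w]])
    ultimately show "X \<in> self_intertwiners \<alpha> (multiplet_endo (rep_dim U) \<phi>)"
      by (simp add: self_intertwiners_def)
  qed
  then show ?thesis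
    by (simp add: irreducible_endo_def)
qed

text \<open>Membership in \<open>star_auts\<close> lets the generator survive the intersection with
  the carrier in \<open>subgroup_generated\<close>.\<close>

lemma class_aut_irreducible:
  assumes D: "D \<in> dual"
  shows "class_aut \<alpha> H D \<in> carrier (irreducible_aut_group \<alpha>)"
proof -
  have "class_aut \<alpha> H D \<in> {restrict (canonical_endo H) (center \<alpha>) | H.
      invariant_hilbert_space \<alpha> H \<and> irreducible_endo \<alpha> (canonical_endo H)}"
    using spectral[OF D] irreducible_canonical_endo[OF D]
    by (auto simp: class_aut_def spectral_hilbert_space_def)
  then show ?thesis
    unfolding irreducible_aut_group_def carrier_subgroup_generated
    using class_aut_mem[OF D] by (intro generate.incl) (simp add: carrier_aut_group)
qed

lemma group_hom_chain_aut:
  "group_hom chain_group (aut_group (center \<alpha>)) (chain_aut \<alpha> H)"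
  by (intro group_hom.intro group_hom_axioms.intro group_chain_group group_aut_group_center chain_aut_hom)

lemma group_hom_chain_aut_irreducible:
  "group_hom chain_group (irreducible_aut_group \<alpha>) (chain_aut \<alpha> H)"
proof (intro group_hom.intro group_hom_axioms.intro group_chain_group homI)
  show "group (irreducible_aut_group \<alpha>)"
    unfolding irreducible_aut_group_def by (rule group.group_subgroup_generated[OF group_aut_group_center])
next
  fix x assume "x \<in> carrier (chain_group :: 'g rep set set monoid)"
  then show "chain_aut \<alpha> H x \<in> carrier (irreducible_aut_group \<alpha>)"
    using class_aut_irreducible chain_aut_chain_class by (auto elim!: carrier_chain_groupE)
next
  fix x y :: "'g rep set set"
  assume "x \<in> carrier chain_group" "y \<in> carrier chain_group"
  then show "chain_aut \<alpha> H (x \<otimes>\<^bsub>chain_group\<^esub> y) = chain_aut \<alpha> H x \<otimes>\<^bsub>irreducible_aut_group \<alpha>\<^esub> chain_aut \<alpha> H y"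
    using hom_mult[OF chain_aut_hom] by (simp add: irreducible_aut_group_def)
qed

end

theorem theorem5p7:
  fixes \<alpha> :: "'g::{topological_group_add, t2_space} \<Rightarrow> 'f::unital_cstar_algebra \<Rightarrow> 'f"
    and H :: "'g rep set \<Rightarrow> 'f set"
  assumes "hilbert_cstar_system \<alpha>"
    and "minimal_system \<alpha>"
    and "\<exists>g h :: 'g. g + h \<noteq> h + g"
    and "property_B (fixed_algebra \<alpha>)"
    and "\<forall>D\<in>dual. spectral_hilbert_space \<alpha> D (H D)"
  shows "(\<forall>D\<in>dual. \<forall>D'\<in>dual. chain_equiv D D' \<longrightarrow> class_aut \<alpha> H D = class_aut \<alpha> H D') \<and>
    (\<forall>D\<in>dual. chain_aut \<alpha> H (chain_class D) = class_aut \<alpha> H D \<and>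
       class_aut \<alpha> H D \<in> carrier (aut_group (center \<alpha>))) \<and>
    group_hom chain_group (aut_group (center \<alpha>)) (chain_aut \<alpha> H) \<and>
    group_hom chain_group (irreducible_aut_group \<alpha>) (chain_aut \<alpha> H)"
proof -
  interpret spectral_system \<alpha> H
  proof unfold_locales
    show "\<alpha> g \<in> star_auts UNIV" for g
      using assms(1) by (simp add: hilbert_cstar_system_def compact_group_action_def)
    show "commutant (fixed_algebra \<alpha>) = center \<alpha>"
      using assms(2) by (simp add: minimal_system_def)
    show "spectral_hilbert_space \<alpha> D (H D)" if "D \<in> dual" for D
      using assms(5) that by (rule bspec)
  qed
  show ?thesis
    unfolding carrier_aut_group
    by (intro conjI ballI impI class_aut_chain_equiv chain_aut_chain_class class_aut_mem
        group_hom_chain_aut group_hom_chain_aut_irreducible)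
qed

end
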